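(* Let $L$ be a well-defined IPS generator with semigroup $(P^L_t)_{t\ge0}$ which satisfies conditions (i), (ii), (iii) and (iv) of the context. Assume further that $L$ is irreducible and admits a reversible Gibbs measure $\mu\in\mathcal{G}(\gamma)$ which is translation invariant and asymptotically decoupled, where $\gamma$ is a translation-invariant, non-null and quasilocal specification. Then, for any $\nu\in\mathcal{P}_\theta$ and any sequence of times $t_n\uparrow\infty$ such that $(\nu P^L_{t_n})_{n\in\mathbb{N}}$ converges weakly to $\nu_*$, we have $\nu_*\in\mathcal{G}(\gamma)$.
   Context: **Configurations and measures.** Fix integers $d,q\ge1$; $\Omega=\{1,\dots,q\}^{\mathbb{Z}^d}$ carries the product topology and Borel $\sigma$-algebra $\mathcal{F}$. $\mathcal{P}_\theta$ is the set of translation-invariant probability measures on $\Omega$, with the weak topology. $\Lambda\Subset\mathbb{Z}^d$ means that $\Lambda$ is a finite nonempty subset; $\Lambda^c=\mathbb{Z}^d\setminus\Lambda$; $o$ is the origin; $\eta_\Lambda$ is the restriction of $\eta$ to $\Lambda$, and $\eta_\Lambda\xi_\Delta$ is concatenation for disjoint $\Lambda,\Delta$. $1_{\eta_\Lambda}$ is the indicator function of $\{\omega:\omega_\Lambda=\eta_\Lambda\}$, and $\nu(f)=\int f\,d\nu$. **Specifications.** A specification is a family $\gamma=(\gamma_\Lambda)_{\Lambda\Subset\mathbb{Z}^d}$ of probability kernels $\gamma_\Lambda(\cdot|\eta_{\Lambda^c})$ from $(\Omega,\mathcal{F}_{\Lambda^c})$ to $(\Omega,\mathcal{F})$ ($\mathcal{F}_{\Lambda^c}$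 the $\sigma$-algebra generated by the coordinates in $\Lambda^c$) that are proper ($\gamma_\Lambda(1_{\eta_\Lambda}1_{\eta_\Delta}|\eta_{\Lambda^c})=\gamma_\Lambda(1_{\eta_\Lambda}|\eta_{\Lambda^c})1_{\eta_\Delta}(\eta_{\Lambda^c})$ for $\Delta\subset\Lambda^c$) and consistent ($\gamma_\Lambda\gamma_\Delta=\gamma_\Lambda$ for $\Delta\subset\Lambda$). It is translation invariant if $\gamma_{\Lambda+i}(1_{\eta_{\Lambda+i}}|\eta_{(\Lambda+i)^c})=\gamma_\Lambda(1_{\eta_\Lambda}|\eta_{\Lambda^c})$ for all $\Lambda\Subset\mathbb{Z}^d$, $i\in\mathbb{Z}^d$ (configurations being translated along); non-null if $\inf_\eta\gamma_o(1_{\eta_o}|\eta_{o^c})\ge\delta$ for some $\delta>0$; quasilocal if for all $\Lambda\Subset\mathbb{Z}^d$, $\lim_{\Delta\uparrow\mathbb{Z}^d}\sup_{\eta,\xi}|\gamma_\Lambda(1_{\eta_\Lambda}|\eta_{\Delta\setminus\Lambda}\xi_{\Delta^c})-\gamma_\Lambda(1_{\eta_\Lambda}|\eta_{\Lambda^c})|=0$. $\mathcal{G}(\gamma)$ is the set of probability measures $\mu$ with $\mu(\gamma_\Lambda(1_{\eta_\Lambda}|\cdot))=\mu(1_{\eta_\Lambda})$ for all $\Lambda\Subset\mathbb{Z}^d$ and $\eta_\Lambda$ (DLR equation: Gibbs measures for $\gamma$). **Asymptotic decoupling.** With $V_n=[-n,n]^d\cap\mathbb{Z}^d$, $\mu$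 is asymptotically decoupled if there are $d(\cdot):\mathbb{N}\to\mathbb{N}$ and $c(\cdot):\mathbb{N}\to[0,\infty)$ with $d(n)/n\to0$, $c(n)/|V_n|\to0$ and $e^{-c(n)}\mu(A)\mu(B)\le\mu(A\cap B)\le e^{c(n)}\mu(A)\mu(B)$ for all $i\in\mathbb{Z}^d$, $n\in\mathbb{N}$, all events $A$ measurable w.r.t. the coordinates in $V_n+i$ and all $B$ measurable w.r.t. the coordinates in $(V_{n+d(n)}+i)^c$. **IPS.** An interacting particle system (IPS) is given by rates $c_\Delta(\eta,\xi_\Delta)\ge0$, $\Delta\Subset\mathbb{Z}^d$, $\xi_\Delta\in\{1,\dots,q\}^\Delta$, continuous in $\eta\in\Omega$, with generator $Lf(\eta)=\sum_{\Delta\Subset\mathbb{Z}^d}\sum_{\xi_\Delta}c_\Delta(\eta,\xi_\Delta)[f(\xi_\Delta\eta_{\Delta^c})-f(\eta)]$ (sums only over terms with positive rate). Put $c_\Delta(\eta)=\sum_{\xi_\Delta\ne\eta_\Delta}c_\Delta(\eta,\xi_\Delta)$ and $c_\Delta=\sup_\eta c_\Delta(\eta)$. It is well-defined if it satisfies Liggett's conditions $\sup_x\sum_{\Delta\ni x}c_\Delta<\infty$ and $\sup_x\sum_{u\neq x}\sum_{\Delta\ni x}\sup\{\sum_{\xi_\Delta}|c_\Delta(\eta,\xi_\Delta)-c_\Delta(\zeta,\xi_\Delta)|:\eta_y=\zeta_y\ \forall y\ne u\}<\infty$; then (the closure of) $L$ generates a unique Feller Markov semigroup $(P^L_t)_{t\ge0}$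 on $C(\Omega)$, and $\nu P_t^L$ denotes the time-evolved measure. A measure $\mu$ is reversible for $L$ if $\int f\,P^L_tg\,d\mu=\int g\,P^L_tf\,d\mu$ for all continuous $f,g$ and $t\ge0$. **Conditions on $L$.** (i) $L$ is translation invariant: all rates are translation invariant. (ii) Finitely many types of transitions: up to lattice translations, $c_\Delta>0$ for only finitely many $\Delta\Subset\mathbb{Z}^d$. (iii) Uniformly continuous rates: $\lim_{\Lambda\uparrow\mathbb{Z}^d}\sup_{\Delta\ni o}\sup_{\eta,\xi,\sigma}|c_\Delta(\eta_\Lambda\sigma_{\Lambda^c},\xi_\Delta)-c_\Delta(\eta,\xi_\Delta)|=0$. (iv) Strictly positive minimal transition rate: for all $\Delta$ with $c_\Delta>0$, $\inf_{\eta,\xi:\,c_\Delta(\eta,\xi_\Delta)>0}c_\Delta(\eta,\xi_\Delta)>0$. **Irreducibility.** $L$ is irreducible if for all $\eta^{(0)}\in\Omega$, $\Delta\Subset\mathbb{Z}^d$ and $\sigma\in\{1,\dots,q\}^\Delta$ there is a finite sequence of configurations $\eta^{(1)},\dots,\eta^{(n)}\in\Omega$ with $\eta^{(n)}=\eta^{(0)}_{\Delta^c}\sigma_\Delta$ such that for every $i\in\{1,\dots,n\}$ the transition rate to jump from $\eta^{(i-1)}$ to $\eta^{(i)}$ is positive. *)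

theory Defs
  imports "HOL-Probability.Probability"
begin

text \<open>The lattice of dimension \<open>d = CARD('d)\<close> is \<open>int ^ 'd\<close>; the \<open>q = CARD('q)\<close> spins form
  the type \<open>'q discrete\<close>, so that the topology that \<open>config\<close> inherits from the function type is the
  product of discrete topologies and \<open>borel\<close> is the Borel sigma-algebra of that product topology.\<close>

type_synonym 'd site = "(int, 'd) vec"
type_synonym ('d, 'q) config = "'d site \<Rightarrow> 'q discrete"
type_synonym ('d, 'q) cont = "('d, 'q) config \<Rightarrow>\<^sub>C real"

instance discrete :: (finite) finite
proof
  have "(UNIV :: 'a discrete set) = range discrete"
    by (metis surj_def of_discrete_inverse)
  then show "finite (UNIV :: 'a discrete set)"
    by (metis finite_imageI finite_class.finite_UNIV)
qed


section \<open>Configurations and measures\<close>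

definition volumes :: "('d::finite) site set set" where
  "volumes = {\<Lambda>. finite \<Lambda> \<and> \<Lambda> \<noteq> {}}"

definition translate :: "('d::finite) site \<Rightarrow> 'd site set \<Rightarrow> 'd site set" where
  "translate i \<Lambda> = (\<lambda>x. x + i) ` \<Lambda>"

definition shift :: "('d::finite) site \<Rightarrow> ('d, 'q) config \<Rightarrow> ('d, 'q) config" where
  "shift i \<omega> = (\<lambda>x. \<omega> (x - i))"

definition cyl :: "('d::finite) site set \<Rightarrow> ('d, 'q) config \<Rightarrow> ('d, 'q) config set" where
  "cyl \<Lambda> \<eta> = {\<omega>. \<forall>x\<in>\<Lambda>. \<omega> x = \<eta> x}"

text \<open>The sigma-algebra generated by the coordinates in \<open>\<Lambda>\<close>.\<close>

definition coord_algebra :: "('d::finite) site set \<Rightarrow> ('d, 'q::finite) config measure" where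
  "coord_algebra \<Lambda> = sigma UNIV {(\<lambda>\<omega>. \<omega> x) -` A | x A. x \<in> \<Lambda>}"

definition prob_measures :: "('d::finite, 'q::finite) config measure set" where
  "prob_measures = space (prob_algebra borel)"

definition translation_invariant_measure :: "('d::finite, 'q::finite) config measure \<Rightarrow> bool" where
  "translation_invariant_measure \<mu> \<longleftrightarrow> (\<forall>i. distr \<mu> borel (shift i) = \<mu>)"

definition weakly_converges ::
  "(nat \<Rightarrow> ('d::finite, 'q::finite) config measure) \<Rightarrow> ('d, 'q) config measure \<Rightarrow> bool" where
  "weakly_converges M N \<longleftrightarrow>
    (\<forall>f :: ('d, 'q) cont. (\<lambda>n. \<integral>\<omega>. apply_bcontfun f \<omega> \<partial>M n) \<longlonglongrightarrow> (\<integral>\<omega>. apply_bcontfun f \<omega> \<partial>N))"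

definition lattice_box :: "nat \<Rightarrow> ('d::finite) site set" where
  "lattice_box n = {x. \<forall>j. - int n \<le> x $ j \<and> x $ j \<le> int n}"

definition asymptotically_decoupled :: "('d::finite, 'q::finite) config measure \<Rightarrow> bool" where
  "asymptotically_decoupled \<mu> \<longleftrightarrow>
    (\<exists>(d :: nat \<Rightarrow> nat) (c :: nat \<Rightarrow> real).
      (\<forall>n. 0 \<le> c n) \<and>
      (\<lambda>n. real (d n) / real n) \<longlonglongrightarrow> 0 \<and>
      (\<lambda>n. c n / real (card (lattice_box n :: 'd site set))) \<longlonglongrightarrow> 0 \<and>
      (\<forall>i n. \<forall>A \<in> sets (coord_algebra (translate i (lattice_box n))).
             \<forall>B \<in> sets (coord_algebra (- translate i (lattice_box (n + d n)))).
        exp (- c n) * measure \<mu> A * measure \<mu> B \<le> measure \<mu> (A \<inter> B) \<and>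
        measure \<mu> (A \<inter> B) \<le> exp (c n) * measure \<mu> A * measure \<mu> B))"


section \<open>Gibbsian kernels and Gibbs measures\<close>

type_synonym ('d, 'q) kernels = "'d site set \<Rightarrow> ('d, 'q) config \<Rightarrow> ('d, 'q) config measure"

definition proper :: "('d::finite, 'q::finite) kernels \<Rightarrow> bool" where
  "proper \<gamma> \<longleftrightarrow>
    (\<forall>\<Lambda>\<in>volumes. \<forall>\<Delta> \<subseteq> - \<Lambda>. \<forall>\<eta> \<omega>.
      measure (\<gamma> \<Lambda> \<omega>) (cyl \<Lambda> \<eta> \<inter> cyl \<Delta> \<eta>) = measure (\<gamma> \<Lambda> \<omega>) (cyl \<Lambda> \<eta>) * indicator (cyl \<Delta> \<eta>) \<omega>)"

definition is_specification :: "('d::finite, 'q::finite) kernels \<Rightarrow> bool" where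
  "is_specification \<gamma> \<longleftrightarrow>
    (\<forall>\<Lambda>\<in>volumes. \<gamma> \<Lambda> \<in> coord_algebra (- \<Lambda>) \<rightarrow>\<^sub>M prob_algebra borel) \<and>
    proper \<gamma> \<and>
    (\<forall>\<Lambda>\<in>volumes. \<forall>\<Delta>\<in>volumes. \<Delta> \<subseteq> \<Lambda> \<longrightarrow> (\<forall>\<eta>. \<gamma> \<Lambda> \<eta> \<bind> \<gamma> \<Delta> = \<gamma> \<Lambda> \<eta>))"

text \<open>In the next three definitions one configuration \<open>\<eta>\<close> supplies both the event on \<open>\<Lambda>\<close> and the
  boundary condition off \<open>\<Lambda>\<close>; this loses nothing, because \<open>\<gamma> \<Lambda> \<eta>\<close> depends on \<open>\<eta>\<close> only off \<open>\<Lambda>\<close>.\<close>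

definition translation_invariant_spec :: "('d::finite, 'q::finite) kernels \<Rightarrow> bool" where
  "translation_invariant_spec \<gamma> \<longleftrightarrow>
    (\<forall>\<Lambda>\<in>volumes. \<forall>i \<eta>.
      measure (\<gamma> (translate i \<Lambda>) (shift i \<eta>)) (cyl (translate i \<Lambda>) (shift i \<eta>))
      = measure (\<gamma> \<Lambda> \<eta>) (cyl \<Lambda> \<eta>))"

definition non_null :: "('d::finite, 'q::finite) kernels \<Rightarrow> bool" where
  "non_null \<gamma> \<longleftrightarrow> (\<exists>\<delta>>0. (INF \<eta>. measure (\<gamma> {0} \<eta>) (cyl {0} \<eta>)) \<ge> \<delta>)"

text \<open>\<open>override_on \<xi> \<eta> \<Delta>\<close> is \<open>\<eta>\<close> on \<open>\<Delta>\<close> and \<open>\<xi>\<close> off \<open>\<Delta>\<close>.\<close>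

definition quasilocal :: "('d::finite, 'q::finite) kernels \<Rightarrow> bool" where
  "quasilocal \<gamma> \<longleftrightarrow>
    (\<forall>\<Lambda>\<in>volumes.
      ((\<lambda>\<Delta>. SUP (\<eta>, \<xi>). \<bar>measure (\<gamma> \<Lambda> (override_on \<xi> \<eta> \<Delta>)) (cyl \<Lambda> \<eta>) - measure (\<gamma> \<Lambda> \<eta>) (cyl \<Lambda> \<eta>)\<bar>)
        \<longlongrightarrow> 0) (finite_subsets_at_top UNIV))"

definition gibbs_measures :: "('d::finite, 'q::finite) kernels \<Rightarrow> ('d, 'q) config measure set" where
  "gibbs_measures \<gamma> =
    {\<mu> \<in> prob_measures.
      \<forall>\<Lambda>\<in>volumes. \<forall>\<eta>. (\<integral>\<omega>. measure (\<gamma> \<Lambda> \<omega>) (cyl \<Lambda> \<eta>) \<partial>\<mu>) = measure \<mu> (cyl \<Lambda> \<eta>)}"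


section \<open>Interacting particle systems\<close>

text \<open>\<open>c \<Delta> \<eta> \<xi>\<close> is the rate at which \<open>\<eta>\<close> is replaced by \<open>\<xi>\<close> on \<open>\<Delta>\<close>. It is only ever used for
  \<open>\<Delta> \<in> volumes\<close> and \<open>\<xi> \<in> patterns \<Delta>\<close>, where local configurations are functions that are
  \<open>undefined\<close> off \<open>\<Delta>\<close>; accordingly \<open>restrict \<eta> \<Delta>\<close> is the restriction of \<open>\<eta>\<close> to \<open>\<Delta>\<close>.\<close>

type_synonym ('d, 'q) rates = "'d site set \<Rightarrow> ('d, 'q) config \<Rightarrow> ('d, 'q) config \<Rightarrow> real"

definition patterns :: "('d::finite) site set \<Rightarrow> ('d, 'q) config set" where
  "patterns \<Delta> = (\<Pi>\<^sub>E x\<in>\<Delta>. UNIV)"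

definition ips_rates :: "('d::finite, 'q::finite) rates \<Rightarrow> bool" where
  "ips_rates c \<longleftrightarrow>
    (\<forall>\<Delta>\<in>volumes. \<forall>\<xi>\<in>patterns \<Delta>. (\<forall>\<eta>. 0 \<le> c \<Delta> \<eta> \<xi>) \<and> continuous_on UNIV (\<lambda>\<eta>. c \<Delta> \<eta> \<xi>))"

definition exit_rate :: "('d::finite, 'q::finite) rates \<Rightarrow> 'd site set \<Rightarrow> ('d, 'q) config \<Rightarrow> real" where
  "exit_rate c \<Delta> \<eta> = (\<Sum>\<xi>\<in>patterns \<Delta> - {restrict \<eta> \<Delta>}. c \<Delta> \<eta> \<xi>)"

definition max_rate :: "('d::finite, 'q::finite) rates \<Rightarrow> 'd site set \<Rightarrow> real" where
  "max_rate c \<Delta> = (SUP \<eta>. exit_rate c \<Delta> \<eta>)"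

definition rate_influence ::
  "('d::finite, 'q::finite) rates \<Rightarrow> 'd site set \<Rightarrow> 'd site \<Rightarrow> ennreal" where
  "rate_influence c \<Delta> u =
    (SUP (\<eta>, \<zeta>) \<in> {(\<eta>, \<zeta>). \<forall>y. y \<noteq> u \<longrightarrow> \<eta> y = \<zeta> y}.
      ennreal (\<Sum>\<xi>\<in>patterns \<Delta>. \<bar>c \<Delta> \<eta> \<xi> - c \<Delta> \<zeta> \<xi>\<bar>))"

definition well_defined_ips :: "('d::finite, 'q::finite) rates \<Rightarrow> bool" where
  "well_defined_ips c \<longleftrightarrow>
    ips_rates c \<and>
    (SUP x. \<Sum>\<^sub>\<infinity>\<Delta>\<in>{\<Delta>\<in>volumes. x \<in> \<Delta>}. ennreal (max_rate c \<Delta>)) < \<infinity> \<and>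
    (SUP x. \<Sum>\<^sub>\<infinity>u\<in>- {x}. \<Sum>\<^sub>\<infinity>\<Delta>\<in>{\<Delta>\<in>volumes. x \<in> \<Delta>}. rate_influence c \<Delta> u) < \<infinity>"

definition generator ::
  "('d::finite, 'q::finite) rates \<Rightarrow> (('d, 'q) config \<Rightarrow> real) \<Rightarrow> ('d, 'q) config \<Rightarrow> real" where
  "generator c f \<eta> =
    (\<Sum>\<^sub>\<infinity>\<Delta>\<in>volumes. \<Sum>\<xi>\<in>patterns \<Delta>. c \<Delta> \<eta> \<xi> * (f (override_on \<eta> \<xi> \<Delta>) - f \<eta>))"

definition oscillation :: "('d::finite, 'q::finite) cont \<Rightarrow> 'd site \<Rightarrow> real" where
  "oscillation f x =
    (SUP (\<eta>, \<zeta>) \<in> {(\<eta>, \<zeta>). \<forall>y. y \<noteq> x \<longrightarrow> \<eta> y = \<zeta> y}. \<bar>apply_bcontfun f \<eta> - apply_bcontfun f \<zeta>\<bar>)"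

text \<open>Liggett's domain for the pre-generator: the continuous functions of finite total oscillation.
  On it the series defining \<open>generator c\<close> converges absolutely under Liggett's conditions.\<close>

definition pregenerator_graph ::
  "('d::finite, 'q::finite) rates \<Rightarrow> (('d, 'q) cont \<times> ('d, 'q) cont) set" where
  "pregenerator_graph c = {(f, g).
      oscillation f summable_on UNIV \<and> (\<forall>\<eta>. apply_bcontfun g \<eta> = generator c (apply_bcontfun f) \<eta>)}"

text \<open>Operators are indexed by real times, but only nonnegative times are constrained.\<close>

definition feller_semigroup :: "(real \<Rightarrow> ('d::finite, 'q::finite) cont \<Rightarrow> ('d, 'q) cont) \<Rightarrow> bool" where
  "feller_semigroup P \<longleftrightarrow>
    (\<forall>t\<ge>0. linear (P t)) \<and>
    (\<forall>f. P 0 f = f) \<and>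
    (\<forall>s\<ge>0. \<forall>t\<ge>0. \<forall>f. P (s + t) f = P s (P t f)) \<and>
    (\<forall>f. continuous_on {0..} (\<lambda>t. P t f)) \<and>
    (\<forall>t\<ge>0. P t (const_bcontfun 1) = const_bcontfun 1) \<and>
    (\<forall>t\<ge>0. \<forall>f. (\<forall>\<eta>. 0 \<le> apply_bcontfun f \<eta>) \<longrightarrow> (\<forall>\<eta>. 0 \<le> apply_bcontfun (P t f) \<eta>))"

definition semigroup_generator_graph ::
  "(real \<Rightarrow> ('d::finite, 'q::finite) cont \<Rightarrow> ('d, 'q) cont) \<Rightarrow> (('d, 'q) cont \<times> ('d, 'q) cont) set" where
  "semigroup_generator_graph P =
    {(f, g). ((\<lambda>t. (1 / t) *\<^sub>R (P t f - f)) \<longlongrightarrow> g) (at_right 0)}"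

definition ips_semigroup ::
  "('d::finite, 'q::finite) rates \<Rightarrow> (real \<Rightarrow> ('d, 'q) cont \<Rightarrow> ('d, 'q) cont) \<Rightarrow> bool" where
  "ips_semigroup c P \<longleftrightarrow>
    feller_semigroup P \<and> semigroup_generator_graph P = closure (pregenerator_graph c)"

text \<open>\<open>\<nu>'\<close> is the time-evolved measure \<open>\<nu> P\<^sub>t\<close>. By the Riesz representation theorem there is
  exactly one such \<open>\<nu>'\<close>.\<close>

definition time_evolved ::
  "(real \<Rightarrow> ('d::finite, 'q::finite) cont \<Rightarrow> ('d, 'q) cont) \<Rightarrow> real \<Rightarrow>
    ('d, 'q) config measure \<Rightarrow> ('d, 'q) config measure \<Rightarrow> bool" where
  "time_evolved P t \<nu> \<nu>' \<longleftrightarrow>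
    \<nu>' \<in> prob_measures \<and>
    (\<forall>f. (\<integral>\<omega>. apply_bcontfun f \<omega> \<partial>\<nu>') = (\<integral>\<omega>. apply_bcontfun (P t f) \<omega> \<partial>\<nu>))"

definition reversible ::
  "(real \<Rightarrow> ('d::finite, 'q::finite) cont \<Rightarrow> ('d, 'q) cont) \<Rightarrow> ('d, 'q) config measure \<Rightarrow> bool" where
  "reversible P \<mu> \<longleftrightarrow>
    (\<forall>f g. \<forall>t\<ge>0.
      (\<integral>\<omega>. apply_bcontfun f \<omega> * apply_bcontfun (P t g) \<omega> \<partial>\<mu>) =
      (\<integral>\<omega>. apply_bcontfun g \<omega> * apply_bcontfun (P t f) \<omega> \<partial>\<mu>))"

definition translation_invariant_rates :: "('d::finite, 'q::finite) rates \<Rightarrow> bool" where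
  "translation_invariant_rates c \<longleftrightarrow>
    (\<forall>\<Delta>\<in>volumes. \<forall>\<xi>\<in>patterns \<Delta>. \<forall>i \<eta>. c (translate i \<Delta>) (shift i \<eta>) (shift i \<xi>) = c \<Delta> \<eta> \<xi>)"

definition finitely_many_types :: "('d::finite, 'q::finite) rates \<Rightarrow> bool" where
  "finitely_many_types c \<longleftrightarrow>
    (\<exists>\<D>. finite \<D> \<and> (\<forall>\<Delta>\<in>volumes. max_rate c \<Delta> > 0 \<longrightarrow> (\<exists>D\<in>\<D>. \<exists>i. \<Delta> = translate i D)))"

definition uniformly_continuous_rates :: "('d::finite, 'q::finite) rates \<Rightarrow> bool" where
  "uniformly_continuous_rates c \<longleftrightarrow>
    ((\<lambda>\<Lambda>. SUP \<Delta>\<in>{\<Delta>\<in>volumes. 0 \<in> \<Delta>}. SUP \<xi>\<in>patterns \<Delta>. SUP \<eta>. SUP \<sigma>.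
        ennreal \<bar>c \<Delta> (override_on \<sigma> \<eta> \<Lambda>) \<xi> - c \<Delta> \<eta> \<xi>\<bar>)
      \<longlongrightarrow> 0) (finite_subsets_at_top UNIV)"

definition positive_minimal_rates :: "('d::finite, 'q::finite) rates \<Rightarrow> bool" where
  "positive_minimal_rates c \<longleftrightarrow>
    (\<forall>\<Delta>\<in>volumes. max_rate c \<Delta> > 0 \<longrightarrow>
      (INF (\<eta>, \<xi>) \<in> {(\<eta>, \<xi>). \<xi> \<in> patterns \<Delta> \<and> c \<Delta> \<eta> \<xi> > 0}. c \<Delta> \<eta> \<xi>) > 0)"

definition can_jump ::
  "('d::finite, 'q::finite) rates \<Rightarrow> ('d, 'q) config \<Rightarrow> ('d, 'q) config \<Rightarrow> bool" where
  "can_jump c \<eta> \<zeta> \<longleftrightarrow>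
    (\<exists>\<Delta>\<in>volumes. \<exists>\<xi>\<in>patterns \<Delta>. c \<Delta> \<eta> \<xi> > 0 \<and> \<zeta> = override_on \<eta> \<xi> \<Delta>)"

definition irreducible_ips :: "('d::finite, 'q::finite) rates \<Rightarrow> bool" where
  "irreducible_ips c \<longleftrightarrow>
    (\<forall>\<eta>. \<forall>\<Delta>\<in>volumes. \<forall>\<sigma>\<in>patterns \<Delta>. (can_jump c)\<^sup>*\<^sup>* \<eta> (override_on \<eta> \<sigma> \<Delta>))"

end

theory Submission
  imports Defs
begin

text \<open>
  The proof combines entropy production in large boxes with a detailed balance argument.
  Replace \<open>\<nu>\<close> by the mixture of \<open>\<nu>\<close> and \<open>\<mu>\<close>: as \<open>\<mu>\<close> is stationary this commutes with the dynamics,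
  and non-nullness makes all cylinder probabilities positive. Let \<open>f\<close> be the density of the evolved
  mixture with respect to \<open>\<mu>\<close> on the coordinates in a box. The entropy relative to \<open>\<mu>\<close> in the box
  changes at rate \<open>\<Sum> F \<eta> \<eta>' * ln (f \<eta>' / f \<eta>)\<close>, where \<open>F \<eta> \<eta>'\<close> is the probability flux from the
  cylinder of \<open>\<eta>\<close> to that of \<open>\<eta>'\<close>. If \<open>\<eta>\<close> and \<open>\<eta>'\<close> differ deep inside the box, then \<open>F \<eta> \<eta>'\<close> is close,
  in ratio, to \<open>f \<eta>\<close> times the corresponding flux of \<open>\<mu>\<close>, which is symmetric by reversibility; here the
  positive minimal rates are needed. The remaining pairs contribute \<open>O(1)\<close> per boundary site, because
  \<open>x ln (y / x) \<le> y\<close>. Hence the entropy per site essentially decreases, and does so at a definite speed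
  as long as some net current of the evolved measure between two local patterns stays away from 0. If the
  limit had such a current, then so would the evolved measure on infinitely many time intervals of fixed
  length, although the entropy per site is bounded. So the limit is balanced: it has no local currents.

  For a balanced measure, moving along an allowed transition changes the measure by the ratio of the
  forward and backward rates. Since \<open>\<mu>\<close> is balanced too, this is the ratio of conditional probabilities
  under \<open>\<gamma>\<close>. By irreducibility and compactness every local change is a composition of such moves, with
  boundedly many sites involved, and summing over all local patterns gives the DLR equation.
\<close>

section \<open>Topology of the configuration space\<close>

text \<open>Two obstacles shape the proof. The dynamics seen in a box is not closed, as rates depend
  on spins outside. Errors in the fluxes must nevertheless be relative: an additive error would be
  multiplied by a logarithm that may be of the order of the volume. This would fail if a rate could
  vanish at one configuration and be tiny at a nearby one; minimal rates make nearby rates vanish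
  together. The error per site is small but not zero for a given box, and it accumulates in time.
  Hence the order of choices: the current fixes a gain \<open>c0\<close> per site and unit time,
  independent of the box; then a time T is taken by which the gains exceed the bound on the entropy
  per site; only then is the box taken so large that the error up to T stays below 1 per site. For
  the second half, vanishing currents are integrated statements. For \<mu> they become pointwise
  identities between rates and kernels by conditioning on growing boxes, where quasilocality yields
  the limit of cylinder ratios. Other balanced measures inherit the kernels from these identities by
  change-of-variable formulas.\<close>

lemma cyl_self [simp]: "\<omega> \<in> cyl \<Lambda> \<omega>"
  by (simp add: cyl_def)

lemma cyl_mono: "\<Delta> \<subseteq> \<Lambda> \<Longrightarrow> cyl \<Lambda> \<omega> \<subseteq> cyl \<Delta> \<omega>"
  by (auto simp: cyl_def)

lemma cyl_sym: "\<omega>' \<in> cyl \<Lambda> \<omega> \<Longrightarrow> \<omega> \<in> cyl \<Lambda> \<omega>'"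
  by (auto simp: cyl_def)

lemma cyl_cong: "\<omega>' \<in> cyl \<Lambda> \<omega> \<Longrightarrow> cyl \<Lambda> \<omega>' = cyl \<Lambda> \<omega>"
  by (auto simp: cyl_def)

section \<open>Compactness and uniform continuity\<close>

lemma compact_config: "compact (UNIV :: ('d::finite, 'q::finite) config set)"
proof -
  have "compact_space (product_topology (\<lambda>i::'d site. euclidean :: 'q discrete topology) UNIV)"
    unfolding compact_space_product_topology
    by (simp add: compact_space_def finite_imp_compact)
  then show ?thesis
    unfolding euclidean_product_topology by (simp add: compact_space_def)
qed

lemma closed_cyl: "closed (cyl \<Lambda> \<eta> :: ('d::finite, 'q::finite) config set)"
proof -
  have "cyl \<Lambda> \<eta> = (\<Inter>x\<in>\<Lambda>. (\<lambda>\<omega>. \<omega> x) -` {\<eta> x})"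
    by (auto simp: cyl_def)
  moreover have "closed ((\<lambda>\<omega>. \<omega> x) -` {\<eta> x} :: ('d, 'q) config set)" for x
    by (intro closed_vimage) auto
  ultimately show ?thesis by auto
qed

lemma open_cyl: "finite \<Lambda> \<Longrightarrow> open (cyl \<Lambda> \<eta> :: ('d::finite, 'q::finite) config set)"
proof -
  assume "finite \<Lambda>"
  have "cyl \<Lambda> \<eta> = (\<Inter>x\<in>\<Lambda>. (\<lambda>\<omega>. \<omega> x) -` {\<eta> x})"
    by (auto simp: cyl_def)
  moreover have "open ((\<lambda>\<omega>. \<omega> x) -` {\<eta> x} :: ('d, 'q) config set)" for x
    by (intro open_vimage) (auto simp: open_discrete)
  ultimately show ?thesis using \<open>finite \<Lambda>\<close> by auto
qed

lemma open_contains_cyl: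
  fixes U :: "('d::finite, 'q::finite) config set"
  assumes "open U" "\<omega> \<in> U"
  shows "\<exists>\<Lambda>. finite \<Lambda> \<and> cyl \<Lambda> \<omega> \<subseteq> U"
proof -
  have "openin (product_topology (\<lambda>i::'d site. euclidean :: 'q discrete topology) UNIV) U"
    using assms(1) by (simp add: euclidean_product_topology)
  from product_topology_open_contains_basis[OF this assms(2)]
  obtain X where X: "\<omega> \<in> Pi\<^sub>E UNIV X" "finite {i. X i \<noteq> UNIV}" "Pi\<^sub>E UNIV X \<subseteq> U"
    by auto
  have "cyl {i. X i \<noteq> UNIV} \<omega> \<subseteq> Pi\<^sub>E UNIV X"
    using X(1) by (fastforce simp: cyl_def PiE_def Pi_def)
  with X show ?thesis by blast
qed

text \<open>Compactness as it is used below: finitely many of the open cylinders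
  \<open>cyl (F \<omega>) \<omega>\<close> cover the space, so windows chosen pointwise fit into one
  finite volume.\<close>

lemma cyl_cover:
  fixes F :: "('d::finite, 'q::finite) config \<Rightarrow> 'd site set"
  assumes "\<And>\<omega>. finite (F \<omega>)"
  shows "\<exists>\<Lambda>. finite \<Lambda> \<and> (\<forall>\<omega>'. \<exists>\<omega>. \<omega>' \<in> cyl (F \<omega>) \<omega> \<and> F \<omega> \<subseteq> \<Lambda>)"
proof -
  have "\<exists>C. finite C \<and> UNIV \<subseteq> (\<Union>\<omega>\<in>C. cyl (F \<omega>) \<omega>)"
    by (rule compactE_image[OF compact_config, of UNIV "\<lambda>\<omega>. cyl (F \<omega>) \<omega>"])
       (use assms in \<open>auto intro!: open_cyl intro: cyl_self\<close>)
  then obtain C where C: "finite C" "UNIV \<subseteq> (\<Union>\<omega>\<in>C. cyl (F \<omega>) \<omega>)" by auto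
  show ?thesis
    by (rule exI[of _ "\<Union>(F ` C)"]) (use C assms in fastforce)
qed

text \<open>Cylinders over a common finite volume play the part of uniform neighbourhoods. Both
  configurations are compared with the centre of one covering cylinder, whence the tolerance
  \<open>e / 2\<close>.\<close>

lemma uniform_continuity:
  fixes f :: "('d::finite, 'q::finite) config \<Rightarrow> real"
  assumes "continuous_on UNIV f" "e > 0"
  shows "\<exists>\<Lambda>. finite \<Lambda> \<and> (\<forall>\<omega>. \<forall>\<omega>'\<in>cyl \<Lambda> \<omega>. \<bar>f \<omega>' - f \<omega>\<bar> < e)"
proof -
  have "\<exists>\<Lambda>. finite \<Lambda> \<and> (\<forall>\<omega>'\<in>cyl \<Lambda> \<omega>. \<bar>f \<omega>' - f \<omega>\<bar> < e / 2)" for \<omega>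
  proof -
    have "open (f -` ball (f \<omega>) (e / 2))"
      by (intro open_vimage assms) auto
    from open_contains_cyl[OF this, of \<omega>] assms(2) show ?thesis
      by (auto simp: subset_eq dist_real_def abs_minus_commute)
  qed
  then obtain F where F: "\<And>\<omega>. finite (F \<omega>)"
    "\<And>\<omega> \<omega>'. \<omega>' \<in> cyl (F \<omega>) \<omega> \<Longrightarrow> \<bar>f \<omega>' - f \<omega>\<bar> < e / 2" by metis
  obtain \<Lambda> where \<Lambda>: "finite \<Lambda>" "\<And>\<omega>'. \<exists>\<omega>. \<omega>' \<in> cyl (F \<omega>) \<omega> \<and> F \<omega> \<subseteq> \<Lambda>"
    using cyl_cover[of F] F by blast
  have "\<bar>f \<omega>' - f \<omega>\<bar> < e" if "\<omega>' \<in> cyl \<Lambda> \<omega>" for \<omega> \<omega>'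
  proof -
    obtain \<omega>0 where 0: "\<omega> \<in> cyl (F \<omega>0) \<omega>0" "F \<omega>0 \<subseteq> \<Lambda>" using \<Lambda>(2) by blast
    then have "\<omega>' \<in> cyl (F \<omega>0) \<omega>0"
      using that by (auto simp: cyl_def)
    from F(2)[OF 0(1)] F(2)[OF this] show ?thesis by linarith
  qed
  with \<Lambda>(1) show ?thesis by blast
qed

lemma continuous_on_local:
  fixes f :: "('d::finite, 'q::finite) config \<Rightarrow> 'b::topological_space"
  assumes "finite \<Lambda>" "\<And>\<omega> \<omega>'. \<omega>' \<in> cyl \<Lambda> \<omega> \<Longrightarrow> f \<omega>' = f \<omega>"
  shows "continuous_on UNIV f"
proof -
  have "open (f -` B)" for B
  proof -
    have "f -` B = (\<Union>\<omega>\<in>f -` B. cyl \<Lambda> \<omega>)"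
      using assms(2) by (auto intro: cyl_self)
    also have "open \<dots>"
      using open_cyl[OF assms(1)] by blast
    finally show ?thesis .
  qed
  then show ?thesis by (simp add: continuous_on_open_vimage)
qed

lemma continuous_on_indicator_cyl [continuous_intros]:
  "finite \<Lambda> \<Longrightarrow> continuous_on UNIV (indicator (cyl \<Lambda> \<eta>) :: ('d::finite, 'q::finite) config \<Rightarrow> real)"
  by (rule continuous_on_local[of \<Lambda>]) (auto simp: cyl_def indicator_def)

lemma continuous_on_override1: "continuous_on UNIV (\<lambda>\<eta>::('d::finite, 'q::finite) config. override_on \<eta> \<xi> \<Delta>)"
proof (rule continuous_on_coordinatewise_then_product)
  fix i show "continuous_on UNIV (\<lambda>\<eta>::('d, 'q) config. override_on \<eta> \<xi> \<Delta> i)"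
    by (cases "i \<in> \<Delta>") auto
qed

lemma continuous_on_compose_override1 [continuous_intros]:
  "continuous_on UNIV f \<Longrightarrow> continuous_on UNIV (\<lambda>\<eta>::('d::finite, 'q::finite) config. f (override_on \<eta> \<xi> \<Delta>))"
  using continuous_on_compose2[OF _ continuous_on_override1] by blast

lemma continuous_on_shift: "continuous_on UNIV (shift i :: ('d::finite, 'q::finite) config \<Rightarrow> _)"
  unfolding shift_def
  by (rule continuous_on_coordinatewise_then_product) auto

lemma continuous_on_compose_shift [continuous_intros]:
  "continuous_on UNIV f \<Longrightarrow> continuous_on UNIV (\<lambda>\<eta>::('d::finite, 'q::finite) config. f (shift i \<eta>))"
  using continuous_on_compose2[OF _ continuous_on_shift] by blast

lemma continuous_bounded:
  fixes f :: "('d::finite, 'q::finite) config \<Rightarrow> real"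
  assumes "continuous_on UNIV f"
  shows "\<exists>B. \<forall>\<omega>. \<bar>f \<omega>\<bar> \<le> B"
  using compact_imp_bounded[OF compact_continuous_image[OF assms compact_config]]
  by (auto simp: bounded_iff)

lemma continuous_in_bcontfun:
  fixes f :: "('d::finite, 'q::finite) config \<Rightarrow> real"
  shows "continuous_on UNIV f \<Longrightarrow> f \<in> bcontfun"
  using continuous_bounded[of f] by (metis bcontfun_normI real_norm_def)

lemma apply_Bcontfun [simp]:
  fixes f :: "('d::finite, 'q::finite) config \<Rightarrow> real"
  shows "continuous_on UNIV f \<Longrightarrow> apply_bcontfun (Bcontfun f) = f"
  by (simp add: Bcontfun_inverse continuous_in_bcontfun)

section \<open>Integrals of continuous functions\<close>

lemma prob_measuresD:
  assumes "M \<in> prob_measures"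
  shows "prob_space M" "sets M = sets borel" "space M = UNIV"
  using assms by (auto simp: prob_measures_def space_prob_algebra dest: sets_eq_imp_space_eq)

lemma integrable_continuous:
  fixes f :: "('d::finite, 'q::finite) config \<Rightarrow> real"
  assumes "M \<in> prob_measures" "continuous_on UNIV f"
  shows "integrable M f"
proof -
  interpret prob_space M using prob_measuresD[OF assms(1)] by simp
  obtain B where "\<forall>\<omega>. \<bar>f \<omega>\<bar> \<le> B" using continuous_bounded[OF assms(2)] by blast
  moreover have "f \<in> borel_measurable M"
    using borel_measurable_continuous_onI[OF assms(2)] measurable_cong_sets[OF prob_measuresD(2)[OF assms(1)] refl]
    by blast
  ultimately show ?thesis by (intro integrable_const_bound[of _ B]) auto
qed

lemma integral_indicator_cyl:
  assumes "M \<in> prob_measures" "finite \<Lambda>"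
  shows "(\<integral>\<omega>. indicator (cyl \<Lambda> \<eta>) \<omega> \<partial>M) = measure M (cyl \<Lambda> \<eta>)"
  using assms prob_measuresD[OF assms(1)] open_cyl[OF assms(2)] by simp

section \<open>Patterns and local approximation\<close>

lemma finite_patterns [simp]: "finite \<Lambda> \<Longrightarrow> finite (patterns \<Lambda> :: ('d::finite, 'q::finite) config set)"
  by (simp add: patterns_def finite_PiE)

lemma patterns_nonempty: "(patterns \<Lambda> :: ('d::finite, 'q::finite) config set) \<noteq> {}"
  by (simp add: patterns_def PiE_eq_empty_iff)

lemma card_patterns:
  "finite \<Lambda> \<Longrightarrow> card (patterns \<Lambda> :: ('d::finite, 'q::finite) config set) = CARD('q discrete) ^ card \<Lambda>"
  by (simp add: patterns_def card_PiE)

lemma restrict_patterns [simp]: "restrict \<omega> \<Lambda> \<in> patterns \<Lambda>"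
  by (simp add: patterns_def)

lemma patterns_eqI: "\<eta> \<in> patterns \<Lambda> \<Longrightarrow> \<eta>' \<in> patterns \<Lambda> \<Longrightarrow> (\<And>x. x \<in> \<Lambda> \<Longrightarrow> \<eta> x = \<eta>' x) \<Longrightarrow> \<eta> = \<eta>'"
  unfolding patterns_def by (rule PiE_ext) auto

lemma cyl_pattern_iff: "\<eta> \<in> patterns \<Lambda> \<Longrightarrow> \<omega> \<in> cyl \<Lambda> \<eta> \<longleftrightarrow> \<eta> = restrict \<omega> \<Lambda>"
  by (auto simp: cyl_def intro!: patterns_eqI)

lemma cyl_restrict [simp]: "cyl \<Lambda> (restrict \<omega> \<Lambda>) = cyl \<Lambda> \<omega>"
  by (auto simp: cyl_def)

text \<open>The cylinders of the patterns on \<Lambda> partition the space, so exactly one summand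
  survives.\<close>

lemma sum_indicator_cyl:
  fixes \<omega> :: "('d::finite, 'q::finite) config" and f :: "('d, 'q) config \<Rightarrow> real"
  assumes "finite \<Lambda>"
  shows "(\<Sum>\<eta>\<in>patterns \<Lambda>. f \<eta> * indicator (cyl \<Lambda> \<eta>) \<omega>) = f (restrict \<omega> \<Lambda>)"
proof -
  have "(\<Sum>\<eta>\<in>patterns \<Lambda>. f \<eta> * indicator (cyl \<Lambda> \<eta>) \<omega>) = (\<Sum>\<eta>\<in>patterns \<Lambda>. if restrict \<omega> \<Lambda> = \<eta> then f \<eta> else 0)"
    by (intro sum.cong refl) (auto simp: cyl_pattern_iff indicator_def)
  also have "\<dots> = f (restrict \<omega> \<Lambda>)"
    using assms by (simp add: sum.delta)
  finally show ?thesis .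
qed

text \<open>\<open>restrict \<omega> \<Lambda>'\<close> has the fixed value \<open>undefined\<close>
  off \<Lambda>', which acts as a boundary condition: the approximating function depends on the
  spins in \<Lambda>' only.\<close>

lemma local_approximation:
  fixes f :: "('d::finite, 'q::finite) config \<Rightarrow> real"
  assumes "continuous_on UNIV f" "e > 0"
  shows "\<exists>\<Lambda>. finite \<Lambda> \<and> (\<forall>\<Lambda>'. \<Lambda> \<subseteq> \<Lambda>' \<longrightarrow> (\<forall>\<omega>. \<bar>f \<omega> - f (restrict \<omega> \<Lambda>')\<bar> < e))"
proof -
  obtain \<Lambda> where \<Lambda>: "finite \<Lambda>" "\<And>\<omega> \<omega>'. \<omega>' \<in> cyl \<Lambda> \<omega> \<Longrightarrow> \<bar>f \<omega>' - f \<omega>\<bar> < e"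
    using uniform_continuity[OF assms] by blast
  show ?thesis
    by (rule exI[of _ \<Lambda>]) (use \<Lambda> in \<open>auto intro!: \<Lambda>(2) simp: cyl_def\<close>)
qed

section \<open>Boxes of the lattice\<close>

lemma finite_lattice_box [simp]: "finite (lattice_box n :: 'd::finite site set)"
proof -
  have "lattice_box n \<subseteq> (\<lambda>f. \<chi> j. f j) ` (\<Pi>\<^sub>E j\<in>(UNIV :: 'd set). {- int n..int n})"
  proof
    fix x :: "'d site" assume "x \<in> lattice_box n"
    then show "x \<in> (\<lambda>f. \<chi> j. f j) ` (\<Pi>\<^sub>E j\<in>(UNIV :: 'd set). {- int n..int n})"
      by (intro image_eqI[of _ _ "vec_nth x"]) (auto simp: lattice_box_def)
  qed
  then show ?thesis
    by (rule finite_subset) (auto intro!: finite_imageI finite_PiE)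
qed

lemma card_lattice_box: "card (lattice_box n :: 'd::finite site set) = (2 * n + 1) ^ CARD('d)"
proof -
  have "bij_betw (\<lambda>f. \<chi> j. f j) (\<Pi>\<^sub>E j\<in>(UNIV :: 'd set). {- int n..int n}) (lattice_box n)"
    by (rule bij_betw_byWitness[of _ vec_nth]) (auto simp: lattice_box_def PiE_def Pi_def extensional_def)
  from bij_betw_same_card[OF this] have "card (lattice_box n :: 'd site set) = card (\<Pi>\<^sub>E j\<in>(UNIV :: 'd set). {- int n..int n})" by simp
  also have "\<dots> = (2 * n + 1) ^ CARD('d)"
    by (subst card_PiE) (auto simp: nat_add_distrib nat_mult_distrib)
  finally show ?thesis .
qed

lemma lattice_box_mono: "m \<le> n \<Longrightarrow> lattice_box m \<subseteq> lattice_box n"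
  by (auto simp: lattice_box_def intro: order_trans[of "- int n" "- int m"] order_trans[of _ "int m" "int n"])

lemma lattice_box_add: "x \<in> lattice_box m \<Longrightarrow> y \<in> lattice_box n \<Longrightarrow> x + y \<in> lattice_box (m + n)"
  by (auto simp: lattice_box_def intro: add_mono order_trans[OF _ add_mono[of "- int m" _ "- int n"]])

lemma zero_in_lattice_box [simp]: "0 \<in> lattice_box n"
  by (simp add: lattice_box_def)

lemma lattice_box_in_volumes [simp]: "lattice_box n \<in> volumes"
  using zero_in_lattice_box[of n] finite_lattice_box[of n]
  by (auto simp: volumes_def simp del: zero_in_lattice_box)

lemma finite_subset_lattice_box:
  fixes \<Lambda> :: "'d::finite site set"
  assumes "finite \<Lambda>" shows "\<exists>n. \<Lambda> \<subseteq> lattice_box n"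
proof -
  define n where "n = Max (insert 0 ((\<lambda>(x, j). nat \<bar>x $ j\<bar>) ` (\<Lambda> \<times> (UNIV :: 'd set))))"
  have "nat \<bar>x $ j\<bar> \<le> n" if "x \<in> \<Lambda>" for x j
    unfolding n_def using that assms by (intro Max_ge) (auto intro!: finite_imageI)
  then have "\<bar>x $ j\<bar> \<le> int n" if "x \<in> \<Lambda>" for x j
    using that by (metis nat_le_iff)
  then have "\<Lambda> \<subseteq> lattice_box n"
    by (auto simp: lattice_box_def abs_le_iff minus_le_iff)
  then show ?thesis by blast
qed

section \<open>Coordinate sigma-algebras\<close>

lemma coord_algebra_subset_borel: "sets (coord_algebra \<Lambda> :: ('d::finite, 'q::finite) config measure) \<subseteq> sets borel"
proof -
  have "(\<lambda>\<omega>. \<omega> x) -` A \<in> sets (borel :: ('d, 'q) config measure)" for x A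
    by (intro borel_open open_vimage open_discrete) auto
  then have "sigma_sets UNIV {(\<lambda>\<omega>. \<omega> x) -` A | x A. x \<in> \<Lambda>} \<subseteq> sets (borel :: ('d, 'q) config measure)"
    by (intro sets.sigma_sets_subset') auto
  then show ?thesis
    by (simp add: coord_algebra_def)
qed

text \<open>Induction over the generated sigma-algebra, starting from preimages under coordinates.
  It turns measurability with respect to the coordinates in \<Lambda> into pointwise dependence on
  them.\<close>

lemma coord_algebra_cyl:
  assumes "A \<in> sets (coord_algebra \<Lambda> :: ('d::finite, 'q::finite) config measure)" "\<omega>' \<in> cyl \<Lambda> \<omega>"
  shows "\<omega>' \<in> A \<longleftrightarrow> \<omega> \<in> A"
proof -
  have "A \<in> sigma_sets UNIV {(\<lambda>\<omega>. \<omega> x) -` A | x A. x \<in> \<Lambda>}"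
    using assms(1) by (simp add: coord_algebra_def)
  then show ?thesis
    by induction (use assms(2) in \<open>auto simp: cyl_def\<close>)
qed

lemma space_coord_algebra [simp]: "space (coord_algebra \<Lambda>) = UNIV"
  by (simp add: coord_algebra_def)

section \<open>Specifications and Gibbs measures\<close>

lemma volumes_iff: "\<Lambda> \<in> volumes \<longleftrightarrow> finite \<Lambda> \<and> \<Lambda> \<noteq> {}"
  by (simp add: volumes_def)

lemma shift_shift [simp]: "shift i (shift j \<omega>) = shift (i + j) \<omega>"
  by (simp add: shift_def algebra_simps)

lemma shift_0 [simp]: "shift 0 \<omega> = \<omega>"
  by (simp add: shift_def)

lemma cyl_Un: "cyl \<Lambda> \<eta> \<inter> cyl \<Delta> \<eta> = cyl (\<Lambda> \<union> \<Delta>) \<eta>"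
  by (auto simp: cyl_def)

lemma cyl_in_borel [measurable]: "(cyl \<Lambda> \<eta> :: ('d::finite, 'q::finite) config set) \<in> sets borel"
  by (simp add: borel_closed closed_cyl)

lemma sum_measure_cyl:
  assumes "M \<in> prob_measures" "finite \<Lambda>" "A \<in> sets (borel :: ('d::finite, 'q::finite) config measure)"
  shows "(\<Sum>\<zeta>\<in>patterns \<Lambda>. measure M (cyl \<Lambda> \<zeta> \<inter> A)) = measure M A"
proof -
  interpret prob_space M using prob_measuresD[OF assms(1)] by simp
  have "measure M (\<Union>\<zeta>\<in>patterns \<Lambda>. cyl \<Lambda> \<zeta> \<inter> A) = (\<Sum>\<zeta>\<in>patterns \<Lambda>. measure M (cyl \<Lambda> \<zeta> \<inter> A))"
    using assms prob_measuresD[OF assms(1)]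
    by (intro finite_measure_finite_Union)
      (auto simp: disjoint_family_on_def cyl_pattern_iff)
  moreover have "(\<Union>\<zeta>\<in>patterns \<Lambda>. cyl \<Lambda> \<zeta> \<inter> A) = A"
  proof -
    have "\<omega> \<in> cyl \<Lambda> (restrict \<omega> \<Lambda>)" for \<omega> by simp
    then show ?thesis by (blast intro: restrict_patterns)
  qed
  ultimately show ?thesis by simp
qed

section \<open>Locality, properness and consistency of the kernels\<close>

locale gibbsian_kernels =
  fixes \<gamma> :: "('d::finite, 'q::finite) kernels"
  assumes is_spec: "is_specification \<gamma>"
    and transl: "translation_invariant_spec \<gamma>"
    and nonnull: "non_null \<gamma>"
    and quasiloc: "quasilocal \<gamma>"
begin

definition cyl_prob :: "'d site set \<Rightarrow> ('d, 'q) config \<Rightarrow> ('d, 'q) config \<Rightarrow> real" where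
  "cyl_prob \<Lambda> \<zeta> \<omega> = measure (\<gamma> \<Lambda> \<omega>) (cyl \<Lambda> \<zeta>)"

lemma kernel_measurable: "\<Lambda> \<in> volumes \<Longrightarrow> \<gamma> \<Lambda> \<in> coord_algebra (- \<Lambda>) \<rightarrow>\<^sub>M prob_algebra borel"
  using is_spec by (simp add: is_specification_def)

lemma kernel_prob: "\<Lambda> \<in> volumes \<Longrightarrow> \<gamma> \<Lambda> \<omega> \<in> prob_measures"
  using measurable_space[OF kernel_measurable, of \<Lambda> \<omega>] by (simp add: prob_measures_def)

lemma kernel_proper:
  assumes "\<Lambda> \<in> volumes" "\<Delta> \<subseteq> - \<Lambda>"
  shows "measure (\<gamma> \<Lambda> \<omega>) (cyl (\<Lambda> \<union> \<Delta>) \<eta>) = cyl_prob \<Lambda> \<eta> \<omega> * indicator (cyl \<Delta> \<eta>) \<omega>"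
  using is_spec assms by (auto simp: is_specification_def proper_def cyl_prob_def cyl_Un)

lemma kernel_measure_coord:
  assumes "\<Lambda> \<in> volumes" "A \<in> sets borel"
  shows "(\<lambda>\<omega>. measure (\<gamma> \<Lambda> \<omega>) A) \<in> borel_measurable (coord_algebra (- \<Lambda>))"
  using measurable_compose[OF measurable_prob_algebraD[OF kernel_measurable[OF assms(1)]]
      measurable_measure_subprob_algebra[OF assms(2)]] .

lemma borel_kernel_measurable:
  assumes "\<Lambda> \<in> volumes"
  shows "\<gamma> \<Lambda> \<in> borel \<rightarrow>\<^sub>M subprob_algebra borel"
proof -
  have "\<gamma> \<Lambda> \<in> coord_algebra (- \<Lambda>) \<rightarrow>\<^sub>M subprob_algebra borel"
    using measurable_prob_algebraD[OF kernel_measurable[OF assms]] .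
  then show ?thesis
    using coord_algebra_subset_borel[of "- \<Lambda>"] by (auto simp: measurable_def)
qed

lemma borel_kernel_measure:
  assumes "\<Lambda> \<in> volumes" "A \<in> sets borel"
  shows "(\<lambda>\<omega>. measure (\<gamma> \<Lambda> \<omega>) A) \<in> borel_measurable borel"
  using measurable_compose[OF borel_kernel_measurable[OF assms(1)] measurable_measure_subprob_algebra[OF assms(2)]] .

lemma integrable_kernel:
  assumes "M \<in> prob_measures" "\<Lambda> \<in> volumes" "A \<in> sets borel"
  shows "integrable M (\<lambda>\<omega>. measure (\<gamma> \<Lambda> \<omega>) A)"
proof -
  interpret prob_space M using prob_measuresD[OF assms(1)] by simp
  have "(\<lambda>\<omega>. measure (\<gamma> \<Lambda> \<omega>) A) \<in> borel_measurable M"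
    using borel_kernel_measure[OF assms(2,3)] measurable_cong_sets[OF prob_measuresD(2)[OF assms(1)] refl] by blast
  moreover have "measure (\<gamma> \<Lambda> \<omega>) A \<le> 1" for \<omega>
    by (rule prob_space.prob_le_1[OF prob_measuresD(1)[OF kernel_prob[OF assms(2)]]])
  ultimately show ?thesis by (intro integrable_const_bound[of _ 1]) auto
qed

text \<open>The level set of the kernel at its value in \<omega> is an event of
  \<open>coord_algebra (- \<Lambda>)\<close>, so it contains \<omega>' together with
  \<omega>.\<close>

lemma kernel_local:
  assumes "\<Lambda> \<in> volumes" "A \<in> sets borel" "\<omega>' \<in> cyl (- \<Lambda>) \<omega>"
  shows "measure (\<gamma> \<Lambda> \<omega>') A = measure (\<gamma> \<Lambda> \<omega>) A"
proof -
  have "(\<lambda>\<omega>. measure (\<gamma> \<Lambda> \<omega>) A) -` {measure (\<gamma> \<Lambda> \<omega>) A} \<in> sets (coord_algebra (- \<Lambda>))"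
    using measurable_sets[OF kernel_measure_coord[OF assms(1,2)], of "{measure (\<gamma> \<Lambda> \<omega>) A}"] by simp
  from coord_algebra_cyl[OF this assms(3)] show ?thesis by simp
qed

lemma cyl_prob_local: "\<Lambda> \<in> volumes \<Longrightarrow> \<omega>' \<in> cyl (- \<Lambda>) \<omega> \<Longrightarrow> cyl_prob \<Lambda> \<zeta> \<omega>' = cyl_prob \<Lambda> \<zeta> \<omega>"
  unfolding cyl_prob_def by (intro kernel_local) auto

lemma cyl_prob_pattern: "\<zeta>' \<in> cyl \<Lambda> \<zeta> \<Longrightarrow> cyl_prob \<Lambda> \<zeta>' \<omega> = cyl_prob \<Lambda> \<zeta> \<omega>"
  by (simp add: cyl_prob_def cyl_cong)

lemma cyl_prob_nonneg [simp]: "0 \<le> cyl_prob \<Lambda> \<zeta> \<omega>"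
  by (simp add: cyl_prob_def)

lemma cyl_prob_le_1: "\<Lambda> \<in> volumes \<Longrightarrow> cyl_prob \<Lambda> \<zeta> \<omega> \<le> 1"
  unfolding cyl_prob_def
  by (rule prob_space.prob_le_1[OF prob_measuresD(1)[OF kernel_prob]])

lemma sum_cyl_prob:
  assumes "\<Lambda> \<in> volumes" shows "(\<Sum>\<zeta>\<in>patterns \<Lambda>. cyl_prob \<Lambda> \<zeta> \<omega>) = 1"
  using sum_measure_cyl[OF kernel_prob[OF assms], of \<Lambda> UNIV \<omega>] assms
    prob_space.prob_space[OF prob_measuresD(1)[OF kernel_prob[OF assms]], of \<omega>] prob_measuresD(3)[OF kernel_prob[OF assms], of \<omega>]
  by (simp add: cyl_prob_def volumes_iff)

text \<open>Properness is used with the infinite set \<open>- \<Lambda>\<close>: summed over the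
  patterns in \<Lambda>, the cylinders with boundary condition \<omega> already carry the total mass
  1.\<close>

lemma AE_kernel_boundary:
  assumes "\<Lambda> \<in> volumes"
  shows "AE \<omega>' in \<gamma> \<Lambda> \<omega>. \<omega>' \<in> cyl (- \<Lambda>) \<omega>"
proof -
  interpret prob_space "\<gamma> \<Lambda> \<omega>" using prob_measuresD[OF kernel_prob[OF assms]] by simp
  have "measure (\<gamma> \<Lambda> \<omega>) (cyl (- \<Lambda>) \<omega>) = (\<Sum>\<zeta>\<in>patterns \<Lambda>. measure (\<gamma> \<Lambda> \<omega>) (cyl \<Lambda> \<zeta> \<inter> cyl (- \<Lambda>) \<omega>))"
    using sum_measure_cyl[OF kernel_prob[OF assms], of \<Lambda> "cyl (- \<Lambda>) \<omega>" \<omega>] assms by (simp add: volumes_iff)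
  also have "\<dots> = (\<Sum>\<zeta>\<in>patterns \<Lambda>. cyl_prob \<Lambda> \<zeta> \<omega>)"
  proof (intro sum.cong refl)
    fix \<zeta> :: "('d, 'q) config"
    define \<eta> where "\<eta> = override_on \<omega> \<zeta> \<Lambda>"
    have "cyl \<Lambda> \<zeta> \<inter> cyl (- \<Lambda>) \<omega> = cyl (\<Lambda> \<union> - \<Lambda>) \<eta>"
      unfolding \<eta>_def cyl_def by (auto simp: override_on_def split: if_splits)
    moreover have "cyl_prob \<Lambda> \<eta> \<omega> = cyl_prob \<Lambda> \<zeta> \<omega>" "\<omega> \<in> cyl (- \<Lambda>) \<eta>"
      by (auto intro!: cyl_prob_pattern simp: cyl_def \<eta>_def)
    ultimately show "measure (\<gamma> \<Lambda> \<omega>) (cyl \<Lambda> \<zeta> \<inter> cyl (- \<Lambda>) \<omega>) = cyl_prob \<Lambda> \<zeta> \<omega>"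
      using kernel_proper[OF assms, of "- \<Lambda>" \<omega> \<eta>] by simp
  qed
  also have "\<dots> = 1" by (rule sum_cyl_prob[OF assms])
  finally show ?thesis
    using AE_prob_1 by blast
qed

lemma kernel_consistent:
  assumes "W \<in> volumes" "\<Lambda> \<in> volumes" "\<Lambda> \<subseteq> W" "A \<in> sets borel"
  shows "measure (\<gamma> W \<omega>) A = (\<integral>\<omega>'. measure (\<gamma> \<Lambda> \<omega>') A \<partial>\<gamma> W \<omega>)"
proof -
  interpret prob_space "\<gamma> W \<omega>" using prob_measuresD[OF kernel_prob[OF assms(1)]] by simp
  have "\<gamma> W \<omega> \<bind> \<gamma> \<Lambda> = \<gamma> W \<omega>"
    using is_spec assms by (simp add: is_specification_def)
  moreover have "\<gamma> \<Lambda> \<in> \<gamma> W \<omega> \<rightarrow>\<^sub>M subprob_algebra borel"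
    using borel_kernel_measurable[OF assms(2)]
      measurable_cong_sets[OF prob_measuresD(2)[OF kernel_prob[OF assms(1)]] refl, of \<omega>] by blast
  ultimately show ?thesis
    using measure_bind[of "\<gamma> \<Lambda>" borel A] assms(4) by simp
qed

text \<open>By consistency the spins in W may be drawn first and those in \<Lambda> resampled.
  Properness prescribes \<zeta> on \<open>W - \<Lambda>\<close>, and off W almost surely stands
  \<omega>, so the inner kernel always sees the boundary condition of
  \<open>override_on \<omega> \<zeta> W\<close> and leaves the integral as a constant.\<close>

lemma cyl_prob_factor:
  assumes "W \<in> volumes" "\<Lambda> \<in> volumes" "\<Lambda> \<subseteq> W"
  shows "cyl_prob W \<zeta> \<omega> = cyl_prob \<Lambda> \<zeta> (override_on \<omega> \<zeta> W) * measure (\<gamma> W \<omega>) (cyl (W - \<Lambda>) \<zeta>)"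
proof -
  interpret prob_space "\<gamma> W \<omega>" using prob_measuresD[OF kernel_prob[OF assms(1)]] by simp
  have "W = \<Lambda> \<union> (W - \<Lambda>)" "W - \<Lambda> \<subseteq> - \<Lambda>" using assms(3) by auto
  then have proper: "measure (\<gamma> \<Lambda> \<omega>') (cyl W \<zeta>) = cyl_prob \<Lambda> \<zeta> \<omega>' * indicator (cyl (W - \<Lambda>) \<zeta>) \<omega>'" for \<omega>'
    using kernel_proper[OF assms(2), of "W - \<Lambda>" \<omega>' \<zeta>] by metis
  have "cyl_prob W \<zeta> \<omega> = (\<integral>\<omega>'. cyl_prob \<Lambda> \<zeta> \<omega>' * indicator (cyl (W - \<Lambda>) \<zeta>) \<omega>' \<partial>\<gamma> W \<omega>)"
    unfolding cyl_prob_def[of W]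
    using kernel_consistent[OF assms, of "cyl W \<zeta>" \<omega>] proper by simp
  also have "\<dots> = (\<integral>\<omega>'. cyl_prob \<Lambda> \<zeta> (override_on \<omega> \<zeta> W) * indicator (cyl (W - \<Lambda>) \<zeta>) \<omega>' \<partial>\<gamma> W \<omega>)"
  proof (rule integral_cong_AE)
    show "AE \<omega>' in \<gamma> W \<omega>. cyl_prob \<Lambda> \<zeta> \<omega>' * indicator (cyl (W - \<Lambda>) \<zeta>) \<omega>'
        = cyl_prob \<Lambda> \<zeta> (override_on \<omega> \<zeta> W) * indicator (cyl (W - \<Lambda>) \<zeta>) \<omega>'"
      using AE_kernel_boundary[OF assms(1)]
    proof eventually_elim
      case (elim \<omega>')
      show ?case
      proof (cases "\<omega>' \<in> cyl (W - \<Lambda>) \<zeta>")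
        case True
        then have "override_on \<omega> \<zeta> W \<in> cyl (- \<Lambda>) \<omega>'"
          using elim by (auto simp: cyl_def override_on_def)
        then show ?thesis using cyl_prob_local[OF assms(2)] by simp
      qed simp
    qed
  qed (use borel_kernel_measure[OF assms(2)] prob_measuresD(2)[OF kernel_prob[OF assms(1)]] in
      \<open>auto simp: cyl_prob_def cong: measurable_cong_sets intro!: borel_measurable_times borel_measurable_indicator\<close>)
  also have "\<dots> = cyl_prob \<Lambda> \<zeta> (override_on \<omega> \<zeta> W) * measure (\<gamma> W \<omega>) (cyl (W - \<Lambda>) \<zeta>)"
    using prob_measuresD(2)[OF kernel_prob[OF assms(1)]] by simp
  finally show ?thesis .
qed

text \<open>In \<open>quasilocal\<close> one configuration supplies both the event and the boundary
  condition. Grafting the pattern \<eta> onto \<omega> separates the two roles again.\<close>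

lemma cyl_prob_uniform:
  assumes "\<Lambda> \<in> volumes" "e > 0"
  shows "\<exists>\<Delta>. finite \<Delta> \<and> (\<forall>\<omega>. \<forall>\<omega>'\<in>cyl \<Delta> \<omega>. \<bar>cyl_prob \<Lambda> \<eta> \<omega>' - cyl_prob \<Lambda> \<eta> \<omega>\<bar> < e)"
proof -
  let ?S = "\<lambda>\<Delta>. SUP (\<eta>, \<xi>). \<bar>cyl_prob \<Lambda> \<eta> (override_on \<xi> \<eta> \<Delta>) - cyl_prob \<Lambda> \<eta> \<eta>\<bar>"
  have "(?S \<longlongrightarrow> 0) (finite_subsets_at_top UNIV)"
    using quasiloc assms(1) by (simp add: quasilocal_def cyl_prob_def)
  then have "\<forall>\<^sub>F \<Delta> in finite_subsets_at_top UNIV. ?S \<Delta> < e"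
    by (rule order_tendstoD) (rule assms)
  then obtain \<Delta>0 where \<Delta>0: "finite \<Delta>0" "\<And>\<Delta>. finite \<Delta> \<Longrightarrow> \<Delta>0 \<subseteq> \<Delta> \<Longrightarrow> ?S \<Delta> < e"
    unfolding eventually_finite_subsets_at_top by auto
  define \<Delta> where "\<Delta> = \<Delta>0 \<union> \<Lambda>"
  have fin: "finite \<Delta>" using \<Delta>0 assms(1) by (simp add: \<Delta>_def volumes_iff)
  have S: "?S \<Delta> < e" by (rule \<Delta>0(2)) (use fin in \<open>auto simp: \<Delta>_def\<close>)
  have b: "\<bar>cyl_prob \<Lambda> \<zeta> \<omega>' - cyl_prob \<Lambda> \<zeta> \<omega>\<bar> \<le> 1" for \<zeta> \<omega> \<omega>'
    using cyl_prob_le_1[OF assms(1), of \<zeta> \<omega>] cyl_prob_le_1[OF assms(1), of \<zeta> \<omega>']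
      cyl_prob_nonneg[of \<Lambda> \<zeta> \<omega>] cyl_prob_nonneg[of \<Lambda> \<zeta> \<omega>'] by linarith
  have key: "\<bar>cyl_prob \<Lambda> \<zeta> (override_on \<xi> \<zeta> \<Delta>) - cyl_prob \<Lambda> \<zeta> \<zeta>\<bar> < e" for \<zeta> \<xi>
  proof -
    have "(\<lambda>(\<eta>, \<xi>). \<bar>cyl_prob \<Lambda> \<eta> (override_on \<xi> \<eta> \<Delta>) - cyl_prob \<Lambda> \<eta> \<eta>\<bar>) (\<zeta>, \<xi>) \<le> ?S \<Delta>"
      by (rule cSUP_upper) (auto intro!: bdd_aboveI[of _ 1] b)
    then show ?thesis using S by simp
  qed
  have "\<bar>cyl_prob \<Lambda> \<eta> \<omega>' - cyl_prob \<Lambda> \<eta> \<omega>\<bar> < e" if "\<omega>' \<in> cyl \<Delta> \<omega>" for \<omega> \<omega>'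
  proof -
    define \<zeta> where "\<zeta> = override_on \<omega> \<eta> \<Lambda>"
    have "cyl_prob \<Lambda> \<zeta> \<zeta> = cyl_prob \<Lambda> \<eta> \<omega>"
      using cyl_prob_local[OF assms(1), of \<zeta> \<omega> \<zeta>] cyl_prob_pattern[of \<zeta> \<Lambda> \<eta> \<omega>]
      by (auto simp: \<zeta>_def cyl_def)
    moreover have "cyl_prob \<Lambda> \<zeta> (override_on \<omega>' \<zeta> \<Delta>) = cyl_prob \<Lambda> \<eta> \<omega>'"
      using cyl_prob_local[OF assms(1), of "override_on \<omega>' \<zeta> \<Delta>" \<omega>' \<zeta>] cyl_prob_pattern[of \<zeta> \<Lambda> \<eta> \<omega>'] that
      by (auto simp: \<zeta>_def cyl_def override_on_def)
    ultimately show ?thesis using key[of \<zeta> \<omega>'] by simp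
  qed
  then show ?thesis using fin by blast
qed

lemma continuous_cyl_prob [continuous_intros]:
  assumes "\<Lambda> \<in> volumes"
  shows "continuous_on UNIV (cyl_prob \<Lambda> \<eta>)"
proof -
  have "\<exists>T. open T \<and> \<omega> \<in> T \<and> (\<forall>\<omega>'\<in>T. dist (cyl_prob \<Lambda> \<eta> \<omega>') (cyl_prob \<Lambda> \<eta> \<omega>) < e)" if e: "e > 0" for \<omega> e
  proof -
    obtain \<Delta> where "finite \<Delta>" "\<forall>\<omega>. \<forall>\<omega>'\<in>cyl \<Delta> \<omega>. \<bar>cyl_prob \<Lambda> \<eta> \<omega>' - cyl_prob \<Lambda> \<eta> \<omega>\<bar> < e"
      using cyl_prob_uniform[OF assms e] by blast
    then show ?thesis
      by (intro exI[of _ "cyl \<Delta> \<omega>"]) (auto simp: open_cyl dist_real_def)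
  qed
  then have "(cyl_prob \<Lambda> \<eta> \<longlongrightarrow> cyl_prob \<Lambda> \<eta> \<omega>) (at \<omega>)" for \<omega>
    by (intro tendstoI) (fastforce simp: eventually_at_topological)
  then show ?thesis by (simp add: continuous_on_def)
qed

section \<open>Finite energy: consequences of non-nullness\<close>

lemma ex_nonnull_constant: "\<exists>\<delta>>0. \<forall>x \<eta> \<omega>. \<delta> \<le> cyl_prob {x} \<eta> \<omega>"
proof -
  obtain \<delta> where \<delta>: "\<delta> > 0" "(INF \<eta>. cyl_prob {0} \<eta> \<eta>) \<ge> \<delta>"
    using nonnull by (auto simp: non_null_def cyl_prob_def)
  have vol: "{x} \<in> volumes" for x :: "'d site" by (simp add: volumes_iff)
  have 0: "\<delta> \<le> cyl_prob {0} \<eta> \<eta>" for \<eta>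
    using \<delta>(2) by (rule order_trans) (rule cINF_lower, auto intro: bdd_belowI[of _ 0])
  \<comment> \<open>Translation invariance carries the bound from the origin to the site x.\<close>
  have 1: "cyl_prob {x} (shift x \<eta>) (shift x \<eta>) = cyl_prob {0} \<eta> \<eta>" for x \<eta>
    using transl vol[of 0] by (auto simp: translation_invariant_spec_def translate_def cyl_prob_def)
  have 2: "\<delta> \<le> cyl_prob {x} \<eta> \<eta>" for x \<eta>
    using 1[of x "shift (- x) \<eta>"] 0 by simp
  \<comment> \<open>Writing \<open>\<eta> x\<close> at x into \<omega> frees the boundary condition
    from the event.\<close>
  have "\<delta> \<le> cyl_prob {x} \<eta> \<omega>" for x \<eta> \<omega>
  proof -
    define \<zeta> where "\<zeta> = override_on \<omega> \<eta> {x}"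
    have "cyl_prob {x} \<zeta> \<zeta> = cyl_prob {x} \<eta> \<omega>"
      using cyl_prob_local[OF vol, of \<zeta> x \<omega> \<zeta>] cyl_prob_pattern[of \<zeta> "{x}" \<eta> \<omega>]
      by (auto simp: \<zeta>_def cyl_def)
    then show ?thesis using 2[of x \<zeta>] by simp
  qed
  then show ?thesis using \<delta> by blast
qed

definition nonnull_bound :: real where
  "nonnull_bound = (SOME \<delta>. \<delta> > 0 \<and> (\<forall>x \<eta> \<omega>. \<delta> \<le> cyl_prob {x} \<eta> \<omega>))"

lemma nonnull_bound: "nonnull_bound > 0" "nonnull_bound \<le> cyl_prob {x} \<eta> \<omega>"
  using someI_ex[OF ex_nonnull_constant] unfolding nonnull_bound_def by blast+

lemma nonnull_bound_le_1: "nonnull_bound \<le> 1"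
  using nonnull_bound(2)[of 0] cyl_prob_le_1[of "{0}"] by (meson insert_not_empty finite.intros volumes_iff order_trans)

text \<open>Resampling the single site x, allowed by consistency, produces the required spin with
  conditional probability at least \<open>nonnull_bound\<close>, whatever surrounds it.\<close>

lemma kernel_cyl_remove_site:
  assumes "W \<in> volumes" "x \<in> U" "U \<subseteq> W"
  shows "nonnull_bound * measure (\<gamma> W \<omega>) (cyl (U - {x}) \<zeta>) \<le> measure (\<gamma> W \<omega>) (cyl U \<zeta>)"
proof -
  interpret prob_space "\<gamma> W \<omega>" using prob_measuresD[OF kernel_prob[OF assms(1)]] by simp
  have vol: "{x} \<in> volumes" by (simp add: volumes_iff)
  have U: "insert x (U - {x}) = U" using assms by auto
  have "nonnull_bound * measure (\<gamma> W \<omega>) (cyl (U - {x}) \<zeta>) = (\<integral>\<omega>'. nonnull_bound * indicator (cyl (U - {x}) \<zeta>) \<omega>' \<partial>\<gamma> W \<omega>)"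
    using prob_measuresD(2)[OF kernel_prob[OF assms(1)]] by simp
  also have "\<dots> \<le> (\<integral>\<omega>'. measure (\<gamma> {x} \<omega>') (cyl U \<zeta>) \<partial>\<gamma> W \<omega>)"
  proof (rule integral_mono)
    show "integrable (\<gamma> W \<omega>) (\<lambda>\<omega>'. nonnull_bound * indicator (cyl (U - {x}) \<zeta>) \<omega>')"
      using prob_measuresD(2)[OF kernel_prob[OF assms(1)]] by (simp add: emeasure_eq_measure)
    show "integrable (\<gamma> W \<omega>) (\<lambda>\<omega>'. measure (\<gamma> {x} \<omega>') (cyl U \<zeta>))"
      by (rule integrable_kernel[OF kernel_prob[OF assms(1)] vol]) simp
    fix \<omega>'
    show "nonnull_bound * indicator (cyl (U - {x}) \<zeta>) \<omega>' \<le> measure (\<gamma> {x} \<omega>') (cyl U \<zeta>)"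
      using kernel_proper[OF vol, of "U - {x}" \<omega>' \<zeta>] nonnull_bound(2)[of x \<zeta> \<omega>'] U by (auto simp: indicator_def)
  qed
  also have "\<dots> = measure (\<gamma> W \<omega>) (cyl U \<zeta>)"
    using kernel_consistent[OF assms(1) vol, of "cyl U \<zeta>" \<omega>] assms by auto
  finally show ?thesis .
qed

lemma kernel_cyl_remove:
  assumes "W \<in> volumes" "S \<subseteq> W"
  shows "nonnull_bound ^ card S * measure (\<gamma> W \<omega>) (cyl (W - S) \<zeta>) \<le> cyl_prob W \<zeta> \<omega>"
proof -
  have "finite S" using assms finite_subset by (auto simp: volumes_iff)
  then show ?thesis using assms(2)
  proof (induction S)
    case empty
    then show ?case by (simp add: cyl_prob_def)
  next
    case (insert x S)
    have "nonnull_bound * measure (\<gamma> W \<omega>) (cyl (W - S - {x}) \<zeta>) \<le> measure (\<gamma> W \<omega>) (cyl (W - S) \<zeta>)"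
      by (rule kernel_cyl_remove_site) (use insert assms in auto)
    moreover have "W - S - {x} = W - insert x S" by auto
    ultimately have "nonnull_bound ^ card S * (nonnull_bound * measure (\<gamma> W \<omega>) (cyl (W - insert x S) \<zeta>))
        \<le> nonnull_bound ^ card S * measure (\<gamma> W \<omega>) (cyl (W - S) \<zeta>)"
      using nonnull_bound(1) by (intro mult_left_mono) auto
    also have "\<dots> \<le> cyl_prob W \<zeta> \<omega>" using insert by auto
    finally show ?case using insert by (simp add: mult_ac)
  qed
qed

lemma cyl_prob_lower:
  assumes "W \<in> volumes" shows "nonnull_bound ^ card W \<le> cyl_prob W \<zeta> \<omega>"
  using kernel_cyl_remove[OF assms order_refl, of \<omega> \<zeta>]
    prob_space.prob_space[OF prob_measuresD(1)[OF kernel_prob[OF assms]], of \<omega>] prob_measuresD(3)[OF kernel_prob[OF assms], of \<omega>]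
  by (simp add: cyl_def)

lemma cyl_prob_pos: "W \<in> volumes \<Longrightarrow> 0 < cyl_prob W \<zeta> \<omega>"
  using cyl_prob_lower[of W \<zeta> \<omega>] nonnull_bound(1) by (meson less_le_trans zero_less_power)

text \<open>Numerator and denominator factor with the same second factor, since \<zeta> and \<zeta>'
  prescribe the same cylinder on \<open>W - \<Lambda>\<close>; by positivity it can be
  cancelled.\<close>

lemma cyl_prob_ratio:
  assumes "W \<in> volumes" "\<Lambda> \<in> volumes" "\<Lambda> \<subseteq> W" "\<zeta>' \<in> cyl (W - \<Lambda>) \<zeta>" "\<omega> \<in> cyl (W - \<Lambda>) \<zeta>"
  shows "cyl_prob W \<zeta>' \<omega> / cyl_prob W \<zeta> \<omega> = cyl_prob \<Lambda> \<zeta>' \<omega> / cyl_prob \<Lambda> \<zeta> \<omega>"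
proof -
  let ?N = "measure (\<gamma> W \<omega>) (cyl (W - \<Lambda>) \<zeta>)"
  have "override_on \<omega> \<zeta> W \<in> cyl (- \<Lambda>) \<omega>" "override_on \<omega> \<zeta>' W \<in> cyl (- \<Lambda>) \<omega>"
    using assms(4,5) by (auto simp: cyl_def override_on_def)
  then have "cyl_prob W \<zeta> \<omega> = cyl_prob \<Lambda> \<zeta> \<omega> * ?N" "cyl_prob W \<zeta>' \<omega> = cyl_prob \<Lambda> \<zeta>' \<omega> * ?N"
    using cyl_prob_factor[OF assms(1-3), of _ \<omega>] cyl_prob_local[OF assms(2)] cyl_cong[OF assms(4)] by simp_all
  moreover have "?N \<noteq> 0"
    using cyl_prob_pos[OF assms(1), of \<zeta> \<omega>] calculation(1) by auto
  ultimately show ?thesis by simp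
qed

section \<open>Cylinder probabilities of Gibbs measures\<close>

lemma gibbsD:
  assumes "\<mu> \<in> gibbs_measures \<gamma>" 
  shows "\<mu> \<in> prob_measures" "\<Lambda> \<in> volumes \<Longrightarrow> measure \<mu> (cyl \<Lambda> \<eta>) = (\<integral>\<omega>. cyl_prob \<Lambda> \<eta> \<omega> \<partial>\<mu>)"
  using assms by (auto simp: gibbs_measures_def cyl_prob_def)

lemma gibbs_cyl_lower:
  assumes "\<mu> \<in> gibbs_measures \<gamma>" "\<Lambda> \<in> volumes"
  shows "nonnull_bound ^ card \<Lambda> \<le> measure \<mu> (cyl \<Lambda> \<eta>)"
proof -
  have prob: "\<mu> \<in> prob_measures" by (rule gibbsD(1)[OF assms(1)])
  interpret prob_space \<mu> using prob_measuresD[OF prob] by simp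
  have "(\<integral>\<omega>. nonnull_bound ^ card \<Lambda> \<partial>\<mu>) \<le> (\<integral>\<omega>. cyl_prob \<Lambda> \<eta> \<omega> \<partial>\<mu>)"
    by (rule integral_mono[OF integrable_continuous[OF prob] integrable_continuous[OF prob] cyl_prob_lower[OF assms(2)]])
      (auto intro: continuous_cyl_prob[OF assms(2)])
  then show ?thesis using gibbsD(2)[OF assms] by (simp add: prob_space)
qed

lemma gibbs_cyl_pos: "\<mu> \<in> gibbs_measures \<gamma> \<Longrightarrow> \<Lambda> \<in> volumes \<Longrightarrow> 0 < measure \<mu> (cyl \<Lambda> \<eta>)"
  using gibbs_cyl_lower[of \<mu> \<Lambda> \<eta>] nonnull_bound(1) by (meson less_le_trans zero_less_power)

text \<open>Forgetting the spins in S enlarges the cylinder; \<open>kernel_cyl_remove\<close> bounds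
  the price of prescribing them anew by one factor \<open>nonnull_bound\<close> per site.\<close>

lemma gibbs_cyl_ratio:
  assumes "\<mu> \<in> gibbs_measures \<gamma>" "\<Lambda> \<in> volumes" "S \<subseteq> \<Lambda>" "\<eta>' \<in> cyl (\<Lambda> - S) \<eta>"
  shows "nonnull_bound ^ card S * measure \<mu> (cyl \<Lambda> \<eta>') \<le> measure \<mu> (cyl \<Lambda> \<eta>)"
proof -
  have "(\<integral>\<omega>. nonnull_bound ^ card S * cyl_prob \<Lambda> \<eta>' \<omega> \<partial>\<mu>) \<le> (\<integral>\<omega>. cyl_prob \<Lambda> \<eta> \<omega> \<partial>\<mu>)"
  proof (rule integral_mono)
    show "integrable \<mu> (\<lambda>\<omega>. nonnull_bound ^ card S * cyl_prob \<Lambda> \<eta>' \<omega>)" "integrable \<mu> (cyl_prob \<Lambda> \<eta>)"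
      by (auto intro!: integrable_mult_right integrable_continuous[OF gibbsD(1)[OF assms(1)]] continuous_cyl_prob[OF assms(2)])
    fix \<omega>
    interpret prob_space "\<gamma> \<Lambda> \<omega>" using prob_measuresD[OF kernel_prob[OF assms(2)]] by simp
    have "cyl_prob \<Lambda> \<eta>' \<omega> \<le> measure (\<gamma> \<Lambda> \<omega>) (cyl (\<Lambda> - S) \<eta>)"
      unfolding cyl_prob_def
      by (rule finite_measure_mono)
        (use assms(4) prob_measuresD(2)[OF kernel_prob[OF assms(2)]] in \<open>auto simp: cyl_def\<close>)
    then have "nonnull_bound ^ card S * cyl_prob \<Lambda> \<eta>' \<omega> \<le> nonnull_bound ^ card S * measure (\<gamma> \<Lambda> \<omega>) (cyl (\<Lambda> - S) \<eta>)"
      using nonnull_bound(1) by (intro mult_left_mono) auto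
    also have "\<dots> \<le> cyl_prob \<Lambda> \<eta> \<omega>" by (rule kernel_cyl_remove[OF assms(2,3)])
    finally show "nonnull_bound ^ card S * cyl_prob \<Lambda> \<eta>' \<omega> \<le> cyl_prob \<Lambda> \<eta> \<omega>" .
  qed
  then show ?thesis using gibbsD(2)[OF assms(1,2)] by simp
qed

text \<open>The DLR equation in a box writes a cylinder probability as an average of
  \<open>cyl_prob W\<close> weighted with the kernel mass of the spins outside W, which is common to
  \<eta> and \<eta>' and averages to \<open>M n\<close>. By quasilocality the first factor becomes
  constant as the box grows. The limit is a value at the single configuration \<eta>, not an almost
  sure one; this is what makes \<open>detailed_balance\<close> pointwise.\<close>

lemma gibbs_cyl_ratio_limit:
  assumes \<mu>: "\<mu> \<in> gibbs_measures \<gamma>" and W: "W \<in> volumes" and agree: "\<eta>' \<in> cyl (- W) \<eta>"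
  shows "(\<lambda>n. measure \<mu> (cyl (lattice_box n) \<eta>') / measure \<mu> (cyl (lattice_box n) \<eta>))
    \<longlonglongrightarrow> cyl_prob W \<eta>' \<eta> / cyl_prob W \<eta> \<eta>"
proof -
  define M where "M n = (\<integral>\<omega>. measure (\<gamma> (lattice_box n) \<omega>) (cyl (lattice_box n - W) \<eta>) \<partial>\<mu>)" for n
  have prob: "\<mu> \<in> prob_measures" using gibbsD(1)[OF \<mu>] .
  interpret prob_space \<mu> using prob_measuresD[OF prob] by simp
  obtain n0 where n0: "W \<subseteq> lattice_box n0"
    using W finite_subset_lattice_box[of W] by (auto simp: volumes_iff)
  have box: "cyl (lattice_box n - W) \<eta>' = cyl (lattice_box n - W) \<eta>" for n
    by (rule cyl_cong) (use agree in \<open>auto simp: cyl_def\<close>)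
  have int: "integrable \<mu> (\<lambda>\<omega>. measure (\<gamma> (lattice_box n) \<omega>) (cyl (lattice_box n - W) \<eta>))" for n
    by (rule integrable_kernel[OF prob]) auto
  have near: "\<forall>\<^sub>F n in sequentially. \<bar>measure \<mu> (cyl (lattice_box n) \<zeta>) - cyl_prob W \<zeta> \<eta> * M n\<bar> \<le> e * M n"
    if e: "e > 0" and \<zeta>: "\<zeta> \<in> cyl (- W) \<eta>" for e \<zeta>
  proof -
    obtain \<Delta> where \<Delta>: "finite \<Delta>" "\<And>\<omega> \<omega>'. \<omega>' \<in> cyl \<Delta> \<omega> \<Longrightarrow> \<bar>cyl_prob W \<zeta> \<omega>' - cyl_prob W \<zeta> \<omega>\<bar> < e"
      using cyl_prob_uniform[OF W e, of \<zeta>] by auto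
    obtain n1 where n1: "\<Delta> \<subseteq> lattice_box n1" using finite_subset_lattice_box[OF \<Delta>(1)] by blast
    have "\<bar>measure \<mu> (cyl (lattice_box n) \<zeta>) - cyl_prob W \<zeta> \<eta> * M n\<bar> \<le> e * M n" if n: "n \<ge> max n0 n1" for n
    proof -
      let ?\<Lambda> = "lattice_box n :: 'd site set"
      let ?N = "\<lambda>\<omega>. measure (\<gamma> ?\<Lambda> \<omega>) (cyl (?\<Lambda> - W) \<eta>)"
      have sub: "W \<subseteq> ?\<Lambda>" "\<Delta> \<subseteq> ?\<Lambda>" using n n0 n1 lattice_box_mono[of n0 n] lattice_box_mono[of n1 n] by auto
      have cong: "cyl (?\<Lambda> - W) \<zeta> = cyl (?\<Lambda> - W) \<eta>"
        by (rule cyl_cong) (use \<zeta> in \<open>auto simp: cyl_def\<close>)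
      have *: "cyl_prob ?\<Lambda> \<zeta> \<omega> = cyl_prob W \<zeta> (override_on \<omega> \<zeta> ?\<Lambda>) * ?N \<omega>" for \<omega>
        using cyl_prob_factor[OF _ W sub(1), of \<zeta> \<omega>] cong by simp
      have **: "\<bar>cyl_prob W \<zeta> (override_on \<omega> \<zeta> ?\<Lambda>) - cyl_prob W \<zeta> \<eta>\<bar> \<le> e" for \<omega>
      proof -
        have "cyl_prob W \<zeta> \<zeta> = cyl_prob W \<zeta> \<eta>" by (rule cyl_prob_local[OF W \<zeta>])
        moreover have "override_on \<omega> \<zeta> ?\<Lambda> \<in> cyl \<Delta> \<zeta>" using sub by (auto simp: cyl_def)
        ultimately show ?thesis using \<Delta>(2) by (metis less_imp_le)
      qed
      have "measure \<mu> (cyl ?\<Lambda> \<zeta>) - cyl_prob W \<zeta> \<eta> * M n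
        = (\<integral>\<omega>. cyl_prob ?\<Lambda> \<zeta> \<omega> - cyl_prob W \<zeta> \<eta> * ?N \<omega> \<partial>\<mu>)"
        unfolding M_def gibbsD(2)[OF \<mu> lattice_box_in_volumes]
        by (subst Bochner_Integration.integral_diff)
          (auto intro!: integrable_continuous[OF prob] continuous_cyl_prob int integrable_mult_right)
      also have "\<bar>\<dots>\<bar> \<le> (\<integral>\<omega>. e * ?N \<omega> \<partial>\<mu>)"
      proof (rule order_trans[OF integral_abs_bound], rule integral_mono)
        show "integrable \<mu> (\<lambda>\<omega>. \<bar>cyl_prob ?\<Lambda> \<zeta> \<omega> - cyl_prob W \<zeta> \<eta> * ?N \<omega>\<bar>)"
          by (intro integrable_abs Bochner_Integration.integrable_diff integrable_continuous[OF prob]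
              continuous_cyl_prob lattice_box_in_volumes integrable_mult_right int)
        show "integrable \<mu> (\<lambda>\<omega>. e * ?N \<omega>)" using int by simp
        fix \<omega>
        have "\<bar>cyl_prob ?\<Lambda> \<zeta> \<omega> - cyl_prob W \<zeta> \<eta> * ?N \<omega>\<bar>
          = \<bar>cyl_prob W \<zeta> (override_on \<omega> \<zeta> ?\<Lambda>) - cyl_prob W \<zeta> \<eta>\<bar> * ?N \<omega>"
          unfolding * by (simp add: left_diff_distrib[symmetric] abs_mult)
        also have "\<dots> \<le> e * ?N \<omega>" by (intro mult_right_mono **) simp
        finally show "\<bar>cyl_prob ?\<Lambda> \<zeta> \<omega> - cyl_prob W \<zeta> \<eta> * ?N \<omega>\<bar> \<le> e * ?N \<omega>" .
      qed
      also have "\<dots> = e * M n" by (simp add: M_def)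
      finally show ?thesis .
    qed
    then show ?thesis unfolding eventually_sequentially by blast
  qed
  \<comment> \<open>\<open>M n\<close> dominates a Gibbs cylinder probability and may therefore be
    divided by.\<close>
  have M_pos: "\<forall>\<^sub>F n in sequentially. M n > 0"
  proof -
    have "M n > 0" if n: "n \<ge> n0" for n
    proof -
      have "measure \<mu> (cyl (lattice_box n) \<eta>) \<le> M n"
        unfolding M_def gibbsD(2)[OF \<mu> lattice_box_in_volumes]
      proof (rule integral_mono[OF integrable_continuous[OF prob continuous_cyl_prob[OF lattice_box_in_volumes]] int])
        fix \<omega>
        interpret k: prob_space "\<gamma> (lattice_box n) \<omega>" using prob_measuresD[OF kernel_prob] by auto
        show "cyl_prob (lattice_box n) \<eta> \<omega> \<le> measure (\<gamma> (lattice_box n) \<omega>) (cyl (lattice_box n - W) \<eta>)"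
          unfolding cyl_prob_def
          by (rule k.finite_measure_mono) (use prob_measuresD(2)[OF kernel_prob] in \<open>auto simp: cyl_def\<close>)
      qed
      then show ?thesis using gibbs_cyl_pos[OF \<mu>, of "lattice_box n" \<eta>] by simp
    qed
    then show ?thesis unfolding eventually_sequentially by blast
  qed
  have lim: "(\<lambda>n. measure \<mu> (cyl (lattice_box n) \<zeta>) / M n) \<longlonglongrightarrow> cyl_prob W \<zeta> \<eta>" if \<zeta>: "\<zeta> \<in> cyl (- W) \<eta>" for \<zeta>
  proof (rule tendstoI)
    fix e :: real assume "e > 0"
    then have "e / 2 > 0" by simp
    from near[OF this \<zeta>] M_pos
    show "\<forall>\<^sub>F n in sequentially. dist (measure \<mu> (cyl (lattice_box n) \<zeta>) / M n) (cyl_prob W \<zeta> \<eta>) < e"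
    proof eventually_elim
      case (elim n)
      have "dist (measure \<mu> (cyl (lattice_box n) \<zeta>) / M n) (cyl_prob W \<zeta> \<eta>)
        = \<bar>measure \<mu> (cyl (lattice_box n) \<zeta>) - cyl_prob W \<zeta> \<eta> * M n\<bar> / M n"
        using elim by (simp add: dist_real_def abs_div_pos diff_divide_distrib)
      also have "\<dots> \<le> e / 2" using elim by (simp add: divide_le_eq)
      also have "\<dots> < e" using \<open>e > 0\<close> by simp
      finally show ?case .
    qed
  qed
  have "(\<lambda>n. (measure \<mu> (cyl (lattice_box n) \<eta>') / M n) / (measure \<mu> (cyl (lattice_box n) \<eta>) / M n))
      \<longlonglongrightarrow> cyl_prob W \<eta>' \<eta> / cyl_prob W \<eta> \<eta>"
    using cyl_prob_pos[OF W, of \<eta> \<eta>] by (intro tendsto_divide lim agree) auto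
  moreover have "\<forall>\<^sub>F n in sequentially. (measure \<mu> (cyl (lattice_box n) \<eta>') / M n) / (measure \<mu> (cyl (lattice_box n) \<eta>) / M n)
      = measure \<mu> (cyl (lattice_box n) \<eta>') / measure \<mu> (cyl (lattice_box n) \<eta>)"
    using M_pos by eventually_elim simp
  ultimately show ?thesis by (rule Lim_transform_eventually)
qed

end

section \<open>Transitions and rates\<close>

lemma translate_translate [simp]: "translate i (translate j \<Lambda>) = translate (i + j) \<Lambda>"
  by (auto simp: translate_def image_iff algebra_simps)

lemma translate_0 [simp]: "translate 0 \<Lambda> = \<Lambda>"
  by (simp add: translate_def)

lemma mem_translate_iff: "x \<in> translate i \<Lambda> \<longleftrightarrow> x - i \<in> \<Lambda>"
  by (auto simp: translate_def image_iff) (metis diff_add_cancel)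

lemma finite_translate [simp]: "finite (translate i \<Lambda>) \<longleftrightarrow> finite \<Lambda>"
  by (simp add: translate_def finite_image_iff)

lemma card_translate [simp]: "card (translate i \<Lambda>) = card \<Lambda>"
  by (simp add: translate_def card_image)

lemma translate_volumes [simp]: "translate i \<Lambda> \<in> volumes \<longleftrightarrow> \<Lambda> \<in> volumes"
  by (auto simp: volumes_iff translate_def finite_image_iff)

lemma shift_patterns: "\<xi> \<in> patterns \<Delta> \<Longrightarrow> shift i \<xi> \<in> patterns (translate i \<Delta>)"
  by (auto simp: patterns_def shift_def PiE_def extensional_def mem_translate_iff)

lemma shift_override: "shift i (override_on \<omega> \<xi> \<Delta>) = override_on (shift i \<omega>) (shift i \<xi>) (translate i \<Delta>)"
  by (auto simp: shift_def override_on_def mem_translate_iff)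

lemma shift_restrict: "shift i (restrict \<omega> \<Delta>) = restrict (shift i \<omega>) (translate i \<Delta>)"
  by (auto simp: shift_def restrict_def mem_translate_iff)

lemma shift_cyl_iff: "shift i \<omega> \<in> cyl (translate i \<Lambda>) (shift i \<eta>) \<longleftrightarrow> \<omega> \<in> cyl \<Lambda> \<eta>"
  by (auto simp: cyl_def shift_def mem_translate_iff translate_def)

lemma shift_inj [simp]: "shift i \<omega> = shift i \<omega>' \<longleftrightarrow> \<omega> = \<omega>'"
  by (metis add.left_inverse shift_0 shift_shift)

definition shift_transition :: "('d::finite) site \<Rightarrow> 'd site set \<times> ('d, 'q) config \<Rightarrow> 'd site set \<times> ('d, 'q) config" where
  "shift_transition i \<tau> = (translate i (fst \<tau>), shift i (snd \<tau>))"

definition move :: "('d::finite) site set \<times> ('d, 'q) config \<Rightarrow> ('d, 'q) config \<Rightarrow> ('d, 'q) config" where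
  "move \<tau> \<omega> = override_on \<omega> (snd \<tau>) (fst \<tau>)"

lemma shift_transition_0 [simp]: "shift_transition 0 \<tau> = \<tau>"
  by (simp add: shift_transition_def)

lemma shift_transition_add [simp]: "shift_transition i (shift_transition j \<tau>) = shift_transition (i + j) \<tau>"
  by (simp add: shift_transition_def)

lemma move_shift: "move (shift_transition i \<tau>) (shift i \<omega>) = shift i (move \<tau> \<omega>)"
  by (simp add: move_def shift_transition_def shift_override)

lemma continuous_on_compose_move [continuous_intros]:
  "continuous_on UNIV f \<Longrightarrow> continuous_on UNIV (\<lambda>\<eta>::('d::finite, 'q::finite) config. f (move \<tau> \<eta>))"
  unfolding move_def by (rule continuous_intros)

lemma move_cyl_cong:
  assumes "\<omega>' \<in> cyl \<Lambda> \<omega>" shows "move \<tau> \<omega>' \<in> cyl \<Lambda> (move \<tau> \<omega>)"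
  using assms by (auto simp: cyl_def move_def override_on_def)

section \<open>Transitions and uniform bounds on their rates\<close>

locale translation_invariant_rates_system =
  fixes c :: "('d::finite, 'q::finite) rates"
  assumes ips_rates: "ips_rates c"
    and rates_shift: "translation_invariant_rates c"
    and types: "finitely_many_types c"
    and positive_minimal: "positive_minimal_rates c"
begin

text \<open>Moves that leave the configuration unchanged are excluded, to match
  \<open>max_rate\<close>: only for sets with a genuine change do the finiteness of types and the
  minimal rates say anything.\<close>

definition active :: "'d site set \<Rightarrow> bool" where
  "active \<Delta> \<longleftrightarrow> \<Delta> \<in> volumes \<and> (\<exists>\<eta>. \<exists>\<xi>\<in>patterns \<Delta>. c \<Delta> \<eta> \<xi> > 0 \<and> \<xi> \<noteq> restrict \<eta> \<Delta>)"

text \<open>All patterns are listed for each active set, also those of rate zero at some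
  configurations, so that sums over moves have an index set independent of the
  configuration.\<close>

definition transitions :: "'d site set \<Rightarrow> ('d site set \<times> ('d, 'q) config) set" where
  "transitions \<Lambda> = (SIGMA \<Delta>:{\<Delta>. active \<Delta> \<and> \<Delta> \<inter> \<Lambda> \<noteq> {}}. patterns \<Delta>)"

definition rate :: "'d site set \<times> ('d, 'q) config \<Rightarrow> ('d, 'q) config \<Rightarrow> real" where
  "rate \<tau> \<omega> = c (fst \<tau>) \<omega> (snd \<tau>)"

lemma transitionsD:
  assumes "\<tau> \<in> transitions \<Lambda>"
  shows "active (fst \<tau>)" "fst \<tau> \<inter> \<Lambda> \<noteq> {}" "snd \<tau> \<in> patterns (fst \<tau>)" "fst \<tau> \<in> volumes" "finite (fst \<tau>)"
  using assms by (auto simp: transitions_def active_def volumes_iff)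

lemma c_cont: "\<Delta> \<in> volumes \<Longrightarrow> \<xi> \<in> patterns \<Delta> \<Longrightarrow> continuous_on UNIV (\<lambda>\<eta>. c \<Delta> \<eta> \<xi>)"
  and c_nonneg: "\<Delta> \<in> volumes \<Longrightarrow> \<xi> \<in> patterns \<Delta> \<Longrightarrow> 0 \<le> c \<Delta> \<eta> \<xi>"
  using ips_rates by (auto simp: ips_rates_def)

lemma rate_cont [continuous_intros]: "\<tau> \<in> transitions \<Lambda> \<Longrightarrow> continuous_on UNIV (rate \<tau>)"
  unfolding rate_def by (intro c_cont transitionsD)

lemma rate_nonneg: "\<tau> \<in> transitions \<Lambda> \<Longrightarrow> 0 \<le> rate \<tau> \<omega>"
  unfolding rate_def by (intro c_nonneg transitionsD)

lemma transitions_mono: "\<Lambda> \<subseteq> \<Lambda>' \<Longrightarrow> transitions \<Lambda> \<subseteq> transitions \<Lambda>'"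
  by (auto simp: transitions_def)

lemma transitions_Union: "transitions \<Lambda> = (\<Union>x\<in>\<Lambda>. transitions {x})"
  by (auto simp: transitions_def)

lemma active_translate: "active \<Delta> \<Longrightarrow> active (translate i \<Delta>)"
proof -
  assume "active \<Delta>"
  then obtain \<eta> \<xi> where *: "\<Delta> \<in> volumes" "\<xi> \<in> patterns \<Delta>" "c \<Delta> \<eta> \<xi> > 0" "\<xi> \<noteq> restrict \<eta> \<Delta>"
    by (auto simp: active_def)
  then have "c (translate i \<Delta>) (shift i \<eta>) (shift i \<xi>) > 0"
    using rates_shift by (auto simp: translation_invariant_rates_def)
  moreover have "shift i \<xi> \<noteq> restrict (shift i \<eta>) (translate i \<Delta>)"
    using * by (simp flip: shift_restrict)
  ultimately show ?thesis
    using * shift_patterns[of \<xi> \<Delta> i] by (auto simp: active_def)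
qed

lemma shift_transitions:
  assumes "\<tau> \<in> transitions \<Lambda>" shows "shift_transition i \<tau> \<in> transitions (translate i \<Lambda>)"
proof -
  have "translate i (fst \<tau>) \<inter> translate i \<Lambda> \<noteq> {}"
    using transitionsD(2)[OF assms] by (auto simp: translate_def)
  then show ?thesis
    using transitionsD[OF assms] by (auto simp: transitions_def shift_transition_def active_translate shift_patterns)
qed

lemma transitions_translate: "transitions (translate i \<Lambda>) = shift_transition i ` transitions \<Lambda>"
proof (intro equalityI subsetI)
  fix \<tau> assume "\<tau> \<in> transitions (translate i \<Lambda>)"
  from shift_transitions[OF this, of "- i"] show "\<tau> \<in> shift_transition i ` transitions \<Lambda>"
    by (auto intro!: image_eqI[of _ _ "shift_transition (- i) \<tau>"])
qed (auto intro: shift_transitions)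

lemma inj_shift_transition: "inj_on (shift_transition i) A"
  by (rule inj_on_inverseI[of _ "shift_transition (- i)"]) simp

lemma rate_shift:
  assumes "\<tau> \<in> transitions \<Lambda>"
  shows "rate (shift_transition i \<tau>) (shift i \<omega>) = rate \<tau> \<omega>"
  using rates_shift transitionsD[OF assms] by (auto simp: rate_def shift_transition_def translation_invariant_rates_def)

lemma active_max_rate:
  assumes "active \<Delta>" shows "max_rate c \<Delta> > 0"
proof -
  obtain \<eta> \<xi> where *: "\<Delta> \<in> volumes" "\<xi> \<in> patterns \<Delta>" "c \<Delta> \<eta> \<xi> > 0" "\<xi> \<noteq> restrict \<eta> \<Delta>"
    using assms by (auto simp: active_def)
  have fin: "finite (patterns \<Delta> :: ('d, 'q) config set)" using * by (simp add: volumes_iff)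
  \<comment> \<open>The rates are bounded by compactness; without an upper bound the supremum in
    \<open>max_rate\<close> would carry no information.\<close>
  obtain B where B: "\<And>\<xi> \<omega>. \<xi> \<in> patterns \<Delta> \<Longrightarrow> \<bar>c \<Delta> \<omega> \<xi>\<bar> \<le> B \<xi>"
    using continuous_bounded[OF c_cont[OF *(1)]] by metis
  have "exit_rate c \<Delta> \<omega> \<le> (\<Sum>\<xi>\<in>patterns \<Delta>. B \<xi>)" for \<omega>
    unfolding exit_rate_def
  proof (rule order_trans[OF sum_mono sum_mono2])
    show "c \<Delta> \<omega> \<xi> \<le> B \<xi>" if "\<xi> \<in> patterns \<Delta> - {restrict \<omega> \<Delta>}" for \<xi>
      using B[of \<xi> \<omega>] that by auto
    show "0 \<le> B \<xi>" if "\<xi> \<in> patterns \<Delta> - (patterns \<Delta> - {restrict \<omega> \<Delta>})" for \<xi>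
      using B[of \<xi> \<omega>] that by auto
  qed (use fin in auto)
  then have bdd: "bdd_above (range (exit_rate c \<Delta>))" by (intro bdd_aboveI) auto
  have "0 < c \<Delta> \<eta> \<xi>" by fact
  also have "\<dots> \<le> exit_rate c \<Delta> \<eta>"
    unfolding exit_rate_def using * fin c_nonneg by (intro member_le_sum) auto
  also have "\<dots> \<le> max_rate c \<Delta>"
    unfolding max_rate_def by (rule cSUP_upper[OF _ bdd]) simp
  finally show ?thesis .
qed

lemma finite_transitions_site: "finite (transitions {x})"
proof -
  obtain \<D> where \<D>: "finite \<D>" "\<And>\<Delta>. \<Delta> \<in> volumes \<Longrightarrow> max_rate c \<Delta> > 0 \<Longrightarrow> \<exists>D\<in>\<D>. \<exists>i. \<Delta> = translate i D"
    using types by (auto simp: finitely_many_types_def)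
  \<comment> \<open>A translate of D that contains x is determined by the point y of D that is moved
    to x.\<close>
  have "{\<Delta>. active \<Delta> \<and> \<Delta> \<inter> {x} \<noteq> {}} \<subseteq> (\<Union>D\<in>{D\<in>\<D>. finite D}. \<Union>y\<in>D. {translate (x - y) D})"
  proof
    fix \<Delta> assume "\<Delta> \<in> {\<Delta>. active \<Delta> \<and> \<Delta> \<inter> {x} \<noteq> {}}"
    then have \<Delta>: "active \<Delta>" "x \<in> \<Delta>" by auto
    then have "\<Delta> \<in> volumes" by (simp add: active_def)
    then obtain D i where D: "D \<in> \<D>" "\<Delta> = translate i D" using \<D>(2) active_max_rate[OF \<Delta>(1)] by blast
    have "finite D" using \<open>\<Delta> \<in> volumes\<close> D by (simp add: volumes_iff)
    moreover have "x - i \<in> D" using \<Delta> D by (simp add: mem_translate_iff)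
    moreover have "\<Delta> = translate (x - (x - i)) D" using D by simp
    ultimately show "\<Delta> \<in> (\<Union>D\<in>{D\<in>\<D>. finite D}. \<Union>y\<in>D. {translate (x - y) D})" using D(1) by blast
  qed
  then have "finite {\<Delta>. active \<Delta> \<and> \<Delta> \<inter> {x} \<noteq> {}}"
    by (rule finite_subset) (use \<D>(1) in auto)
  then show ?thesis
    unfolding transitions_def by (rule finite_SigmaI) (auto simp: active_def volumes_iff)
qed

lemma finite_transitions [simp]: "finite \<Lambda> \<Longrightarrow> finite (transitions \<Lambda>)"
  by (subst transitions_Union) (auto simp: finite_transitions_site)

lemma card_transitions:
  assumes "finite \<Lambda>" shows "card (transitions \<Lambda>) \<le> card (transitions {0}) * card \<Lambda>"
proof -
  have site: "card (transitions {x}) = card (transitions {0})" for x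
    using transitions_translate[of x "{0}"] by (simp add: translate_def card_image inj_shift_transition)
  have "card (transitions \<Lambda>) \<le> (\<Sum>x\<in>\<Lambda>. card (transitions {x}))"
    by (subst transitions_Union) (rule card_UN_le[OF assms])
  also have "\<dots> = (\<Sum>x\<in>\<Lambda>. card (transitions {0}))"
    by (rule sum.cong[OF refl site])
  finally show ?thesis by (simp add: mult.commute)
qed

lemma transitions_site_cases:
  assumes "\<tau> \<in> transitions {x}"
  obtains \<tau>0 where "\<tau>0 \<in> transitions {0}" "\<tau> = shift_transition x \<tau>0"
  using assms transitions_translate[of x "{0}"] by (auto simp: translate_def)

lemma transitions_cases:
  assumes "\<tau> \<in> transitions \<Lambda>"
  obtains x \<tau>0 where "x \<in> \<Lambda>" "\<tau>0 \<in> transitions {0}" "\<tau> = shift_transition x \<tau>0"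
  using assms transitions_site_cases by (subst (asm) transitions_Union) blast

lemma rate_shift': "\<tau> \<in> transitions \<Lambda> \<Longrightarrow> rate (shift_transition i \<tau>) \<omega> = rate \<tau> (shift (- i) \<omega>)"
  using rate_shift[of \<tau> \<Lambda> i "shift (- i) \<omega>"] by simp

text \<open>Up to translation only the finitely many transitions meeting the origin occur, so maxima
  and minima over \<open>transitions {0}\<close> serve all volumes.\<close>

lemma ex_transition_bounds:
  "\<exists>C D \<kappa>. 0 \<le> C \<and> 0 < \<kappa> \<and> (\<forall>\<Lambda>. \<forall>\<tau>\<in>transitions \<Lambda>. card (fst \<tau>) \<le> D \<and>
    (\<forall>\<omega>. rate \<tau> \<omega> \<le> C \<and> (rate \<tau> \<omega> > 0 \<longrightarrow> \<kappa> \<le> rate \<tau> \<omega>)))"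
proof -
  have "\<exists>B k. 0 < k \<and> (\<forall>\<omega>. rate \<tau> \<omega> \<le> B \<and> (rate \<tau> \<omega> > 0 \<longrightarrow> k \<le> rate \<tau> \<omega>))" if \<tau>: "\<tau> \<in> transitions {0}" for \<tau>
  proof -
    let ?S = "{(\<eta>, \<xi>). \<xi> \<in> patterns (fst \<tau>) \<and> c (fst \<tau>) \<eta> \<xi> > 0}"
    let ?k = "INF (\<eta>, \<xi>) \<in> ?S. c (fst \<tau>) \<eta> \<xi>"
    have k: "?k > 0"
      using positive_minimal active_max_rate[OF transitionsD(1)[OF \<tau>]] transitionsD(4)[OF \<tau>]
      by (auto simp: positive_minimal_rates_def)
    have "?k \<le> rate \<tau> \<omega>" if "rate \<tau> \<omega> > 0" for \<omega>
    proof -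
      have "?k \<le> (\<lambda>(\<eta>, \<xi>). c (fst \<tau>) \<eta> \<xi>) (\<omega>, snd \<tau>)"
        by (rule cINF_lower) (use that transitionsD[OF \<tau>] in \<open>auto intro!: bdd_belowI[of _ 0] simp: rate_def\<close>)
      then show ?thesis by (simp add: rate_def)
    qed
    moreover obtain B where "\<forall>\<omega>. \<bar>rate \<tau> \<omega>\<bar> \<le> B" using continuous_bounded[OF rate_cont[OF \<tau>]] by blast
    ultimately show ?thesis using k by (meson abs_le_D1)
  qed
  then obtain B k where Bk: "\<And>\<tau> \<omega>. \<tau> \<in> transitions {0} \<Longrightarrow> rate \<tau> \<omega> \<le> B \<tau>" "\<And>\<tau>. \<tau> \<in> transitions {0} \<Longrightarrow> 0 < k \<tau>"
    "\<And>\<tau> \<omega>. \<tau> \<in> transitions {0} \<Longrightarrow> rate \<tau> \<omega> > 0 \<Longrightarrow> k \<tau> \<le> rate \<tau> \<omega>"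
    by metis
  \<comment> \<open>The inserted 0 and 1 keep \<open>Max\<close> and \<open>Min\<close> meaningful
    if there are no transitions at all.\<close>
  define C where "C = Max (insert 0 (B ` transitions {0}))"
  define \<kappa> where "\<kappa> = Min (insert 1 (k ` transitions {0}))"
  define D where "D = Max (insert 0 ((\<lambda>\<tau>. card (fst \<tau>)) ` transitions {0}))"
  have fin: "finite (transitions {0})" by simp
  have C: "B \<tau> \<le> C" "k \<tau> \<ge> \<kappa>" "card (fst \<tau>) \<le> D" if "\<tau> \<in> transitions {0}" for \<tau>
    unfolding C_def \<kappa>_def D_def using that fin by (auto intro!: Max_ge Min_le)
  have 0: "0 \<le> C" "0 < \<kappa>" unfolding C_def \<kappa>_def using fin Bk(2) by (auto intro!: Max_ge)
  show ?thesis
  proof (rule exI[of _ C], rule exI[of _ D], rule exI[of _ \<kappa>], intro conjI 0 allI ballI impI)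
    fix \<Lambda> \<tau> \<omega> assume "\<tau> \<in> transitions \<Lambda>"
    then obtain x \<tau>0 where \<tau>: "\<tau>0 \<in> transitions {0}" "\<tau> = shift_transition x \<tau>0" by (rule transitions_cases)
    show "card (fst \<tau>) \<le> D" using C(3)[OF \<tau>(1)] \<tau>(2) by (simp add: shift_transition_def)
    show "rate \<tau> \<omega> \<le> C" using order_trans[OF Bk(1)[OF \<tau>(1)] C(1)[OF \<tau>(1)]] by (simp add: \<tau> rate_shift'[OF \<tau>(1)])
    assume "rate \<tau> \<omega> > 0"
    then show "\<kappa> \<le> rate \<tau> \<omega>"
      using order_trans[OF C(2)[OF \<tau>(1)] Bk(3)[OF \<tau>(1)]] by (simp add: \<tau> rate_shift'[OF \<tau>(1)])
  qed
qed

text \<open>Relative rather than additive closeness is what the logarithms in the entropy require.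
  It includes that configurations agreeing near x allow the same moves at x.\<close>

lemma rate_relative_continuity:
  assumes "a > 1"
  shows "\<exists>r. \<forall>x. \<forall>\<tau>\<in>transitions {x}. \<forall>\<omega>. \<forall>\<omega>'\<in>cyl (translate x (lattice_box r)) \<omega>. rate \<tau> \<omega>' \<le> a * rate \<tau> \<omega>"
proof -
  obtain C D \<kappa> where \<kappa>: "\<kappa> > 0" "\<And>\<Lambda> \<tau> \<omega>. \<tau> \<in> transitions \<Lambda> \<Longrightarrow> rate \<tau> \<omega> > 0 \<Longrightarrow> \<kappa> \<le> rate \<tau> \<omega>"
    using ex_transition_bounds by metis
  \<comment> \<open>The first term makes nearby rates vanish together, as nonzero ones are at least
    \<kappa>; the second turns an additive error into a relative one.\<close>
  define e where "e = min (\<kappa> / 2) ((a - 1) * \<kappa>)"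
  have e: "e > 0" using \<kappa> assms by (simp add: e_def)
  have "\<exists>\<Lambda>. finite \<Lambda> \<and> (\<forall>\<omega>. \<forall>\<omega>'\<in>cyl \<Lambda> \<omega>. \<bar>rate \<tau> \<omega>' - rate \<tau> \<omega>\<bar> < e)" if "\<tau> \<in> transitions {0}" for \<tau>
    by (rule uniform_continuity[OF rate_cont[OF that] e])
  then obtain F where F: "\<And>\<tau>. \<tau> \<in> transitions {0} \<Longrightarrow> finite (F \<tau>)"
    "\<And>\<tau> \<omega> \<omega>'. \<tau> \<in> transitions {0} \<Longrightarrow> \<omega>' \<in> cyl (F \<tau>) \<omega> \<Longrightarrow> \<bar>rate \<tau> \<omega>' - rate \<tau> \<omega>\<bar> < e"
    by metis
  obtain r where r: "(\<Union>\<tau>\<in>transitions {0}. F \<tau>) \<subseteq> lattice_box r"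
    using finite_subset_lattice_box[of "\<Union>\<tau>\<in>transitions {0}. F \<tau>"] F(1) by auto
  have 0: "rate \<tau> \<omega>' \<le> a * rate \<tau> \<omega>" if "\<tau> \<in> transitions {0}" "\<omega>' \<in> cyl (lattice_box r) \<omega>" for \<tau> \<omega> \<omega>'
  proof -
    have "\<omega>' \<in> cyl (F \<tau>) \<omega>" using that r by (auto simp: cyl_def)
    from F(2)[OF that(1) this] have d: "\<bar>rate \<tau> \<omega>' - rate \<tau> \<omega>\<bar> < e" .
    show ?thesis
    proof (cases "rate \<tau> \<omega> > 0")
      case True
      then have "\<kappa> \<le> rate \<tau> \<omega>" using \<kappa>(2)[OF that(1)] by simp
      then have "(a - 1) * \<kappa> \<le> (a - 1) * rate \<tau> \<omega>" using assms by (intro mult_left_mono) auto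
      then show ?thesis using d by (auto simp: e_def algebra_simps)
    next
      case False
      then have "rate \<tau> \<omega> = 0" using rate_nonneg[OF that(1), of \<omega>] by simp
      moreover have "rate \<tau> \<omega>' = 0"
      proof (rule ccontr)
        assume "rate \<tau> \<omega>' \<noteq> 0"
        then have "rate \<tau> \<omega>' > 0" using rate_nonneg[OF that(1), of \<omega>'] by simp
        then have "\<kappa> \<le> rate \<tau> \<omega>'" using \<kappa>(2)[OF that(1)] by simp
        then show False using d \<open>rate \<tau> \<omega> = 0\<close> \<kappa>(1) by (simp add: e_def)
      qed
      ultimately show ?thesis by simp
    qed
  qed
  show ?thesis
  proof (intro exI[of _ r] allI ballI)
    fix x \<tau> and \<omega> \<omega>' :: "('d, 'q) config"
    assume *: "\<tau> \<in> transitions {x}" "\<omega>' \<in> cyl (translate x (lattice_box r)) \<omega>"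
    obtain \<tau>0 where \<tau>: "\<tau>0 \<in> transitions {0}" "\<tau> = shift_transition x \<tau>0" using *(1) by (rule transitions_site_cases)
    have "shift (- x) \<omega>' \<in> cyl (lattice_box r) (shift (- x) \<omega>)"
      using *(2) by (auto simp: cyl_def shift_def mem_translate_iff)
    from 0[OF \<tau>(1) this] show "rate \<tau> \<omega>' \<le> a * rate \<tau> \<omega>"
      by (simp add: \<tau> rate_shift'[OF \<tau>(1)])
  qed
qed

text \<open>Sets missing \<Lambda> do not change f, and sets that are not active contribute only
  zero rates or idle moves. What is left is a finite sum, so no question of convergence arises for
  local functions.\<close>

lemma generator_local:
  fixes f :: "('d, 'q) config \<Rightarrow> real"
  assumes "finite \<Lambda>" "\<And>\<omega> \<omega>'. \<omega>' \<in> cyl \<Lambda> \<omega> \<Longrightarrow> f \<omega>' = f \<omega>"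
  shows "generator c f \<omega> = (\<Sum>\<tau>\<in>transitions \<Lambda>. rate \<tau> \<omega> * (f (move \<tau> \<omega>) - f \<omega>))"
proof -
  let ?G = "\<lambda>\<Delta>. \<Sum>\<xi>\<in>patterns \<Delta>. c \<Delta> \<omega> \<xi> * (f (override_on \<omega> \<xi> \<Delta>) - f \<omega>)"
  let ?A = "{\<Delta>. active \<Delta> \<and> \<Delta> \<inter> \<Lambda> \<noteq> {}}"
  have "?A = fst ` transitions \<Lambda>"
    using patterns_nonempty by (force simp: transitions_def image_iff)
  then have fin: "finite ?A" using assms(1) by simp
  have "?G \<Delta> = 0" if "\<Delta> \<in> volumes - ?A" for \<Delta>
  proof (rule sum.neutral, rule ballI)
    fix \<xi> :: "('d, 'q) config" assume \<xi>: "\<xi> \<in> patterns \<Delta>"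
    show "c \<Delta> \<omega> \<xi> * (f (override_on \<omega> \<xi> \<Delta>) - f \<omega>) = 0"
    proof (cases "active \<Delta>")
      case True
      then have "override_on \<omega> \<xi> \<Delta> \<in> cyl \<Lambda> \<omega>"
        using that by (auto simp: cyl_def override_on_def)
      then show ?thesis using assms(2) by simp
    next
      case False
      then have "\<not> c \<Delta> \<omega> \<xi> > 0 \<or> \<xi> = restrict \<omega> \<Delta>"
        using that \<xi> by (auto simp: active_def)
      then show ?thesis
      proof
        assume "\<not> c \<Delta> \<omega> \<xi> > 0"
        then show ?thesis using c_nonneg[OF _ \<xi>, of \<omega>] that by simp
      next
        assume "\<xi> = restrict \<omega> \<Delta>"
        then have "override_on \<omega> \<xi> \<Delta> = \<omega>" by (auto simp: override_on_def)
        then show ?thesis by simp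
      qed
    qed
  qed
  moreover have "?A \<subseteq> volumes" by (auto simp: active_def)
  ultimately have "generator c f \<omega> = infsum ?G ?A"
    unfolding generator_def by (intro infsum_cong_neutral) auto
  also have "\<dots> = sum ?G ?A" using fin by simp
  also have "\<dots> = (\<Sum>\<tau>\<in>transitions \<Lambda>. rate \<tau> \<omega> * (f (move \<tau> \<omega>) - f \<omega>))"
    unfolding transitions_def rate_def move_def
    by (subst sum.Sigma) (use fin in \<open>auto simp: active_def volumes_iff split_def\<close>)
  finally show ?thesis .
qed

lemma generator_local_continuous:
  fixes f :: "('d, 'q) config \<Rightarrow> real"
  assumes "finite \<Lambda>" "\<And>\<omega> \<omega>'. \<omega>' \<in> cyl \<Lambda> \<omega> \<Longrightarrow> f \<omega>' = f \<omega>"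
  shows "continuous_on UNIV (generator c f)"
proof -
  have "generator c f = (\<lambda>\<omega>. \<Sum>\<tau>\<in>transitions \<Lambda>. rate \<tau> \<omega> * (f (move \<tau> \<omega>) - f \<omega>))"
    by (rule ext, rule generator_local[OF assms])
  then show ?thesis
    using continuous_on_local[OF assms] by (auto intro!: continuous_intros)
qed

text \<open>Moves from the cylinder of \<eta> to itself are included. They are also counted in
  \<open>total_rate\<close>, so they cancel in the generator.\<close>

definition inflow :: "'d site set \<Rightarrow> ('d, 'q) config \<Rightarrow> ('d, 'q) config \<Rightarrow> real" where
  "inflow \<Lambda> \<eta> \<omega> = (\<Sum>\<tau>\<in>transitions \<Lambda>. rate \<tau> \<omega> * indicator (cyl \<Lambda> \<eta>) (move \<tau> \<omega>))"

definition total_rate :: "'d site set \<Rightarrow> ('d, 'q) config \<Rightarrow> real" where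
  "total_rate \<Lambda> \<omega> = (\<Sum>\<tau>\<in>transitions \<Lambda>. rate \<tau> \<omega>)"

lemma inflow_cont [continuous_intros]: "finite \<Lambda> \<Longrightarrow> continuous_on UNIV (inflow \<Lambda> \<eta>)"
  unfolding inflow_def
  by (intro continuous_on_sum continuous_on_mult rate_cont continuous_on_compose_move continuous_on_indicator_cyl)

lemma total_rate_cont [continuous_intros]: "finite \<Lambda> \<Longrightarrow> continuous_on UNIV (total_rate \<Lambda>)"
  unfolding total_rate_def by (auto intro!: continuous_intros)

lemma inflow_nonneg: "0 \<le> inflow \<Lambda> \<eta> \<omega>"
  unfolding inflow_def by (intro sum_nonneg mult_nonneg_nonneg rate_nonneg) auto

lemma inflow_cong: "\<eta>' \<in> cyl \<Lambda> \<eta> \<Longrightarrow> inflow \<Lambda> \<eta>' = inflow \<Lambda> \<eta>"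
  by (simp add: inflow_def cyl_cong fun_eq_iff)

lemma sum_inflow: "finite \<Lambda> \<Longrightarrow> (\<Sum>\<eta>\<in>patterns \<Lambda>. inflow \<Lambda> \<eta> \<omega>) = total_rate \<Lambda> \<omega>"
  unfolding inflow_def total_rate_def
  by (subst sum.swap, rule sum.cong[OF refl], rule sum_indicator_cyl)

lemma generator_indicator_cyl:
  assumes "finite \<Lambda>"
  shows "generator c (indicator (cyl \<Lambda> \<eta>)) \<omega> = inflow \<Lambda> \<eta> \<omega> - total_rate \<Lambda> \<omega> * indicator (cyl \<Lambda> \<eta>) \<omega>"
  by (subst generator_local[OF assms])
    (auto simp: inflow_def total_rate_def algebra_simps sum_subtractf sum_distrib_left cyl_def indicator_def)

lemma inflow_shift:
  assumes "finite \<Lambda>"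
  shows "inflow (translate i \<Lambda>) (shift i \<eta>) (shift i \<omega>) = inflow \<Lambda> \<eta> \<omega>"
  unfolding inflow_def transitions_translate
  by (subst sum.reindex[OF inj_shift_transition])
    (auto intro!: sum.cong simp: rate_shift move_shift indicator_def shift_cyl_iff)

text \<open>Start and target differ at a site of S, and a move leading from one to the other has to
  touch that site.\<close>

lemma inflow_restrict_sites:
  assumes "finite \<Lambda>" "S \<subseteq> \<Lambda>" "\<omega> \<in> cyl \<Lambda> \<eta>" "\<exists>x\<in>S. \<eta> x \<noteq> \<eta>' x"
  shows "inflow \<Lambda> \<eta>' \<omega> = (\<Sum>\<tau>\<in>transitions S. rate \<tau> \<omega> * indicator (cyl \<Lambda> \<eta>') (move \<tau> \<omega>))"
proof -
  have "move \<tau> \<omega> \<notin> cyl \<Lambda> \<eta>'" if "\<tau> \<in> transitions \<Lambda> - transitions S" for \<tau>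
  proof
    assume *: "move \<tau> \<omega> \<in> cyl \<Lambda> \<eta>'"
    obtain x where x: "x \<in> S" "\<eta> x \<noteq> \<eta>' x" using assms by blast
    have "fst \<tau> \<inter> S = {}" using that by (auto simp: transitions_def)
    then have "move \<tau> \<omega> x = \<omega> x" using x by (auto simp: move_def override_on_def)
    then show False using * x assms by (auto simp: cyl_def)
  qed
  then show ?thesis
    unfolding inflow_def
    by (intro sum.mono_neutral_right) (use assms transitions_mono[OF assms(2)] in auto)
qed

end

section \<open>Balanced measures are Gibbs measures\<close>

text \<open>Conditioning on ever longer agreement with \<eta> recovers the value of a continuous
  function at \<eta>, even if the single configuration \<eta> carries no mass.\<close>

lemma integral_cyl_average_limit:
  fixes f :: "('d::finite, 'q::finite) config \<Rightarrow> real"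
  assumes M: "M \<in> prob_measures" and f: "continuous_on UNIV f"
    and pos: "\<And>n. measure M (cyl (lattice_box n) \<eta>) > 0"
  shows "(\<lambda>n. (\<integral>\<omega>. indicator (cyl (lattice_box n) \<eta>) \<omega> * f \<omega> \<partial>M) / measure M (cyl (lattice_box n) \<eta>)) \<longlonglongrightarrow> f \<eta>"
proof (rule tendstoI)
  fix e :: real assume "e > 0"
  then have e2: "e / 2 > 0" by simp
  obtain \<Lambda> where \<Lambda>: "finite \<Lambda>" "\<And>\<omega> \<omega>'. \<omega>' \<in> cyl \<Lambda> \<omega> \<Longrightarrow> \<bar>f \<omega>' - f \<omega>\<bar> < e / 2"
    using uniform_continuity[OF f e2] by blast
  obtain n0 where n0: "\<Lambda> \<subseteq> lattice_box n0" using finite_subset_lattice_box[OF \<Lambda>(1)] by blast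
  have "dist ((\<integral>\<omega>. indicator (cyl (lattice_box n) \<eta>) \<omega> * f \<omega> \<partial>M) / measure M (cyl (lattice_box n) \<eta>)) (f \<eta>) < e"
    if n: "n \<ge> n0" for n
  proof -
    let ?I = "indicator (cyl (lattice_box n) \<eta>) :: ('d, 'q) config \<Rightarrow> real"
    let ?p = "measure M (cyl (lattice_box n) \<eta>)"
    have int: "integrable M (\<lambda>\<omega>. ?I \<omega> * g \<omega>)" if "continuous_on UNIV g" for g
      by (rule integrable_continuous[OF M]) (intro continuous_intros finite_lattice_box that)
    have "(\<integral>\<omega>. ?I \<omega> * f \<omega> \<partial>M) - f \<eta> * ?p = (\<integral>\<omega>. ?I \<omega> * (f \<omega> - f \<eta>) \<partial>M)"
    proof -
      have "f \<eta> * ?p = (\<integral>\<omega>. ?I \<omega> * f \<eta> \<partial>M)"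
        using integral_indicator_cyl[OF M, of "lattice_box n" \<eta>] by (simp add: prob_measuresD(3)[OF M])
      then show ?thesis
        using Bochner_Integration.integral_diff[OF int[OF f] int[of "\<lambda>_. f \<eta>"]] by (simp add: algebra_simps prob_measuresD(3)[OF M])
    qed
    also have "\<bar>\<dots>\<bar> \<le> (\<integral>\<omega>. ?I \<omega> * (e / 2) \<partial>M)"
    proof (rule order_trans[OF integral_abs_bound integral_mono])
      show "integrable M (\<lambda>\<omega>. \<bar>?I \<omega> * (f \<omega> - f \<eta>)\<bar>)" "integrable M (\<lambda>\<omega>. ?I \<omega> * (e / 2))"
        by (intro integrable_abs int continuous_intros f)+
      fix \<omega>
      show "\<bar>?I \<omega> * (f \<omega> - f \<eta>)\<bar> \<le> ?I \<omega> * (e / 2)"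
      proof (cases "\<omega> \<in> cyl (lattice_box n) \<eta>")
        case True
        then have "\<omega> \<in> cyl \<Lambda> \<eta>" using n0 lattice_box_mono[OF n] by (auto simp: cyl_def)
        from \<Lambda>(2)[OF this] True show ?thesis by simp
      qed simp
    qed
    also have "\<dots> = e / 2 * ?p" using integral_indicator_cyl[OF M, of "lattice_box n" \<eta>] by simp
    also have "\<dots> < e * ?p" using pos[of n] \<open>e > 0\<close> by simp
    finally have "\<bar>(\<integral>\<omega>. ?I \<omega> * f \<omega> \<partial>M) - f \<eta> * ?p\<bar> < e * ?p" .
    moreover have "(\<integral>\<omega>. ?I \<omega> * f \<omega> \<partial>M) / ?p - f \<eta> = ((\<integral>\<omega>. ?I \<omega> * f \<omega> \<partial>M) - f \<eta> * ?p) / ?p"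
      using pos[of n] by (simp add: diff_divide_distrib)
    ultimately show ?thesis
      using pos[of n] by (simp add: dist_real_def pos_divide_less_eq)
  qed
  then show "\<forall>\<^sub>F n in sequentially. dist ((\<integral>\<omega>. indicator (cyl (lattice_box n) \<eta>) \<omega> * f \<omega> \<partial>M) / measure M (cyl (lattice_box n) \<eta>)) (f \<eta>) < e"
    unfolding eventually_sequentially by blast
qed

text \<open>Cylinder indicators span the local functions, which approximate h uniformly; each
  integral changes by at most the bound of its weight times the error of approximation.\<close>

lemma integral_eq_by_cylinders:
  fixes a b h :: "('d::finite, 'q::finite) config \<Rightarrow> real"
  assumes M: "M \<in> prob_measures" and a: "continuous_on UNIV a" and b: "continuous_on UNIV b"
    and W: "finite W" and h: "continuous_on UNIV h"
    and eq: "\<And>\<Lambda> \<eta>. finite \<Lambda> \<Longrightarrow> W \<subseteq> \<Lambda> \<Longrightarrow>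
      (\<integral>\<omega>. a \<omega> * indicator (cyl \<Lambda> \<eta>) \<omega> \<partial>M) = (\<integral>\<omega>. b \<omega> * indicator (cyl \<Lambda> \<eta>) (override_on \<omega> \<zeta> W) \<partial>M)"
  shows "(\<integral>\<omega>. a \<omega> * h \<omega> \<partial>M) = (\<integral>\<omega>. b \<omega> * h (override_on \<omega> \<zeta> W) \<partial>M)"
proof -
  interpret prob_space M using prob_measuresD[OF M] by simp
  obtain A B where AB: "\<And>\<omega>. \<bar>a \<omega>\<bar> \<le> A" "\<And>\<omega>. \<bar>b \<omega>\<bar> \<le> B"
    using continuous_bounded[OF a] continuous_bounded[OF b] by blast
  have "\<bar>(\<integral>\<omega>. a \<omega> * h \<omega> \<partial>M) - (\<integral>\<omega>. b \<omega> * h (override_on \<omega> \<zeta> W) \<partial>M)\<bar> \<le> (A + B) * e" if e: "e > 0" for e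
  proof -
    obtain \<Lambda>0 where \<Lambda>0: "finite \<Lambda>0" "\<And>\<Lambda>' \<omega>. \<Lambda>0 \<subseteq> \<Lambda>' \<Longrightarrow> \<bar>h \<omega> - h (restrict \<omega> \<Lambda>')\<bar> < e"
      using local_approximation[OF h e] by blast
    define \<Lambda> where "\<Lambda> = \<Lambda>0 \<union> W"
    have fin: "finite \<Lambda>" using \<Lambda>0 W by (simp add: \<Lambda>_def)
    define g where "g \<omega> = h (restrict \<omega> \<Lambda>)" for \<omega>
    have hg: "\<bar>h \<omega> - g \<omega>\<bar> \<le> e" for \<omega>
      unfolding g_def by (rule less_imp_le[OF \<Lambda>0(2)]) (simp add: \<Lambda>_def)
    have g: "g \<omega> = (\<Sum>\<eta>\<in>patterns \<Lambda>. h \<eta> * indicator (cyl \<Lambda> \<eta>) \<omega>)" for \<omega>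
      unfolding g_def by (rule sum_indicator_cyl[OF fin, symmetric])
    have gc: "continuous_on UNIV g"
      by (rule continuous_on_local[OF fin]) (auto simp: g_def cyl_def restrict_def intro!: arg_cong[of _ _ h])
    have inta: "integrable M (\<lambda>\<omega>. a \<omega> * f \<omega>)" if "continuous_on UNIV f" for f
      by (intro integrable_continuous[OF M] continuous_intros a that)
    have intb: "integrable M (\<lambda>\<omega>. b \<omega> * f (override_on \<omega> \<zeta> W))" if "continuous_on UNIV f" for f
      by (intro integrable_continuous[OF M] continuous_intros b that)
    \<comment> \<open>For the local function g the identity follows by linearity over the patterns
      on \<Lambda>.\<close>
    have 1: "(\<integral>\<omega>. a \<omega> * g \<omega> \<partial>M) = (\<integral>\<omega>. b \<omega> * g (override_on \<omega> \<zeta> W) \<partial>M)"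
    proof -
      have "(\<integral>\<omega>. a \<omega> * g \<omega> \<partial>M) = (\<integral>\<omega>. (\<Sum>\<eta>\<in>patterns \<Lambda>. h \<eta> * (a \<omega> * indicator (cyl \<Lambda> \<eta>) \<omega>)) \<partial>M)"
        by (simp only: g sum_distrib_left mult_ac)
      also have "\<dots> = (\<Sum>\<eta>\<in>patterns \<Lambda>. h \<eta> * (\<integral>\<omega>. a \<omega> * indicator (cyl \<Lambda> \<eta>) \<omega> \<partial>M))"
        by (subst Bochner_Integration.integral_sum)
          (intro integrable_mult_right inta continuous_on_indicator_cyl fin, simp)
      also have "\<dots> = (\<Sum>\<eta>\<in>patterns \<Lambda>. h \<eta> * (\<integral>\<omega>. b \<omega> * indicator (cyl \<Lambda> \<eta>) (override_on \<omega> \<zeta> W) \<partial>M))"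
        using eq[OF fin] by (simp add: \<Lambda>_def)
      also have "\<dots> = (\<integral>\<omega>. (\<Sum>\<eta>\<in>patterns \<Lambda>. h \<eta> * (b \<omega> * indicator (cyl \<Lambda> \<eta>) (override_on \<omega> \<zeta> W))) \<partial>M)"
        by (subst Bochner_Integration.integral_sum)
          (intro integrable_mult_right intb continuous_on_indicator_cyl fin, simp)
      also have "\<dots> = (\<integral>\<omega>. b \<omega> * g (override_on \<omega> \<zeta> W) \<partial>M)"
        by (simp only: g sum_distrib_left mult_ac)
      finally show ?thesis .
    qed
    have "\<bar>(\<integral>\<omega>. a \<omega> * h \<omega> \<partial>M) - (\<integral>\<omega>. a \<omega> * g \<omega> \<partial>M)\<bar> = \<bar>\<integral>\<omega>. a \<omega> * (h \<omega> - g \<omega>) \<partial>M\<bar>"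
      using Bochner_Integration.integral_diff[OF inta[OF h] inta[OF gc]] by (simp add: algebra_simps)
    also have "\<dots> \<le> (\<integral>\<omega>. A * e \<partial>M)"
    proof (rule order_trans[OF integral_abs_bound integral_mono])
      show "integrable M (\<lambda>\<omega>. \<bar>a \<omega> * (h \<omega> - g \<omega>)\<bar>)" by (intro integrable_abs inta continuous_intros h gc)
      show "\<bar>a \<omega> * (h \<omega> - g \<omega>)\<bar> \<le> A * e" for \<omega>
        unfolding abs_mult using AB(1)[of \<omega>] hg[of \<omega>] by (intro mult_mono) auto
    qed simp
    finally have 2: "\<bar>(\<integral>\<omega>. a \<omega> * h \<omega> \<partial>M) - (\<integral>\<omega>. a \<omega> * g \<omega> \<partial>M)\<bar> \<le> A * e" by (simp add: prob_space)
    have "\<bar>(\<integral>\<omega>. b \<omega> * h (override_on \<omega> \<zeta> W) \<partial>M) - (\<integral>\<omega>. b \<omega> * g (override_on \<omega> \<zeta> W) \<partial>M)\<bar>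
        = \<bar>\<integral>\<omega>. b \<omega> * (h (override_on \<omega> \<zeta> W) - g (override_on \<omega> \<zeta> W)) \<partial>M\<bar>"
      using Bochner_Integration.integral_diff[OF intb[OF h] intb[OF gc]] by (simp add: algebra_simps)
    also have "\<dots> \<le> (\<integral>\<omega>. B * e \<partial>M)"
    proof (rule order_trans[OF integral_abs_bound integral_mono])
      show "integrable M (\<lambda>\<omega>. \<bar>b \<omega> * (h (override_on \<omega> \<zeta> W) - g (override_on \<omega> \<zeta> W))\<bar>)"
        using intb[of "\<lambda>\<omega>. h \<omega> - g \<omega>"] h gc by (auto intro!: integrable_abs continuous_intros)
      show "\<bar>b \<omega> * (h (override_on \<omega> \<zeta> W) - g (override_on \<omega> \<zeta> W))\<bar> \<le> B * e" for \<omega>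
        unfolding abs_mult using AB(2)[of \<omega>] hg by (intro mult_mono) auto
    qed simp
    finally have 3: "\<bar>(\<integral>\<omega>. b \<omega> * h (override_on \<omega> \<zeta> W) \<partial>M) - (\<integral>\<omega>. b \<omega> * g (override_on \<omega> \<zeta> W) \<partial>M)\<bar> \<le> B * e"
      by (simp add: prob_space)
    show ?thesis using 1 2 3 by (simp add: algebra_simps)
  qed
  note * = this
  have AB0: "0 \<le> A + B" using AB(1)[of undefined] AB(2)[of undefined] by linarith
  have "\<bar>(\<integral>\<omega>. a \<omega> * h \<omega> \<partial>M) - (\<integral>\<omega>. b \<omega> * h (override_on \<omega> \<zeta> W) \<partial>M)\<bar> \<le> 0"
  proof (rule field_le_epsilon)
    fix e :: real assume "e > 0"
    \<comment> \<open>The summand 1 covers the case that both bounds are 0.\<close>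
    then have "e / (A + B + 1) > 0" using AB0 by simp
    from *[OF this] have "\<bar>(\<integral>\<omega>. a \<omega> * h \<omega> \<partial>M) - (\<integral>\<omega>. b \<omega> * h (override_on \<omega> \<zeta> W) \<partial>M)\<bar> \<le> (A + B) * (e / (A + B + 1))" .
    also have "\<dots> \<le> e" using AB0 \<open>e > 0\<close> by (simp add: field_simps)
    finally show "\<bar>(\<integral>\<omega>. a \<omega> * h \<omega> \<partial>M) - (\<integral>\<omega>. b \<omega> * h (override_on \<omega> \<zeta> W) \<partial>M)\<bar> \<le> 0 + e" by simp
  qed
  then show ?thesis by simp
qed

section \<open>Currents and balance\<close>

context translation_invariant_rates_system
begin

definition current :: "'d site set \<Rightarrow> ('d, 'q) config \<Rightarrow> ('d, 'q) config \<Rightarrow> ('d, 'q) config \<Rightarrow> real" where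
  "current \<Lambda> \<eta> \<eta>' \<omega> =
    indicator (cyl \<Lambda> \<eta>) \<omega> * inflow \<Lambda> \<eta>' \<omega> - indicator (cyl \<Lambda> \<eta>') \<omega> * inflow \<Lambda> \<eta> \<omega>"

definition balanced :: "('d, 'q) config measure \<Rightarrow> bool" where
  "balanced M \<longleftrightarrow> (\<forall>\<Lambda>\<in>volumes. \<forall>\<eta> \<eta>'. (\<integral>\<omega>. current \<Lambda> \<eta> \<eta>' \<omega> \<partial>M) = 0)"

lemma current_cont [continuous_intros]: "finite \<Lambda> \<Longrightarrow> continuous_on UNIV (current \<Lambda> \<eta> \<eta>')"
  unfolding current_def by (intro continuous_intros)

lemma balancedD:
  assumes "balanced M" "M \<in> prob_measures" "\<Lambda> \<in> volumes"
  shows "(\<integral>\<omega>. indicator (cyl \<Lambda> \<eta>) \<omega> * inflow \<Lambda> \<eta>' \<omega> \<partial>M) = (\<integral>\<omega>. indicator (cyl \<Lambda> \<eta>') \<omega> * inflow \<Lambda> \<eta> \<omega> \<partial>M)"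
proof -
  have int: "integrable M (\<lambda>\<omega>. indicator (cyl \<Lambda> \<eta>) \<omega> * inflow \<Lambda> \<eta>' \<omega>)" for \<eta> \<eta>'
    using assms(3) by (intro integrable_continuous[OF assms(2)] continuous_intros) (auto simp: volumes_iff)
  show ?thesis
    using assms Bochner_Integration.integral_diff[OF int[of \<eta> \<eta>'] int[of \<eta>' \<eta>]]
    by (simp add: balanced_def current_def)
qed

definition reach :: "'d site set \<Rightarrow> 'd site set" where
  "reach S = S \<union> \<Union>(fst ` transitions S)"

lemma finite_reach: "finite S \<Longrightarrow> finite (reach S)"
  by (auto simp: reach_def transitionsD)

text \<open>A move that leads from \<eta> to \<eta>' touches S and so changes no site outside
  \<open>reach S\<close>; off S the two configurations agree, hence nothing has to be checked
  outside W. The inflow thus stays one fixed continuous function while the box grows.\<close>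

lemma inflow_enlarge:
  assumes "finite \<Lambda>" "W \<subseteq> \<Lambda>" "reach S \<subseteq> W" "\<eta>' \<in> cyl (- S) \<eta>" "\<exists>x\<in>S. \<eta> x \<noteq> \<eta>' x" "\<omega> \<in> cyl \<Lambda> \<eta>"
  shows "inflow \<Lambda> \<eta>' \<omega> = inflow W \<eta>' \<omega>"
proof -
  have S: "S \<subseteq> W" "\<And>\<tau>. \<tau> \<in> transitions S \<Longrightarrow> fst \<tau> \<subseteq> W" using assms(3) by (auto simp: reach_def)
  have finW: "finite W" using assms(1,2) finite_subset by blast
  have "(\<Sum>\<tau>\<in>transitions S. rate \<tau> \<omega> * indicator (cyl \<Lambda> \<eta>') (move \<tau> \<omega>))
      = (\<Sum>\<tau>\<in>transitions S. rate \<tau> \<omega> * indicator (cyl W \<eta>') (move \<tau> \<omega>))"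
  proof (intro sum.cong refl)
    fix \<tau> assume "\<tau> \<in> transitions S"
    then have "fst \<tau> \<subseteq> W" by (rule S)
    then have "move \<tau> \<omega> \<in> cyl \<Lambda> \<eta>' \<longleftrightarrow> move \<tau> \<omega> \<in> cyl W \<eta>'"
      using assms(2,4,6) S(1) unfolding cyl_def move_def override_on_def
      by (auto) (metis (mono_tags, lifting) ComplI subsetD)+
    then show "rate \<tau> \<omega> * indicator (cyl \<Lambda> \<eta>') (move \<tau> \<omega>) = rate \<tau> \<omega> * indicator (cyl W \<eta>') (move \<tau> \<omega>)"
      by (simp add: indicator_def)
  qed
  moreover have "inflow \<Lambda> \<eta>' \<omega> = (\<Sum>\<tau>\<in>transitions S. rate \<tau> \<omega> * indicator (cyl \<Lambda> \<eta>') (move \<tau> \<omega>))"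
    by (rule inflow_restrict_sites[where \<eta> = \<eta>]) (use assms S in auto)
  moreover have "inflow W \<eta>' \<omega> = (\<Sum>\<tau>\<in>transitions S. rate \<tau> \<omega> * indicator (cyl W \<eta>') (move \<tau> \<omega>))"
    by (rule inflow_restrict_sites[where \<eta> = \<eta>]) (use assms S finW in \<open>auto simp: cyl_def\<close>)
  ultimately show ?thesis by simp
qed

end

section \<open>Detailed balance and transport of patterns\<close>

locale reversible_gibbs_system = gibbsian_kernels \<gamma> + translation_invariant_rates_system c
  for \<gamma> :: "('d::finite, 'q::finite) kernels" and c :: "('d, 'q) rates" +
  fixes \<mu> :: "('d, 'q) config measure"
  assumes gibbs: "\<mu> \<in> gibbs_measures \<gamma>"
    and balanced_gibbs: "balanced \<mu>"
begin

lemma gibbs_prob: "\<mu> \<in> prob_measures"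
  by (rule gibbsD(1)[OF gibbs])

text \<open>Balance in a growing box is divided by the probability of the cylinder of \<eta>. One
  side is an average of \<open>inflow W \<eta>'\<close> near \<eta>, the other the cylinder ratio of
  \<open>gibbs_cyl_ratio_limit\<close> times an average near \<eta>'. As \<mu> charges all
  cylinders, the identity holds at every configuration.\<close>

lemma detailed_balance:
  assumes S: "finite S" and W: "W \<in> volumes" "reach S \<subseteq> W"
    and \<eta>': "\<eta>' \<in> cyl (- S) \<eta>" "\<exists>x\<in>S. \<eta> x \<noteq> \<eta>' x"
  shows "inflow W \<eta>' \<eta> * cyl_prob W \<eta> \<eta> = inflow W \<eta> \<eta>' * cyl_prob W \<eta>' \<eta>"
proof -
  let ?\<mu> = "\<lambda>n \<zeta>. measure \<mu> (cyl (lattice_box n) \<zeta>)"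
  let ?A = "\<lambda>n \<zeta> \<zeta>'. (\<integral>\<omega>. indicator (cyl (lattice_box n) \<zeta>) \<omega> * inflow W \<zeta>' \<omega> \<partial>\<mu>)"
  have finW: "finite W" using W by (simp add: volumes_iff)
  have pos: "?\<mu> n \<zeta> > 0" for n \<zeta> by (rule gibbs_cyl_pos[OF gibbs lattice_box_in_volumes])
  have neq: "\<exists>x\<in>S. \<eta>' x \<noteq> \<eta> x" using \<eta>'(2) by metis
  have \<eta>W: "\<eta>' \<in> cyl (- W) \<eta>" using \<eta>'(1) W(2) by (auto simp: cyl_def reach_def)
  have lim: "(\<lambda>n. ?A n \<zeta> \<zeta>' / ?\<mu> n \<zeta>) \<longlonglongrightarrow> inflow W \<zeta>' \<zeta>" for \<zeta> \<zeta>'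
    by (rule integral_cyl_average_limit[OF gibbs_prob inflow_cont[OF finW] pos])
  have "(\<lambda>n. (?\<mu> n \<eta>' / ?\<mu> n \<eta>) * (?A n \<eta>' \<eta> / ?\<mu> n \<eta>')) \<longlonglongrightarrow> (cyl_prob W \<eta>' \<eta> / cyl_prob W \<eta> \<eta>) * inflow W \<eta> \<eta>'"
    by (intro tendsto_mult gibbs_cyl_ratio_limit[OF gibbs W(1) \<eta>W] lim)
  moreover have "\<forall>\<^sub>F n in sequentially. (?\<mu> n \<eta>' / ?\<mu> n \<eta>) * (?A n \<eta>' \<eta> / ?\<mu> n \<eta>') = ?A n \<eta> \<eta>' / ?\<mu> n \<eta>"
  proof -
    obtain n0 where n0: "W \<subseteq> lattice_box n0" using finite_subset_lattice_box[OF finW] by blast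
    have "?A n \<eta>' \<eta> = ?A n \<eta> \<eta>'" if "n \<ge> n0" for n
    proof -
      have sub: "W \<subseteq> lattice_box n" using n0 lattice_box_mono[OF that] by blast
      have "?A n \<eta> \<eta>' = (\<integral>\<omega>. indicator (cyl (lattice_box n) \<eta>) \<omega> * inflow (lattice_box n) \<eta>' \<omega> \<partial>\<mu>)"
        using inflow_enlarge[OF finite_lattice_box sub W(2) \<eta>'] by (intro Bochner_Integration.integral_cong) (auto simp: indicator_def)
      also have "\<dots> = (\<integral>\<omega>. indicator (cyl (lattice_box n) \<eta>') \<omega> * inflow (lattice_box n) \<eta> \<omega> \<partial>\<mu>)"
        by (rule balancedD[OF balanced_gibbs gibbs_prob]) simp
      also have "\<dots> = ?A n \<eta>' \<eta>"
        using inflow_enlarge[OF finite_lattice_box sub W(2) cyl_sym[OF \<eta>'(1)] neq]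
        by (intro Bochner_Integration.integral_cong) (auto simp: indicator_def)
      finally show ?thesis by simp
    qed
    then show ?thesis
      unfolding eventually_sequentially using pos by (intro exI[of _ n0]) (auto simp: less_imp_neq[symmetric])
  qed
  ultimately have "(\<lambda>n. ?A n \<eta> \<eta>' / ?\<mu> n \<eta>) \<longlonglongrightarrow> (cyl_prob W \<eta>' \<eta> / cyl_prob W \<eta> \<eta>) * inflow W \<eta> \<eta>'"
    by (rule Lim_transform_eventually)
  from LIMSEQ_unique[OF this lim[of \<eta> \<eta>']] show ?thesis
    using cyl_prob_pos[OF W(1), of \<eta> \<eta>] by (simp add: field_simps)
qed

text \<open>The image of M on \<open>cyl W \<zeta>'\<close> under writing \<zeta> on W has density
  \<open>cyl_prob W \<zeta>' / cyl_prob W \<zeta>\<close> with respect to M on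
  \<open>cyl W \<zeta>\<close>. In this form conditional probabilities become statements about
  replacing patterns, which can be composed along paths of moves.\<close>

definition transports :: "('d, 'q) config measure \<Rightarrow> 'd site set \<Rightarrow> ('d, 'q) config \<Rightarrow> ('d, 'q) config \<Rightarrow> bool" where
  "transports M W \<zeta> \<zeta>' \<longleftrightarrow> (\<forall>h. continuous_on UNIV h \<longrightarrow>
    (\<integral>\<omega>. indicator (cyl W \<zeta>') \<omega> * h (override_on \<omega> \<zeta> W) \<partial>M)
    = (\<integral>\<omega>. indicator (cyl W \<zeta>) \<omega> * (h \<omega> * cyl_prob W \<zeta>' \<omega> / cyl_prob W \<zeta> \<omega>) \<partial>M))"

lemma cyl_prob_override: "W \<in> volumes \<Longrightarrow> cyl_prob W \<eta> (override_on \<omega> \<zeta> W) = cyl_prob W \<eta> \<omega>"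
  by (rule cyl_prob_local) (auto simp: cyl_def)

lemma override_on_cyl [simp]: "\<omega> \<in> cyl W \<zeta> \<Longrightarrow> override_on \<omega> \<zeta> W = \<omega>"
  by (auto simp: cyl_def override_on_def)

lemma override_on_override_on [simp]: "override_on (override_on \<omega> \<zeta> W) \<zeta>' W = override_on \<omega> \<zeta>' W"
  by (auto simp: override_on_def)

lemma transports_refl:
  assumes "W \<in> volumes" shows "transports M W \<zeta> \<zeta>"
  unfolding transports_def
  by (auto intro!: Bochner_Integration.integral_cong simp: indicator_def)
    (use cyl_prob_pos[OF assms] in \<open>simp add: less_imp_neq[symmetric]\<close>)

text \<open>Densities multiply under composition, and the kernel of the intermediate pattern
  cancels.\<close>

lemma transports_trans:
  assumes "W \<in> volumes" "transports M W \<zeta> \<zeta>'" "transports M W \<zeta>' \<zeta>''"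
  shows "transports M W \<zeta> \<zeta>''"
  unfolding transports_def
proof (intro allI impI)
  fix h :: "('d, 'q) config \<Rightarrow> real" assume h: "continuous_on UNIV h"
  have nz: "cyl_prob W \<eta> \<omega> \<noteq> 0" for \<eta> \<omega> using cyl_prob_pos[OF assms(1), of \<eta> \<omega>] by simp
  let ?h1 = "\<lambda>\<omega>. h (override_on \<omega> \<zeta> W)"
  let ?h2 = "\<lambda>\<omega>. h \<omega> * cyl_prob W \<zeta>'' \<omega> / cyl_prob W \<zeta>' \<omega>"
  have "continuous_on UNIV ?h1" by (intro continuous_intros h)
  then have "(\<integral>\<omega>. indicator (cyl W \<zeta>'') \<omega> * h (override_on \<omega> \<zeta> W) \<partial>M)
      = (\<integral>\<omega>. indicator (cyl W \<zeta>') \<omega> * ?h2 (override_on \<omega> \<zeta> W) \<partial>M)"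
    using assms(3)[unfolded transports_def, rule_format, of ?h1]
    by (simp only: override_on_override_on cyl_prob_override[OF assms(1)])
  also have "continuous_on UNIV ?h2"
    using nz by (intro continuous_on_divide continuous_on_mult continuous_cyl_prob h assms(1)) auto
  then have "(\<integral>\<omega>. indicator (cyl W \<zeta>') \<omega> * ?h2 (override_on \<omega> \<zeta> W) \<partial>M)
      = (\<integral>\<omega>. indicator (cyl W \<zeta>) \<omega> * (?h2 \<omega> * cyl_prob W \<zeta>' \<omega> / cyl_prob W \<zeta> \<omega>) \<partial>M)"
    using assms(2) unfolding transports_def by blast
  also have "\<dots> = (\<integral>\<omega>. indicator (cyl W \<zeta>) \<omega> * (h \<omega> * cyl_prob W \<zeta>'' \<omega> / cyl_prob W \<zeta> \<omega>) \<partial>M)"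
    using nz by simp
  finally show "(\<integral>\<omega>. indicator (cyl W \<zeta>'') \<omega> * h (override_on \<omega> \<zeta> W) \<partial>M)
      = (\<integral>\<omega>. indicator (cyl W \<zeta>) \<omega> * (h \<omega> * cyl_prob W \<zeta>'' \<omega> / cyl_prob W \<zeta> \<omega>) \<partial>M)" .
qed

text \<open>Balance of M equates the mass leaving \<open>cyl W \<zeta>\<close> for \<zeta>' with the
  mass coming back, also on all finer cylinders. By detailed balance of \<mu> the quotient of the
  two inflows is the quotient of the kernels, so it is the same for all balanced M.\<close>

lemma transports_step:
  assumes M: "M \<in> prob_measures" "balanced M"
    and S: "finite S" and W: "W \<in> volumes" "reach S \<subseteq> W"
    and \<zeta>': "\<zeta>' \<in> cyl (- S) \<zeta>" "\<exists>x\<in>S. \<zeta> x \<noteq> \<zeta>' x"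
    and pos: "\<And>\<omega>. \<omega> \<in> cyl W \<zeta> \<Longrightarrow> inflow W \<zeta>' \<omega> > 0"
  shows "transports M W \<zeta> \<zeta>'"
  unfolding transports_def
proof (intro allI impI)
  fix h0 :: "('d, 'q) config \<Rightarrow> real" assume h0: "continuous_on UNIV h0"
  have finW: "finite W" using W by (simp add: volumes_iff)
  have SW: "S \<subseteq> W" using W(2) by (auto simp: reach_def)
  have nz: "cyl_prob W \<eta> \<omega> > 0" for \<eta> \<omega> using cyl_prob_pos[OF W(1), of \<eta> \<omega>] by simp
  define q where "q \<omega> = inflow W \<zeta> (override_on \<omega> \<zeta>' W)" for \<omega>
  have db: "inflow W \<zeta>' \<omega> * cyl_prob W \<zeta> \<omega> = q \<omega> * cyl_prob W \<zeta>' \<omega>" if \<omega>: "\<omega> \<in> cyl W \<zeta>" for \<omega>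
  proof -
    let ?\<omega>' = "override_on \<omega> \<zeta>' W"
    have "?\<omega>' \<in> cyl (- S) \<omega>" "\<exists>x\<in>S. \<omega> x \<noteq> ?\<omega>' x"
      using \<omega> \<zeta>' SW by (auto simp: cyl_def override_on_def)
    from detailed_balance[OF S W this]
    have "inflow W ?\<omega>' \<omega> * cyl_prob W \<omega> \<omega> = inflow W \<omega> ?\<omega>' * cyl_prob W ?\<omega>' \<omega>" .
    moreover have "inflow W ?\<omega>' = inflow W \<zeta>'" "cyl_prob W ?\<omega>' \<omega> = cyl_prob W \<zeta>' \<omega>"
      by (auto intro!: inflow_cong cyl_prob_pattern simp: cyl_def)
    moreover have "inflow W \<omega> = inflow W \<zeta>" "cyl_prob W \<omega> \<omega> = cyl_prob W \<zeta> \<omega>"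
      using \<omega> by (auto intro!: inflow_cong cyl_prob_pattern)
    ultimately show ?thesis by (simp add: q_def)
  qed
  \<comment> \<open>The backward move is possible because the forward one is:
    \<open>detailed_balance\<close> with positive kernels excludes a one-way passage.\<close>
  have q_pos: "q \<omega> > 0" for \<omega>
  proof -
    have \<omega>: "override_on \<omega> \<zeta> W \<in> cyl W \<zeta>" by (auto simp: cyl_def)
    have "q (override_on \<omega> \<zeta> W) * cyl_prob W \<zeta>' (override_on \<omega> \<zeta> W) > 0"
      using db[OF \<omega>] pos[OF \<omega>] nz by (metis mult_pos_pos)
    then have "q (override_on \<omega> \<zeta> W) > 0" using nz by (simp add: zero_less_mult_iff) (meson less_asym)
    then show ?thesis by (simp add: q_def)
  qed
  have q_cont: "continuous_on UNIV q"
    unfolding q_def by (intro continuous_intros finW)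
  \<comment> \<open>Division by the backward inflow removes the rates from the side of
    \<zeta>'.\<close>
  define h where "h \<omega> = h0 \<omega> / q \<omega>" for \<omega>
  have h: "continuous_on UNIV h"
    unfolding h_def using q_pos by (intro continuous_on_divide h0 q_cont) (auto simp: less_imp_neq[symmetric])
  define a where "a \<omega> = indicator (cyl W \<zeta>) \<omega> * inflow W \<zeta>' \<omega>" for \<omega>
  define b where "b \<omega> = indicator (cyl W \<zeta>') \<omega> * inflow W \<zeta> \<omega>" for \<omega>
  have ab: "continuous_on UNIV a" "continuous_on UNIV b"
    unfolding a_def b_def by (intro continuous_intros finW)+
  have "(\<integral>\<omega>. a \<omega> * h \<omega> \<partial>M) = (\<integral>\<omega>. b \<omega> * h (override_on \<omega> \<zeta> W) \<partial>M)"
  proof (rule integral_eq_by_cylinders[OF M(1) ab finW h])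
    fix \<Lambda> :: "'d site set" and \<eta> :: "('d, 'q) config" assume \<Lambda>: "finite \<Lambda>" "W \<subseteq> \<Lambda>"
    have vol: "\<Lambda> \<in> volumes" using \<Lambda> W(1) by (auto simp: volumes_iff)
    show "(\<integral>\<omega>. a \<omega> * indicator (cyl \<Lambda> \<eta>) \<omega> \<partial>M) = (\<integral>\<omega>. b \<omega> * indicator (cyl \<Lambda> \<eta>) (override_on \<omega> \<zeta> W) \<partial>M)"
    proof (cases "\<eta> \<in> cyl W \<zeta>")
      case True
      define \<eta>' where "\<eta>' = override_on \<eta> \<zeta>' W"
      obtain x where "x \<in> S" "\<zeta> x \<noteq> \<zeta>' x" using \<zeta>'(2) by blast
      moreover from this have "\<eta> x = \<zeta> x" "\<eta>' x = \<zeta>' x" using True SW by (auto simp: cyl_def \<eta>'_def)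
      ultimately have "\<exists>x\<in>S. \<eta> x \<noteq> \<eta>' x" "\<exists>x\<in>S. \<eta>' x \<noteq> \<eta> x" by (auto intro!: bexI[of _ x])
      moreover have "\<eta>' \<in> cyl (- S) \<eta>"
        using True \<zeta>' by (auto simp: cyl_def override_on_def \<eta>'_def)
      ultimately have \<eta>': "\<eta>' \<in> cyl (- S) \<eta>" "\<exists>x\<in>S. \<eta> x \<noteq> \<eta>' x" "\<exists>x\<in>S. \<eta>' x \<noteq> \<eta> x"
        by auto
      have c1: "inflow W \<eta>' = inflow W \<zeta>'" "inflow W \<eta> = inflow W \<zeta>"
        using True by (auto intro!: inflow_cong simp: cyl_def \<eta>'_def)
      have "(\<integral>\<omega>. a \<omega> * indicator (cyl \<Lambda> \<eta>) \<omega> \<partial>M) = (\<integral>\<omega>. indicator (cyl \<Lambda> \<eta>) \<omega> * inflow \<Lambda> \<eta>' \<omega> \<partial>M)"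
      proof (intro Bochner_Integration.integral_cong refl)
        fix \<omega>
        show "a \<omega> * indicator (cyl \<Lambda> \<eta>) \<omega> = indicator (cyl \<Lambda> \<eta>) \<omega> * inflow \<Lambda> \<eta>' \<omega>"
        proof (cases "\<omega> \<in> cyl \<Lambda> \<eta>")
          case \<omega>: True
          then have "\<omega> \<in> cyl W \<zeta>" using True \<Lambda>(2) by (auto simp: cyl_def)
          then show ?thesis using \<omega> inflow_enlarge[OF \<Lambda> W(2) \<eta>'(1,2) \<omega>] c1 by (simp add: a_def)
        qed simp
      qed
      also have "\<dots> = (\<integral>\<omega>. indicator (cyl \<Lambda> \<eta>') \<omega> * inflow \<Lambda> \<eta> \<omega> \<partial>M)"
        by (rule balancedD[OF M(2,1) vol])
      also have "\<dots> = (\<integral>\<omega>. b \<omega> * indicator (cyl \<Lambda> \<eta>) (override_on \<omega> \<zeta> W) \<partial>M)"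
      proof (intro Bochner_Integration.integral_cong refl)
        fix \<omega>
        show "indicator (cyl \<Lambda> \<eta>') \<omega> * inflow \<Lambda> \<eta> \<omega> = b \<omega> * indicator (cyl \<Lambda> \<eta>) (override_on \<omega> \<zeta> W)"
        proof (cases "\<omega> \<in> cyl \<Lambda> \<eta>'")
          case \<omega>: True
          then have "\<omega> \<in> cyl W \<zeta>'" "override_on \<omega> \<zeta> W \<in> cyl \<Lambda> \<eta>"
            using True \<Lambda>(2) by (auto simp: cyl_def \<eta>'_def override_on_def split: if_splits)
          then show ?thesis using \<omega> inflow_enlarge[OF \<Lambda> W(2) cyl_sym[OF \<eta>'(1)] \<eta>'(3) \<omega>] c1 by (simp add: b_def)
        next
          case \<omega>: False
          have "\<omega> \<in> cyl \<Lambda> \<eta>'" if "\<omega> \<in> cyl W \<zeta>'" "override_on \<omega> \<zeta> W \<in> cyl \<Lambda> \<eta>"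
            using that by (auto simp: cyl_def \<eta>'_def override_on_def split: if_splits)
          then show ?thesis using \<omega> by (auto simp: b_def indicator_def)
        qed
      qed
      finally show ?thesis .
    next
      case False
      have z: "a \<omega> * indicator (cyl \<Lambda> \<eta>) \<omega> = 0" "b \<omega> * indicator (cyl \<Lambda> \<eta>) (override_on \<omega> \<zeta> W) = 0" for \<omega>
        using False \<Lambda>(2) by (auto simp: a_def indicator_def cyl_def subset_eq) (metis override_on_apply_in)+
      show ?thesis by (simp only: z)
    qed
  qed
  moreover have "a \<omega> * h \<omega> = indicator (cyl W \<zeta>) \<omega> * (h0 \<omega> * cyl_prob W \<zeta>' \<omega> / cyl_prob W \<zeta> \<omega>)" for \<omega>
  proof (cases "\<omega> \<in> cyl W \<zeta>")
    case True
    have "inflow W \<zeta>' \<omega> / q \<omega> = cyl_prob W \<zeta>' \<omega> / cyl_prob W \<zeta> \<omega>"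
      using db[OF True] q_pos[of \<omega>] nz[of \<zeta> \<omega>] by (simp add: frac_eq_eq mult.commute)
    then show ?thesis using True by (simp add: a_def h_def) (metis mult.commute times_divide_eq_right)
  qed (simp add: a_def)
  moreover have "b \<omega> * h (override_on \<omega> \<zeta> W) = indicator (cyl W \<zeta>') \<omega> * h0 (override_on \<omega> \<zeta> W)" for \<omega>
  proof (cases "\<omega> \<in> cyl W \<zeta>'")
    case True
    then have "q (override_on \<omega> \<zeta> W) = inflow W \<zeta> \<omega>" by (simp add: q_def)
    then show ?thesis using True q_pos[of "override_on \<omega> \<zeta> W"] by (simp add: b_def h_def)
  qed (simp add: b_def)
  ultimately show "(\<integral>\<omega>. indicator (cyl W \<zeta>') \<omega> * h0 (override_on \<omega> \<zeta> W) \<partial>M)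
      = (\<integral>\<omega>. indicator (cyl W \<zeta>) \<omega> * (h0 \<omega> * cyl_prob W \<zeta>' \<omega> / cyl_prob W \<zeta> \<omega>) \<partial>M)" by simp
qed

text \<open>Transport is demanded on a whole neighbourhood \<open>cyl W0 \<eta>\<close> and in all
  larger volumes: the first feeds the compactness argument, the second lets steps with different
  windows be composed in one volume.\<close>

definition robustly_transports :: "('d, 'q) config measure \<Rightarrow> ('d, 'q) config \<Rightarrow> ('d, 'q) config \<Rightarrow> bool" where
  "robustly_transports M \<eta> \<eta>' \<longleftrightarrow> (\<exists>\<Delta> \<xi> W0. finite W0 \<and> \<Delta> \<subseteq> W0 \<and> \<eta>' = override_on \<eta> \<xi> \<Delta> \<and>
    (\<forall>W\<in>volumes. W0 \<subseteq> W \<longrightarrow> (\<forall>\<zeta>\<in>cyl W0 \<eta>. transports M W \<zeta> (override_on \<zeta> \<xi> \<Delta>))))"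

lemma robustly_transportsE:
  assumes "robustly_transports M \<eta> \<eta>'"
  obtains \<Delta> \<xi> W0 where "finite W0" "\<Delta> \<subseteq> W0" "\<eta>' = override_on \<eta> \<xi> \<Delta>"
    "\<And>W \<zeta>. W \<in> volumes \<Longrightarrow> W0 \<subseteq> W \<Longrightarrow> \<zeta> \<in> cyl W0 \<eta> \<Longrightarrow> transports M W \<zeta> (override_on \<zeta> \<xi> \<Delta>)"
  using assms unfolding robustly_transports_def by blast

lemma robustly_transports_refl: "robustly_transports M \<eta> \<eta>"
  unfolding robustly_transports_def
  by (rule exI[of _ "{}"], rule exI[of _ \<eta>], rule exI[of _ "{}"]) (auto intro: transports_refl)

lemma robustly_transports_trans:
  assumes "robustly_transports M \<eta> \<eta>'" "robustly_transports M \<eta>' \<eta>''"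
  shows "robustly_transports M \<eta> \<eta>''"
proof -
  obtain \<Delta> \<xi> W0 where 1: "finite W0" "\<Delta> \<subseteq> W0" "\<eta>' = override_on \<eta> \<xi> \<Delta>"
    "\<And>W \<zeta>. W \<in> volumes \<Longrightarrow> W0 \<subseteq> W \<Longrightarrow> \<zeta> \<in> cyl W0 \<eta> \<Longrightarrow> transports M W \<zeta> (override_on \<zeta> \<xi> \<Delta>)"
    by (rule robustly_transportsE[OF assms(1)]) (rule that)
  obtain \<Delta>' \<xi>' W0' where 2: "finite W0'" "\<Delta>' \<subseteq> W0'" "\<eta>'' = override_on \<eta>' \<xi>' \<Delta>'"
    "\<And>W \<zeta>. W \<in> volumes \<Longrightarrow> W0' \<subseteq> W \<Longrightarrow> \<zeta> \<in> cyl W0' \<eta>' \<Longrightarrow> transports M W \<zeta> (override_on \<zeta> \<xi>' \<Delta>')"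
    by (rule robustly_transportsE[OF assms(2)]) (rule that)
  have comp: "override_on (override_on \<zeta> \<xi> \<Delta>) \<xi>' \<Delta>' = override_on \<zeta> (override_on \<xi> \<xi>' \<Delta>') (\<Delta> \<union> \<Delta>')" for \<zeta> :: "('d, 'q) config"
    by (auto simp: override_on_def)
  have "transports M W \<zeta> (override_on \<zeta> (override_on \<xi> \<xi>' \<Delta>') (\<Delta> \<union> \<Delta>'))"
    if W: "W \<in> volumes" "W0 \<union> W0' \<subseteq> W" and \<zeta>: "\<zeta> \<in> cyl (W0 \<union> W0') \<eta>" for W \<zeta>
  proof -
    have "transports M W \<zeta> (override_on \<zeta> \<xi> \<Delta>)" using W \<zeta> by (intro 1(4)) (auto simp: cyl_def)
    moreover have "transports M W (override_on \<zeta> \<xi> \<Delta>) (override_on (override_on \<zeta> \<xi> \<Delta>) \<xi>' \<Delta>')"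
      using W \<zeta> by (intro 2(4)) (auto simp: cyl_def 1(3) override_on_def)
    ultimately show ?thesis using transports_trans[OF W(1)] comp by metis
  qed
  then show ?thesis
    unfolding robustly_transports_def
    using 1(1-3) 2(1-3) comp[of \<eta>]
    by (intro exI[of _ "\<Delta> \<union> \<Delta>'"] exI[of _ "override_on \<xi> \<xi>' \<Delta>'"] exI[of _ "W0 \<union> W0'"]) auto
qed

text \<open>By continuity a positive rate stays positive on a cylinder around \<eta>; with
  \<open>reach \<Delta>\<close> added to the window, \<open>transports_step\<close> applies
  throughout it.\<close>

lemma robustly_transports_jump:
  assumes M: "M \<in> prob_measures" "balanced M" and jump: "can_jump c \<eta> \<eta>'"
  shows "robustly_transports M \<eta> \<eta>'"
proof (cases "\<eta>' = \<eta>")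
  case True
  then show ?thesis by (simp add: robustly_transports_refl)
next
  case False
  obtain \<Delta> \<xi> where \<Delta>: "\<Delta> \<in> volumes" "\<xi> \<in> patterns \<Delta>" "c \<Delta> \<eta> \<xi> > 0" "\<eta>' = override_on \<eta> \<xi> \<Delta>"
    using jump by (auto simp: can_jump_def)
  then obtain x where x: "x \<in> \<Delta>" "\<xi> x \<noteq> \<eta> x"
    using False by (metis override_on_def ext)
  then have "\<xi> \<noteq> restrict \<eta> \<Delta>" by auto
  then have act: "active \<Delta>" unfolding active_def using \<Delta> by blast
  have "open ((\<lambda>\<omega>. c \<Delta> \<omega> \<xi>) -` {0<..})" by (intro open_vimage c_cont \<Delta>) auto
  from open_contains_cyl[OF this, of \<eta>] obtain \<Lambda>1 where \<Lambda>1: "finite \<Lambda>1" "\<And>\<omega>. \<omega> \<in> cyl \<Lambda>1 \<eta> \<Longrightarrow> c \<Delta> \<omega> \<xi> > 0"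
    using \<Delta>(3) by auto
  have fin: "finite \<Delta>" "\<Delta> \<noteq> {}" using \<Delta>(1) by (auto simp: volumes_iff)
  define W0 where "W0 = \<Lambda>1 \<union> reach \<Delta>"
  have W0: "finite W0" "\<Delta> \<subseteq> W0" using \<Lambda>1 finite_reach[OF fin(1)] by (auto simp: W0_def reach_def)
  have "transports M W \<zeta> (override_on \<zeta> \<xi> \<Delta>)" if W: "W \<in> volumes" "W0 \<subseteq> W" and \<zeta>: "\<zeta> \<in> cyl W0 \<eta>" for W \<zeta>
  proof (rule transports_step[OF M fin(1) W(1)])
    show "reach \<Delta> \<subseteq> W" using W by (auto simp: W0_def)
    show "override_on \<zeta> \<xi> \<Delta> \<in> cyl (- \<Delta>) \<zeta>" by (auto simp: cyl_def)
    show "\<exists>x\<in>\<Delta>. \<zeta> x \<noteq> override_on \<zeta> \<xi> \<Delta> x"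
      using x \<zeta> W0(2) by (intro bexI[of _ x]) (auto simp: cyl_def)
    fix \<omega> assume \<omega>: "\<omega> \<in> cyl W \<zeta>"
    let ?\<tau> = "(\<Delta>, \<xi>)"
    have "?\<tau> \<in> transitions W" using act \<Delta>(2) W(2) W0(2) fin by (auto simp: transitions_def)
    moreover have "rate ?\<tau> \<omega> > 0"
      using cyl_mono[OF W(2), of \<zeta>] cyl_cong[OF \<zeta>] cyl_mono[of \<Lambda>1 W0 \<eta>] \<omega>
      by (auto simp: rate_def W0_def intro!: \<Lambda>1(2))
    moreover have "move ?\<tau> \<omega> \<in> cyl W (override_on \<zeta> \<xi> \<Delta>)"
      using \<omega> by (auto simp: cyl_def move_def override_on_def)
    ultimately have "0 < rate ?\<tau> \<omega> * indicator (cyl W (override_on \<zeta> \<xi> \<Delta>)) (move ?\<tau> \<omega>)" by simp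
    also have "\<dots> \<le> inflow W (override_on \<zeta> \<xi> \<Delta>) \<omega>"
      unfolding inflow_def using \<open>?\<tau> \<in> transitions W\<close> W(1) by (intro member_le_sum) (auto simp: volumes_iff rate_nonneg)
    finally show "0 < inflow W (override_on \<zeta> \<xi> \<Delta>) \<omega>" .
  qed
  then show ?thesis
    unfolding robustly_transports_def using W0 \<Delta>(4)
    by (intro exI[of _ \<Delta>] exI[of _ \<xi>] exI[of _ W0]) auto
qed

text \<open>Irreducibility gives a path for each \<eta> and \<sigma>, with a window depending on
  both. Compactness and the finiteness of the set of patterns reduce these windows to a single
  volume.\<close>

lemma ex_transport_volume:
  assumes M: "M \<in> prob_measures" "balanced M" and irr: "irreducible_ips c" and \<Lambda>: "\<Lambda> \<in> volumes"
  shows "\<exists>W\<in>volumes. \<Lambda> \<subseteq> W \<and> (\<forall>\<sigma>\<in>patterns \<Lambda>. \<forall>\<zeta>. transports M W \<zeta> (override_on \<zeta> \<sigma> \<Lambda>))"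
proof -
  have fin\<Lambda>: "finite \<Lambda>" using \<Lambda> by (simp add: volumes_iff)
  have "\<exists>W0. finite W0 \<and> (\<forall>W\<in>volumes. W0 \<subseteq> W \<longrightarrow> (\<forall>\<zeta>\<in>cyl W0 \<eta>. transports M W \<zeta> (override_on \<zeta> \<sigma> \<Lambda>)))"
    if \<sigma>: "\<sigma> \<in> patterns \<Lambda>" for \<eta> \<sigma>
  proof -
    have "(can_jump c)\<^sup>*\<^sup>* \<eta> (override_on \<eta> \<sigma> \<Lambda>)" using irr \<Lambda> \<sigma> by (simp add: irreducible_ips_def)
    then have "robustly_transports M \<eta> (override_on \<eta> \<sigma> \<Lambda>)"
    proof (induction rule: rtranclp_induct)
      case base
      show ?case by (rule robustly_transports_refl)
    next
      case (step \<eta>' \<eta>'')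
      from robustly_transports_trans[OF step.IH robustly_transports_jump[OF M step.hyps(2)]] show ?case .
    qed
    then obtain \<Delta> \<xi> W0 where 1: "finite W0" "\<Delta> \<subseteq> W0" "override_on \<eta> \<sigma> \<Lambda> = override_on \<eta> \<xi> \<Delta>"
      "\<And>W \<zeta>. W \<in> volumes \<Longrightarrow> W0 \<subseteq> W \<Longrightarrow> \<zeta> \<in> cyl W0 \<eta> \<Longrightarrow> transports M W \<zeta> (override_on \<zeta> \<xi> \<Delta>)"
      by (rule robustly_transportsE) (rule that)
    \<comment> \<open>The composed moves of the path and the replacement by \<sigma> agree at
      \<eta>, hence at every configuration that equals \<eta> on the sites involved.\<close>
    have "override_on \<zeta> \<sigma> \<Lambda> = override_on \<zeta> \<xi> \<Delta>" if \<zeta>: "\<zeta> \<in> cyl (W0 \<union> \<Lambda>) \<eta>" for \<zeta>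
    proof
      fix x
      show "override_on \<zeta> \<sigma> \<Lambda> x = override_on \<zeta> \<xi> \<Delta> x"
        using fun_cong[OF 1(3), of x] \<zeta> 1(2) by (auto simp: cyl_def override_on_def split: if_splits)
    qed
    then show ?thesis
      using 1(1) fin\<Lambda> by (intro exI[of _ "W0 \<union> \<Lambda>"]) (auto intro!: 1(4) simp: cyl_def)
  qed
  note ex = this
  define W0 where "W0 \<eta> \<sigma> = (SOME W0. finite W0 \<and> (\<forall>W\<in>volumes. W0 \<subseteq> W \<longrightarrow>
    (\<forall>\<zeta>\<in>cyl W0 \<eta>. transports M W \<zeta> (override_on \<zeta> \<sigma> \<Lambda>))))" for \<eta> \<sigma>
  have W0: "finite (W0 \<eta> \<sigma>)"
    "\<And>W \<zeta>. W \<in> volumes \<Longrightarrow> W0 \<eta> \<sigma> \<subseteq> W \<Longrightarrow> \<zeta> \<in> cyl (W0 \<eta> \<sigma>) \<eta> \<Longrightarrow> transports M W \<zeta> (override_on \<zeta> \<sigma> \<Lambda>)"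
    if "\<sigma> \<in> patterns \<Lambda>" for \<eta> \<sigma>
    using someI_ex[OF ex[OF that, of \<eta>], folded W0_def] by auto
  define F where "F \<eta> = (\<Union>\<sigma>\<in>patterns \<Lambda>. W0 \<eta> \<sigma>)" for \<eta>
  have "finite (F \<eta>)" for \<eta> using W0(1) fin\<Lambda> by (auto simp: F_def)
  from cyl_cover[of F, OF this] obtain V where V: "finite V" "\<And>\<zeta>. \<exists>\<eta>. \<zeta> \<in> cyl (F \<eta>) \<eta> \<and> F \<eta> \<subseteq> V" by blast
  have "transports M (V \<union> \<Lambda>) \<zeta> (override_on \<zeta> \<sigma> \<Lambda>)" if \<sigma>: "\<sigma> \<in> patterns \<Lambda>" for \<sigma> \<zeta>
  proof -
    obtain \<eta> where \<eta>: "\<zeta> \<in> cyl (F \<eta>) \<eta>" "F \<eta> \<subseteq> V" using V(2) by blast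
    have "W0 \<eta> \<sigma> \<subseteq> F \<eta>" using \<sigma> by (auto simp: F_def)
    then show ?thesis
      using \<eta> V(1) \<Lambda> by (intro W0(2)[OF \<sigma>, of _ \<eta>]) (auto simp: volumes_iff cyl_def)
  qed
  then show ?thesis using V(1) \<Lambda> by (intro bexI[of _ "V \<union> \<Lambda>"]) (auto simp: volumes_iff)
qed

text \<open>The integral is decomposed by the pattern \<zeta> in W, and each part is transported to
  the pattern \<open>r \<zeta>\<close> that shows \<eta> on \<Lambda>. This exchanges
  \<open>cyl_prob \<Lambda> \<eta>\<close> for \<open>cyl_prob \<Lambda> \<zeta>\<close>. The
  patterns with the same \<open>r \<zeta>\<close> run through all patterns on \<Lambda>, whose
  kernel probabilities sum to 1.\<close>

theorem balanced_imp_gibbs: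
  assumes M: "M \<in> prob_measures" "balanced M" and irr: "irreducible_ips c"
  shows "M \<in> gibbs_measures \<gamma>"
proof -
  have "(\<integral>\<omega>. cyl_prob \<Lambda> \<eta> \<omega> \<partial>M) = measure M (cyl \<Lambda> \<eta>)" if \<Lambda>: "\<Lambda> \<in> volumes" for \<Lambda> \<eta>
  proof -
    obtain W where W: "W \<in> volumes" "\<Lambda> \<subseteq> W" "\<And>\<sigma> \<zeta>. \<sigma> \<in> patterns \<Lambda> \<Longrightarrow> transports M W \<zeta> (override_on \<zeta> \<sigma> \<Lambda>)"
      using ex_transport_volume[OF M irr \<Lambda>] by blast
    have fin: "finite W" "finite \<Lambda>" using W(1) \<Lambda> by (auto simp: volumes_iff)
    define r where "r \<zeta> = override_on \<zeta> \<eta> \<Lambda>" for \<zeta>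
    have int: "integrable M (\<lambda>\<omega>. indicator (cyl W \<zeta>) \<omega> * cyl_prob \<Lambda> \<eta>' \<omega>)" for \<zeta> \<eta>'
      by (intro integrable_continuous[OF M(1)] continuous_intros fin \<Lambda>)
    \<comment> \<open>The test function is \<open>cyl_prob \<Lambda> \<eta>\<close>. Writing
      \<open>r \<zeta>\<close> on W alters a configuration of \<open>cyl W \<zeta>\<close> only
      inside \<Lambda>, where this function does not look.\<close>
    have swap: "(\<integral>\<omega>. indicator (cyl W \<zeta>) \<omega> * cyl_prob \<Lambda> \<eta> \<omega> \<partial>M) = (\<integral>\<omega>. indicator (cyl W (r \<zeta>)) \<omega> * cyl_prob \<Lambda> \<zeta> \<omega> \<partial>M)" for \<zeta>
    proof -
      have "override_on (r \<zeta>) (restrict \<zeta> \<Lambda>) \<Lambda> = \<zeta>" by (auto simp: r_def override_on_def)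
      with W(3)[OF restrict_patterns, of "r \<zeta>" \<zeta>] have tr: "transports M W (r \<zeta>) \<zeta>" by simp
      have "(\<integral>\<omega>. indicator (cyl W \<zeta>) \<omega> * cyl_prob \<Lambda> \<eta> \<omega> \<partial>M) = (\<integral>\<omega>. indicator (cyl W \<zeta>) \<omega> * cyl_prob \<Lambda> \<eta> (override_on \<omega> (r \<zeta>) W) \<partial>M)"
      proof (intro Bochner_Integration.integral_cong refl)
        fix \<omega>
        have "override_on \<omega> (r \<zeta>) W \<in> cyl (- \<Lambda>) \<omega>" if "\<omega> \<in> cyl W \<zeta>"
          using that by (auto simp: cyl_def r_def override_on_def)
        then show "indicator (cyl W \<zeta>) \<omega> * cyl_prob \<Lambda> \<eta> \<omega> = indicator (cyl W \<zeta>) \<omega> * cyl_prob \<Lambda> \<eta> (override_on \<omega> (r \<zeta>) W)"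
          using cyl_prob_local[OF \<Lambda>] by (auto simp: indicator_def)
      qed
      also have "\<dots> = (\<integral>\<omega>. indicator (cyl W (r \<zeta>)) \<omega> * (cyl_prob \<Lambda> \<eta> \<omega> * cyl_prob W \<zeta> \<omega> / cyl_prob W (r \<zeta>) \<omega>) \<partial>M)"
        using tr continuous_cyl_prob[OF \<Lambda>, of \<eta>] unfolding transports_def by blast
      also have "\<dots> = (\<integral>\<omega>. indicator (cyl W (r \<zeta>)) \<omega> * cyl_prob \<Lambda> \<zeta> \<omega> \<partial>M)"
      proof (intro Bochner_Integration.integral_cong refl)
        fix \<omega>
        have "cyl_prob \<Lambda> \<eta> \<omega> * cyl_prob W \<zeta> \<omega> / cyl_prob W (r \<zeta>) \<omega> = cyl_prob \<Lambda> \<zeta> \<omega>" if \<omega>: "\<omega> \<in> cyl W (r \<zeta>)"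
        proof -
          have "cyl_prob W \<zeta> \<omega> / cyl_prob W (r \<zeta>) \<omega> = cyl_prob \<Lambda> \<zeta> \<omega> / cyl_prob \<Lambda> (r \<zeta>) \<omega>"
            by (rule cyl_prob_ratio[OF W(1) \<Lambda> W(2)]) (use \<omega> in \<open>auto simp: cyl_def r_def\<close>)
          moreover have "cyl_prob \<Lambda> (r \<zeta>) \<omega> = cyl_prob \<Lambda> \<eta> \<omega>"
            by (rule cyl_prob_pattern) (auto simp: cyl_def r_def)
          ultimately show ?thesis
            using cyl_prob_pos[OF \<Lambda>, of \<eta> \<omega>] by (metis less_irrefl nonzero_mult_div_cancel_left times_divide_eq_right)
        qed
        then show "indicator (cyl W (r \<zeta>)) \<omega> * (cyl_prob \<Lambda> \<eta> \<omega> * cyl_prob W \<zeta> \<omega> / cyl_prob W (r \<zeta>) \<omega>)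
            = indicator (cyl W (r \<zeta>)) \<omega> * cyl_prob \<Lambda> \<zeta> \<omega>"
          by (auto simp: indicator_def)
      qed
      finally show ?thesis .
    qed
    have sum_r: "(\<Sum>\<zeta>\<in>patterns W. indicator (cyl W (r \<zeta>)) \<omega> * cyl_prob \<Lambda> \<zeta> \<omega>) = indicator (cyl \<Lambda> \<eta>) \<omega>" for \<omega>
    proof (cases "\<omega> \<in> cyl \<Lambda> \<eta>")
      case False
      have "\<omega> \<in> cyl \<Lambda> \<eta>" if "\<omega> \<in> cyl W (r \<zeta>)" for \<zeta>
        using that W(2) by (auto simp: cyl_def r_def)
      then have "\<omega> \<notin> cyl W (r \<zeta>)" for \<zeta> using False by blast
      then show ?thesis using False by simp
    next
      case True
      \<comment> \<open>A pattern \<zeta> in the sum must coincide with \<omega> on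
        \<open>W - \<Lambda>\<close>; \<open>?g\<close> recovers it from its restriction to
        \<Lambda>.\<close>
      let ?g = "\<lambda>\<sigma>. restrict (override_on \<omega> \<sigma> \<Lambda>) W"
      have "(\<Sum>\<zeta>\<in>patterns W. indicator (cyl W (r \<zeta>)) \<omega> * cyl_prob \<Lambda> \<zeta> \<omega>)
          = (\<Sum>\<zeta>\<in>{\<zeta>\<in>patterns W. \<omega> \<in> cyl W (r \<zeta>)}. cyl_prob \<Lambda> \<zeta> \<omega>)"
        using fin by (intro sum.mono_neutral_cong_right) auto
      also have "\<dots> = (\<Sum>\<sigma>\<in>patterns \<Lambda>. cyl_prob \<Lambda> \<sigma> \<omega>)"
      proof (rule sum.reindex_bij_witness[of _ ?g "\<lambda>\<zeta>. restrict \<zeta> \<Lambda>"])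
        fix \<zeta> assume \<zeta>: "\<zeta> \<in> {\<zeta> \<in> patterns W. \<omega> \<in> cyl W (r \<zeta>)}"
        show "?g (restrict \<zeta> \<Lambda>) = \<zeta>"
          by (rule patterns_eqI[of _ W]) (use \<zeta> in \<open>auto simp: cyl_def r_def override_on_def\<close>)
        show "restrict \<zeta> \<Lambda> \<in> patterns \<Lambda>" by simp
        show "cyl_prob \<Lambda> (restrict \<zeta> \<Lambda>) \<omega> = cyl_prob \<Lambda> \<zeta> \<omega>" by (rule cyl_prob_pattern) (auto simp: cyl_def)
      next
        fix \<sigma> :: "('d, 'q) config" assume \<sigma>: "\<sigma> \<in> patterns \<Lambda>"
        show "restrict (?g \<sigma>) \<Lambda> = \<sigma>"
          by (rule patterns_eqI[of _ \<Lambda>]) (use \<sigma> W(2) in \<open>auto simp: Int_absorb1\<close>)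
        show "?g \<sigma> \<in> {\<zeta> \<in> patterns W. \<omega> \<in> cyl W (r \<zeta>)}"
          using True by (auto simp: cyl_def r_def override_on_def)
      qed
      also have "\<dots> = 1" by (rule sum_cyl_prob[OF \<Lambda>])
      finally show ?thesis using True by simp
    qed
    have "(\<integral>\<omega>. cyl_prob \<Lambda> \<eta> \<omega> \<partial>M) = (\<integral>\<omega>. (\<Sum>\<zeta>\<in>patterns W. indicator (cyl W \<zeta>) \<omega> * cyl_prob \<Lambda> \<eta> \<omega>) \<partial>M)"
    proof (intro Bochner_Integration.integral_cong refl)
      fix \<omega>
      show "cyl_prob \<Lambda> \<eta> \<omega> = (\<Sum>\<zeta>\<in>patterns W. indicator (cyl W \<zeta>) \<omega> * cyl_prob \<Lambda> \<eta> \<omega>)"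
        using sum_indicator_cyl[OF fin(1), of "\<lambda>_. cyl_prob \<Lambda> \<eta> \<omega>" \<omega>] by (simp only: mult.commute)
    qed
    also have "\<dots> = (\<Sum>\<zeta>\<in>patterns W. (\<integral>\<omega>. indicator (cyl W (r \<zeta>)) \<omega> * cyl_prob \<Lambda> \<zeta> \<omega> \<partial>M))"
      by (subst Bochner_Integration.integral_sum) (auto simp: swap int)
    also have "\<dots> = (\<integral>\<omega>. (\<Sum>\<zeta>\<in>patterns W. indicator (cyl W (r \<zeta>)) \<omega> * cyl_prob \<Lambda> \<zeta> \<omega>) \<partial>M)"
      by (subst Bochner_Integration.integral_sum) (auto simp: int)
    also have "\<dots> = measure M (cyl \<Lambda> \<eta>)"
      by (simp only: sum_r integral_indicator_cyl[OF M(1) fin(2)])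
    finally show ?thesis .
  qed
  then show ?thesis using M(1) by (simp add: gibbs_measures_def cyl_prob_def)
qed

end

section \<open>States and an entropy inequality\<close>

text \<open>The quantity \<open>(x - y)\<^sup>2 / (x + y)\<close> stands in between: the upper bound
  comes from \<open>ln z \<le> z - 1\<close>, the lower one from completing a square. The free
  parameter s makes the bound linear in \<open>\<bar>x - y\<bar>\<close>, so that currents of many
  pairs can be added and s tuned at the end.\<close>

lemma ln_diff_mult_ge:
  fixes x y s :: real
  assumes "x > 0" "y > 0"
  shows "s * \<bar>x - y\<bar> - s\<^sup>2 * (x + y) \<le> (x - y) * (ln x - ln y)"
proof -
  have *: "(x - y)\<^sup>2 / (x + y) \<le> (x - y) * (ln x - ln y)" if "x > 0" "y > 0" "y \<le> x" for x y :: real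
  proof -
    have "ln (y / x) \<le> y / x - 1" using that by (intro ln_le_minus_one) simp
    then have "(x - y) / x \<le> ln x - ln y" using that by (simp add: ln_div diff_divide_distrib)
    then have "(x - y) * ((x - y) / x) \<le> (x - y) * (ln x - ln y)" using that by (intro mult_left_mono) auto
    moreover have "(x - y)\<^sup>2 / (x + y) \<le> (x - y) * ((x - y) / x)"
      using that by (simp add: power2_eq_square frac_le)
    ultimately show ?thesis by linarith
  qed
  have "(x - y)\<^sup>2 / (x + y) \<le> (x - y) * (ln x - ln y)"
  proof (cases "y \<le> x")
    case True
    then show ?thesis using * assms by blast
  next
    case False
    with *[of y x] assms show ?thesis by (simp add: power2_commute add.commute algebra_simps)
  qed
  moreover have "s * \<bar>x - y\<bar> - s\<^sup>2 * (x + y) \<le> (x - y)\<^sup>2 / (x + y)"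
  proof -
    have "(s * \<bar>x - y\<bar> - s\<^sup>2 * (x + y)) * (x + y) \<le> (x - y)\<^sup>2"
    proof -
      have "0 \<le> (\<bar>x - y\<bar> - s * (x + y) / 2)\<^sup>2 + 3 / 4 * (s * (x + y))\<^sup>2" by simp
      also have "\<dots> = \<bar>x - y\<bar>\<^sup>2 - (s * \<bar>x - y\<bar> - s\<^sup>2 * (x + y)) * (x + y)"
        by (simp add: power2_eq_square field_simps)
      finally show ?thesis by simp
    qed
    then show ?thesis using assms by (simp add: pos_le_divide_eq)
  qed
  ultimately show ?thesis by linarith
qed

text \<open>The sign of \<open>ln f' - ln f\<close> decides which of the two bounds on F is of use.
  A surplus of flux is harmless because \<open>f * ln (f' / f) \<le> f'\<close>: the error is linear
  in \<open>f'\<close> even if the logarithm is large.\<close>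

lemma flux_log_bound:
  fixes f f' m F \<alpha> :: real
  assumes pos: "f > 0" "f' > 0" "m \<ge> 0" and \<alpha>: "0 < \<alpha>" "\<alpha> \<le> 1"
    and F: "\<alpha> * (f * m) \<le> F" "\<alpha> * F \<le> f * m"
  shows "F * (ln f' - ln f) \<le> \<alpha> * (m * f * (ln f' - ln f)) + (1 / \<alpha> - \<alpha>) * (m * f')"
proof (cases "f \<le> f'")
  case True
  have "ln (f' / f) \<le> f' / f - 1" using pos by (intro ln_le_minus_one) simp
  then have "f * ln (f' / f) \<le> f * (f' / f - 1)" using pos by (intro mult_left_mono) auto
  also have "\<dots> \<le> f'" using pos by (simp add: right_diff_distrib)
  finally have l: "f * (ln f' - ln f) \<le> f'" using pos by (simp add: ln_div)
  have 0: "0 \<le> ln f' - ln f" using True pos by simp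
  have a: "0 \<le> 1 / \<alpha> - \<alpha>"
    using \<alpha> mult_mono[of \<alpha> 1 \<alpha> 1] by (simp add: field_simps)
  have *: "(1 / \<alpha>) * (f * m) * l = \<alpha> * (m * f * l) + (1 / \<alpha> - \<alpha>) * (m * (f * l))" for l
    by (simp add: algebra_simps)
  have "F \<le> (1 / \<alpha>) * (f * m)" using F(2) \<alpha> by (simp add: field_simps)
  then have "F * (ln f' - ln f) \<le> (1 / \<alpha>) * (f * m) * (ln f' - ln f)" using 0 by (rule mult_right_mono)
  also have "\<dots> = \<alpha> * (m * f * (ln f' - ln f)) + (1 / \<alpha> - \<alpha>) * (m * (f * (ln f' - ln f)))"
    by (rule *)
  also have "\<dots> \<le> \<alpha> * (m * f * (ln f' - ln f)) + (1 / \<alpha> - \<alpha>) * (m * f')"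
    using l a pos by (intro add_left_mono mult_left_mono) auto
  finally show ?thesis .
next
  case False
  then have "ln f' - ln f \<le> 0" using pos by simp
  then have "F * (ln f' - ln f) \<le> \<alpha> * (f * m) * (ln f' - ln f)" using F(1) by (intro mult_right_mono_neg) auto
  moreover have "0 \<le> 1 / \<alpha> - \<alpha>"
    using \<alpha> mult_mono[of \<alpha> 1 \<alpha> 1] by (simp add: field_simps)
  then have "0 \<le> (1 / \<alpha> - \<alpha>) * (m * f')" using pos by simp
  ultimately show ?thesis by (simp add: mult_ac)
qed

text \<open>The fluxes F are traded for \<open>f x * m x y\<close>, whose symmetric weights make the
  sum a dissipation. The cost of the trade is a multiple of B that vanishes as \<alpha> tends to 1;
  the term with \<open>s\<^sup>2\<close> is the price of the linear bound
  \<open>ln_diff_mult_ge\<close>.\<close>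

lemma entropy_dissipation_bound:
  fixes f :: "'a \<Rightarrow> real" and F m :: "'a \<Rightarrow> 'a \<Rightarrow> real"
  assumes G: "finite G" "\<And>x y. (x, y) \<in> G \<Longrightarrow> (y, x) \<in> G"
    and f: "\<And>x y. (x, y) \<in> G \<Longrightarrow> f x > 0"
    and m: "\<And>x y. (x, y) \<in> G \<Longrightarrow> 0 \<le> m x y" "\<And>x y. (x, y) \<in> G \<Longrightarrow> m x y = m y x"
    and \<alpha>: "0 < \<alpha>" "\<alpha> \<le> 1"
    and F: "\<And>x y. (x, y) \<in> G \<Longrightarrow> \<alpha> * (f x * m x y) \<le> F x y" "\<And>x y. (x, y) \<in> G \<Longrightarrow> \<alpha> * F x y \<le> f x * m x y"
    and B: "(\<Sum>(x, y)\<in>G. m x y * f y) \<le> B"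
    and s: "0 \<le> s"
  shows "(\<Sum>(x, y)\<in>G. F x y * (ln (f y) - ln (f x)))
    \<le> - (\<alpha> * s / 2) * (\<Sum>(x, y)\<in>G. \<bar>F x y - F y x\<bar>) + (s * (1 - \<alpha>) + \<alpha> * s\<^sup>2 + 1 / \<alpha> - \<alpha>) * B"
proof -
  have swap: "(\<Sum>(x, y)\<in>G. g x y) = (\<Sum>(x, y)\<in>G. g y x)" for g :: "'a \<Rightarrow> 'a \<Rightarrow> real"
    by (rule sum.reindex_bij_witness[of _ prod.swap prod.swap]) (auto intro: G(2))
  let ?L = "\<Sum>(x, y)\<in>G. m x y * f x * (ln (f y) - ln (f x))"
  let ?M = "\<Sum>(x, y)\<in>G. m x y * f y"
  let ?X = "\<Sum>(x, y)\<in>G. \<bar>F x y - F y x\<bar>"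
  let ?A = "\<Sum>(x, y)\<in>G. m x y * \<bar>f x - f y\<bar>"
  have M': "(\<Sum>(x, y)\<in>G. m x y * f x) = ?M"
    unfolding swap[of "\<lambda>x y. m x y * f x"]
    by (rule sum.cong[OF refl]) (clarify, drule m(2), simp)
  have f2: "f y > 0" if "(x, y) \<in> G" for x y using f[OF G(2)[OF that]] .
  have M0: "0 \<le> ?M" by (intro sum_nonneg) (clarsimp, intro mult_nonneg_nonneg m(1) less_imp_le[OF f2])
  have 1: "(\<Sum>(x, y)\<in>G. F x y * (ln (f y) - ln (f x))) \<le> \<alpha> * ?L + (1 / \<alpha> - \<alpha>) * ?M"
  proof -
    have "(\<Sum>(x, y)\<in>G. F x y * (ln (f y) - ln (f x)))
        \<le> (\<Sum>(x, y)\<in>G. \<alpha> * (m x y * f x * (ln (f y) - ln (f x))) + (1 / \<alpha> - \<alpha>) * (m x y * f y))"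
    proof (rule sum_mono, clarify)
      fix x y assume xy: "(x, y) \<in> G"
      show "F x y * (ln (f y) - ln (f x)) \<le> \<alpha> * (m x y * f x * (ln (f y) - ln (f x))) + (1 / \<alpha> - \<alpha>) * (m x y * f y)"
        by (rule flux_log_bound[OF f[OF xy] f2[OF xy] m(1)[OF xy] \<alpha> F(1)[OF xy] F(2)[OF xy]])
    qed
    also have "\<dots> = \<alpha> * ?L + (1 / \<alpha> - \<alpha>) * ?M"
      by (simp add: sum.distrib sum_distrib_left split_def)
    finally show ?thesis .
  qed
  \<comment> \<open>Adding the sum to its reflection turns each term into minus m times the product
    in \<open>ln_diff_mult_ge\<close>.\<close>
  have 2: "2 * ?L \<le> - s * ?A + s\<^sup>2 * (2 * ?M)"
  proof -
    have "?L = (\<Sum>(x, y)\<in>G. m x y * f y * (ln (f x) - ln (f y)))"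
      unfolding swap[of "\<lambda>x y. m x y * f x * (ln (f y) - ln (f x))"]
      by (rule sum.cong[OF refl]) (clarify, drule m(2), simp)
    then have "2 * ?L = ?L + (\<Sum>(x, y)\<in>G. m x y * f y * (ln (f x) - ln (f y)))" by simp
    also have "\<dots> = (\<Sum>(x, y)\<in>G. - (m x y * ((f x - f y) * (ln (f x) - ln (f y)))))"
      by (simp add: sum.distrib[symmetric] split_def algebra_simps)
    also have "\<dots> \<le> (\<Sum>(x, y)\<in>G. - (m x y * (s * \<bar>f x - f y\<bar> - s\<^sup>2 * (f x + f y))))"
    proof (rule sum_mono, clarify)
      fix x y assume xy: "(x, y) \<in> G"
      show "- (m x y * ((f x - f y) * (ln (f x) - ln (f y)))) \<le> - (m x y * (s * \<bar>f x - f y\<bar> - s\<^sup>2 * (f x + f y)))"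
        using mult_left_mono[OF ln_diff_mult_ge[OF f[OF xy] f2[OF xy], of s] m(1)[OF xy]] by simp
    qed
    also have "\<dots> = - s * ?A + s\<^sup>2 * ((\<Sum>(x, y)\<in>G. m x y * f x) + ?M)"
      by (simp add: sum_distrib_left sum.distrib[symmetric] sum_negf[symmetric] split_def algebra_simps)
    finally show ?thesis using M' by simp
  qed
  \<comment> \<open>The net fluxes of F are compared with those of \<open>f x * m x y\<close>, which
    equal \<open>m x y * \<bar>f x - f y\<bar>\<close> in absolute value by symmetry of m.\<close>
  have 3: "?X \<le> ?A + 2 * (1 / \<alpha> - 1) * ?M"
  proof -
    have d: "\<bar>F x y - f x * m x y\<bar> \<le> (1 / \<alpha> - 1) * (f x * m x y)" if "(x, y) \<in> G" for x y
    proof -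
      have p: "0 \<le> f x * m x y" using f[OF that] m(1)[OF that] by simp
      have "F x y \<le> (1 / \<alpha>) * (f x * m x y)" using F(2)[OF that] \<alpha> by (simp add: field_simps)
      moreover have "(1 - \<alpha>) * (f x * m x y) \<le> (1 / \<alpha> - 1) * (f x * m x y)"
      proof (rule mult_right_mono[OF _ p])
        have "(1 - \<alpha>) * \<alpha> \<le> (1 - \<alpha>) * 1" using \<alpha> by (intro mult_left_mono) auto
        then show "1 - \<alpha> \<le> 1 / \<alpha> - 1" using \<alpha> by (simp add: field_simps)
      qed
      ultimately show ?thesis using F(1)[OF that] by (simp add: abs_le_iff algebra_simps)
    qed
    have "?X \<le> (\<Sum>(x, y)\<in>G. m x y * \<bar>f x - f y\<bar> + (1 / \<alpha> - 1) * (m x y * f x) + (1 / \<alpha> - 1) * (m x y * f y))"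
    proof (rule sum_mono, clarify)
      fix x y assume xy: "(x, y) \<in> G"
      have "\<bar>F x y - F y x\<bar> \<le> \<bar>F x y - f x * m x y\<bar> + \<bar>F y x - f y * m y x\<bar> + \<bar>f x * m x y - f y * m y x\<bar>" by linarith
      also have "\<bar>f x * m x y - f y * m y x\<bar> = m x y * \<bar>f x - f y\<bar>"
        using m[OF xy] by (simp flip: left_diff_distrib add: abs_mult)
      finally show "\<bar>F x y - F y x\<bar> \<le> m x y * \<bar>f x - f y\<bar> + (1 / \<alpha> - 1) * (m x y * f x) + (1 / \<alpha> - 1) * (m x y * f y)"
        using d[OF xy] d[OF G(2)[OF xy]] m(2)[OF xy] by (simp add: mult.commute)
    qed
    also have "\<dots> = ?A + (1 / \<alpha> - 1) * (\<Sum>(x, y)\<in>G. m x y * f x) + (1 / \<alpha> - 1) * ?M"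
      by (simp add: sum.distrib sum_distrib_left split_def)
    finally show ?thesis unfolding M' by (simp add: algebra_simps)
  qed
  have "(\<Sum>(x, y)\<in>G. F x y * (ln (f y) - ln (f x))) \<le> \<alpha> * ((- s * ?A + s\<^sup>2 * (2 * ?M)) / 2) + (1 / \<alpha> - \<alpha>) * ?M"
    by (rule order_trans[OF 1 add_right_mono[OF mult_left_mono]]) (use 2 \<alpha> in auto)
  also have "\<dots> = - (\<alpha> * s / 2) * ?A + (\<alpha> * s\<^sup>2 + 1 / \<alpha> - \<alpha>) * ?M"
    by (simp add: field_simps)
  also have "\<dots> \<le> - (\<alpha> * s / 2) * (?X - 2 * (1 / \<alpha> - 1) * ?M) + (\<alpha> * s\<^sup>2 + 1 / \<alpha> - \<alpha>) * ?M"
    using 3 \<alpha> s mult_left_mono[of "?X - 2 * (1 / \<alpha> - 1) * ?M" ?A "\<alpha> * s / 2"] by simp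
  also have "\<dots> = - (\<alpha> * s / 2) * ?X + (s * (1 - \<alpha>) + \<alpha> * s\<^sup>2 + 1 / \<alpha> - \<alpha>) * ?M"
    using \<alpha> by (simp add: field_simps)
  also have "\<dots> \<le> - (\<alpha> * s / 2) * ?X + (s * (1 - \<alpha>) + \<alpha> * s\<^sup>2 + 1 / \<alpha> - \<alpha>) * B"
  proof (rule add_left_mono, rule mult_left_mono[OF B])
    have "0 \<le> 1 / \<alpha> - \<alpha>" using \<alpha> mult_mono[of \<alpha> 1 \<alpha> 1] by (simp add: field_simps)
    moreover have "0 \<le> s * (1 - \<alpha>)" "0 \<le> \<alpha> * s\<^sup>2" using \<alpha> s by auto
    ultimately show "0 \<le> s * (1 - \<alpha>) + \<alpha> * s\<^sup>2 + 1 / \<alpha> - \<alpha>" by linarith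
  qed
  finally show ?thesis .
qed

text \<open>Evolved measures act below only through integrals of continuous functions, so positive
  normalised functionals stand for them at intermediate times, and no measure has to be constructed
  there.\<close>

locale state =
  fixes E :: "(('d::finite, 'q::finite) config \<Rightarrow> real) \<Rightarrow> real"
  assumes add: "continuous_on UNIV f \<Longrightarrow> continuous_on UNIV g \<Longrightarrow> E (\<lambda>\<omega>. f \<omega> + g \<omega>) = E f + E g"
    and scale: "continuous_on UNIV f \<Longrightarrow> E (\<lambda>\<omega>. a * f \<omega>) = a * E f"
    and nonneg: "continuous_on UNIV f \<Longrightarrow> (\<And>\<omega>. 0 \<le> f \<omega>) \<Longrightarrow> 0 \<le> E f"
    and one: "E (\<lambda>_. 1) = 1"
begin

lemma diff:
  assumes "continuous_on UNIV f" "continuous_on UNIV g"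
  shows "E (\<lambda>\<omega>. f \<omega> - g \<omega>) = E f - E g"
  using add[OF assms(1), of "\<lambda>\<omega>. (- 1) * g \<omega>"] scale[OF assms(2), of "- 1"] assms
  by (simp add: continuous_intros)

lemma mono:
  assumes "continuous_on UNIV f" "continuous_on UNIV g" "\<And>\<omega>. f \<omega> \<le> g \<omega>"
  shows "E f \<le> E g"
  using nonneg[of "\<lambda>\<omega>. g \<omega> - f \<omega>"] diff[OF assms(2,1)] assms by (simp add: continuous_intros)

lemma zero: "E (\<lambda>_. 0) = 0"
  using scale[of "\<lambda>_. 1" 0] by simp

lemma sum:
  assumes "\<And>i. i \<in> I \<Longrightarrow> continuous_on UNIV (f i)"
  shows "E (\<lambda>\<omega>. \<Sum>i\<in>I. f i \<omega>) = (\<Sum>i\<in>I. E (f i))"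
  using assms
proof (induction I rule: infinite_finite_induct)
  case (insert i I)
  then show ?case by (simp add: add continuous_intros)
qed (simp_all add: zero)

lemma sum_cyl:
  assumes "finite \<Lambda>"
  shows "(\<Sum>\<eta>\<in>patterns \<Lambda>. E (indicator (cyl \<Lambda> \<eta>))) = 1"
proof -
  have "(\<Sum>\<eta>\<in>patterns \<Lambda>. E (indicator (cyl \<Lambda> \<eta>))) = E (\<lambda>\<omega>. \<Sum>\<eta>\<in>patterns \<Lambda>. indicator (cyl \<Lambda> \<eta>) \<omega>)"
    by (rule sum[symmetric]) (rule continuous_on_indicator_cyl[OF assms])
  also have "(\<lambda>\<omega>::('d, 'q) config. \<Sum>\<eta>\<in>patterns \<Lambda>. indicator (cyl \<Lambda> \<eta>) \<omega>) = (\<lambda>_. 1 :: real)"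
    by (rule ext) (rule sum_indicator_cyl[OF assms, of "\<lambda>_. 1", unfolded mult_1])
  finally show ?thesis by (simp add: one)
qed

end

lemma state_integral:
  assumes "M \<in> prob_measures"
  shows "state (\<lambda>f. \<integral>\<omega>. f \<omega> \<partial>M)"
proof -
  interpret prob_space M using prob_measuresD[OF assms] by simp
  show ?thesis
    by unfold_locales (auto simp: integrable_continuous[OF assms] prob_space intro!: Bochner_Integration.integral_nonneg)
qed

section \<open>Fluxes between cylinders\<close>

context translation_invariant_rates_system
begin

definition flux :: "((('d, 'q) config \<Rightarrow> real) \<Rightarrow> real) \<Rightarrow> 'd site set \<Rightarrow> ('d, 'q) config \<Rightarrow> ('d, 'q) config \<Rightarrow> real" where
  "flux E \<Lambda> \<eta> \<eta>' = E (\<lambda>\<omega>. indicator (cyl \<Lambda> \<eta>) \<omega> * inflow \<Lambda> \<eta>' \<omega>)"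

lemma flux_integrand_cont: "finite \<Lambda> \<Longrightarrow> continuous_on UNIV (\<lambda>\<omega>. indicator (cyl \<Lambda> \<eta>) \<omega> * inflow \<Lambda> \<eta>' \<omega>)"
  by (intro continuous_intros)

lemma flux_nonneg:
  assumes "state E" "finite \<Lambda>" shows "0 \<le> flux E \<Lambda> \<eta> \<eta>'"
  unfolding flux_def
  by (rule state.nonneg[OF assms(1) flux_integrand_cont[OF assms(2)]]) (simp add: inflow_nonneg)

lemma flux_bounds:
  assumes E: "state E" and \<Lambda>: "finite \<Lambda>"
    and le: "\<And>\<omega>. \<omega> \<in> cyl \<Lambda> \<eta> \<Longrightarrow> inflow \<Lambda> \<eta>' \<omega> \<le> u"
  shows "flux E \<Lambda> \<eta> \<eta>' \<le> u * E (indicator (cyl \<Lambda> \<eta>))"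
proof -
  have "flux E \<Lambda> \<eta> \<eta>' \<le> E (\<lambda>\<omega>. u * indicator (cyl \<Lambda> \<eta>) \<omega>)"
    unfolding flux_def
    by (rule state.mono[OF E flux_integrand_cont[OF \<Lambda>]])
      (use le in \<open>auto intro!: continuous_on_mult_left continuous_on_indicator_cyl \<Lambda>
        split: split_indicator\<close>)
  then show ?thesis using state.scale[OF E continuous_on_indicator_cyl[OF \<Lambda>]] by simp
qed

lemma flux_lower:
  assumes E: "state E" and \<Lambda>: "finite \<Lambda>"
    and le: "\<And>\<omega>. \<omega> \<in> cyl \<Lambda> \<eta> \<Longrightarrow> u \<le> inflow \<Lambda> \<eta>' \<omega>"
  shows "u * E (indicator (cyl \<Lambda> \<eta>)) \<le> flux E \<Lambda> \<eta> \<eta>'"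
proof -
  have "E (\<lambda>\<omega>. u * indicator (cyl \<Lambda> \<eta>) \<omega>) \<le> flux E \<Lambda> \<eta> \<eta>'"
    unfolding flux_def
    by (rule state.mono[OF E _ flux_integrand_cont[OF \<Lambda>]])
      (use le in \<open>auto intro!: continuous_on_mult_left continuous_on_indicator_cyl \<Lambda>
        split: split_indicator\<close>)
  then show ?thesis using state.scale[OF E continuous_on_indicator_cyl[OF \<Lambda>]] by simp
qed

lemma sum_flux_out:
  assumes E: "state E" and \<Lambda>: "finite \<Lambda>"
  shows "(\<Sum>\<eta>'\<in>patterns \<Lambda>. flux E \<Lambda> \<eta> \<eta>') = E (\<lambda>\<omega>. total_rate \<Lambda> \<omega> * indicator (cyl \<Lambda> \<eta>) \<omega>)"
  unfolding flux_def
  by (subst state.sum[OF E, symmetric])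
    (auto simp: sum_inflow[OF \<Lambda>] sum_distrib_left[symmetric] mult.commute intro: flux_integrand_cont[OF \<Lambda>])

lemma sum_flux_in:
  assumes E: "state E" and \<Lambda>: "finite \<Lambda>"
  shows "(\<Sum>\<eta>'\<in>patterns \<Lambda>. flux E \<Lambda> \<eta>' \<eta>) = E (inflow \<Lambda> \<eta>)"
proof -
  have "(\<Sum>\<eta>'\<in>patterns \<Lambda>. flux E \<Lambda> \<eta>' \<eta>) = E (\<lambda>\<omega>. \<Sum>\<eta>'\<in>patterns \<Lambda>. indicator (cyl \<Lambda> \<eta>') \<omega> * inflow \<Lambda> \<eta> \<omega>)"
    unfolding flux_def by (subst state.sum[OF E]) (auto intro: flux_integrand_cont[OF \<Lambda>])
  also have "(\<lambda>\<omega>. \<Sum>\<eta>'\<in>patterns \<Lambda>. indicator (cyl \<Lambda> \<eta>') \<omega> * inflow \<Lambda> \<eta> \<omega>) = inflow \<Lambda> \<eta>"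
  proof
    fix \<omega>
    show "(\<Sum>\<eta>'\<in>patterns \<Lambda>. indicator (cyl \<Lambda> \<eta>') \<omega> * inflow \<Lambda> \<eta> \<omega>) = inflow \<Lambda> \<eta> \<omega>"
      using sum_indicator_cyl[OF \<Lambda>, of "\<lambda>_. inflow \<Lambda> \<eta> \<omega>" \<omega>] by (simp only: mult.commute)
  qed
  finally show ?thesis .
qed

text \<open>The master equation for the pattern in \<Lambda>, in gain and loss terms. It involves
  the full state through the fluxes, because the rates also see spins outside \<Lambda>.\<close>

lemma state_generator_indicator:
  assumes E: "state E" and \<Lambda>: "finite \<Lambda>"
  shows "E (generator c (indicator (cyl \<Lambda> \<eta>))) = (\<Sum>\<eta>'\<in>patterns \<Lambda>. flux E \<Lambda> \<eta>' \<eta> - flux E \<Lambda> \<eta> \<eta>')"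
proof -
  have "E (generator c (indicator (cyl \<Lambda> \<eta>))) = E (\<lambda>\<omega>. inflow \<Lambda> \<eta> \<omega> - total_rate \<Lambda> \<omega> * indicator (cyl \<Lambda> \<eta>) \<omega>)"
    by (rule arg_cong[of _ _ E]) (rule ext, rule generator_indicator_cyl[OF \<Lambda>])
  also have "\<dots> = E (inflow \<Lambda> \<eta>) - E (\<lambda>\<omega>. total_rate \<Lambda> \<omega> * indicator (cyl \<Lambda> \<eta>) \<omega>)"
    by (rule state.diff[OF E]) (intro continuous_intros \<Lambda>)+
  finally show ?thesis by (simp add: sum_subtractf sum_flux_out[OF E \<Lambda>] sum_flux_in[OF E \<Lambda>])
qed

section \<open>Bounds on rates and on the number of sites changed\<close>

definition rate_bound :: real where
  "rate_bound = (SOME C. 0 \<le> C \<and> (\<forall>\<Lambda>. \<forall>\<tau>\<in>transitions \<Lambda>. \<forall>\<omega>. rate \<tau> \<omega> \<le> C))"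

lemma rate_bound: "0 \<le> rate_bound" "\<tau> \<in> transitions \<Lambda> \<Longrightarrow> rate \<tau> \<omega> \<le> rate_bound"
proof -
  have "\<exists>C. 0 \<le> C \<and> (\<forall>\<Lambda>. \<forall>\<tau>\<in>transitions \<Lambda>. \<forall>\<omega>. rate \<tau> \<omega> \<le> C)"
    using ex_transition_bounds by blast
  from someI_ex[OF this] show "0 \<le> rate_bound" "\<tau> \<in> transitions \<Lambda> \<Longrightarrow> rate \<tau> \<omega> \<le> rate_bound"
    unfolding rate_bound_def by blast+
qed

text \<open>Taken positive because it is divided by later on.\<close>

definition size_bound :: nat where
  "size_bound = (SOME D. 0 < D \<and> (\<forall>\<Lambda>. \<forall>\<tau>\<in>transitions \<Lambda>. card (fst \<tau>) \<le> D))"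

lemma size_bound: "0 < size_bound" "\<tau> \<in> transitions \<Lambda> \<Longrightarrow> card (fst \<tau>) \<le> size_bound"
proof -
  obtain D where "\<forall>\<Lambda>. \<forall>\<tau>\<in>transitions \<Lambda>. card (fst \<tau>) \<le> D"
    using ex_transition_bounds by blast
  then have "\<exists>D. 0 < D \<and> (\<forall>\<Lambda>. \<forall>\<tau>\<in>transitions \<Lambda>. card (fst \<tau>) \<le> D)"
    by (intro exI[of _ "Suc D"]) (auto simp: le_SucI)
  from someI_ex[OF this] show "0 < size_bound" "\<tau> \<in> transitions \<Lambda> \<Longrightarrow> card (fst \<tau>) \<le> size_bound"
    unfolding size_bound_def by blast+
qed

definition site_rate :: real where
  "site_rate = rate_bound * card (transitions {0})"

lemma site_rate_nonneg: "0 \<le> site_rate"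
  using rate_bound(1) by (simp add: site_rate_def)

lemma card_transitions_le: "finite \<Lambda> \<Longrightarrow> rate_bound * card (transitions \<Lambda>) \<le> site_rate * card \<Lambda>"
  using mult_left_mono[OF _ rate_bound(1), of "real (card (transitions \<Lambda>))" "real (card (transitions {0}) * card \<Lambda>)"]
    card_transitions[of \<Lambda>] by (simp add: site_rate_def mult.assoc) (metis of_nat_le_iff of_nat_mult)

lemma total_rate_le:
  assumes "finite \<Lambda>" shows "total_rate \<Lambda> \<omega> \<le> site_rate * card \<Lambda>"
proof -
  have "total_rate \<Lambda> \<omega> \<le> (\<Sum>\<tau>\<in>transitions \<Lambda>. rate_bound)"
    unfolding total_rate_def by (intro sum_mono rate_bound)
  also have "\<dots> \<le> site_rate * card \<Lambda>" using card_transitions_le[OF assms] by (simp add: mult.commute)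
  finally show ?thesis .
qed

text \<open>A single move rewrites few sites, and patterns joined by it differ only there. This
  later limits how many windows see the same exchange.\<close>

lemma inflow_nonzero_diff:
  assumes "\<omega> \<in> cyl \<Lambda> \<eta>" "finite \<Lambda>" "inflow \<Lambda> \<eta>' \<omega> \<noteq> 0"
  shows "card {x\<in>\<Lambda>. \<eta> x \<noteq> \<eta>' x} \<le> size_bound"
proof -
  obtain \<tau> where \<tau>: "\<tau> \<in> transitions \<Lambda>" "move \<tau> \<omega> \<in> cyl \<Lambda> \<eta>'"
    using assms(3) unfolding inflow_def by (metis (no_types, lifting) indicator_simps(2) mult_zero_right sum.neutral)
  have "{x\<in>\<Lambda>. \<eta> x \<noteq> \<eta>' x} \<subseteq> fst \<tau>"
    using \<tau>(2) assms(1) by (auto simp: cyl_def move_def override_on_def split: if_splits)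
  then have "card {x\<in>\<Lambda>. \<eta> x \<noteq> \<eta>' x} \<le> card (fst \<tau>)"
    using transitionsD(5)[OF \<tau>(1)] by (rule card_mono[rotated])
  then show ?thesis using size_bound(2)[OF \<tau>(1)] by simp
qed

lemma flux_nonzero_diff:
  assumes "state E" "finite \<Lambda>" "flux E \<Lambda> \<eta> \<eta>' \<noteq> 0"
  shows "card {x\<in>\<Lambda>. \<eta> x \<noteq> \<eta>' x} \<le> size_bound"
proof (rule ccontr)
  assume "\<not> ?thesis"
  then have "indicator (cyl \<Lambda> \<eta>) \<omega> * inflow \<Lambda> \<eta>' \<omega> = 0" for \<omega>
    using inflow_nonzero_diff[OF _ assms(2), of \<omega> \<eta> \<eta>'] by (auto simp: indicator_def)
  then have "flux E \<Lambda> \<eta> \<eta>' = 0" unfolding flux_def by (simp only: state.zero[OF assms(1)])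
  then show False using assms(3) by simp
qed

text \<open>A move between the window cylinders is refined by the patterns on \<Lambda> before and
  after it. That \<zeta> and \<zeta>' differ on W excludes moves away from W, which would appear on
  the right only.\<close>

lemma indicator_inflow_decompose:
  assumes "finite \<Lambda>" "W \<subseteq> \<Lambda>" "\<exists>x\<in>W. \<zeta> x \<noteq> \<zeta>' x"
  shows "indicator (cyl W \<zeta>) \<omega> * inflow W \<zeta>' \<omega> =
    (\<Sum>(\<eta>, \<eta>')\<in>{(\<eta>, \<eta>'). \<eta> \<in> patterns \<Lambda> \<and> \<eta>' \<in> patterns \<Lambda> \<and> \<eta> \<in> cyl W \<zeta> \<and> \<eta>' \<in> cyl W \<zeta>'}.
      indicator (cyl \<Lambda> \<eta>) \<omega> * inflow \<Lambda> \<eta>' \<omega>)"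
proof -
  let ?P = "\<lambda>\<zeta>. {\<eta>\<in>patterns \<Lambda>. \<eta> \<in> cyl W \<zeta>}"
  have finP: "finite (?P \<xi>)" for \<xi> :: "('d, 'q) config" by (rule finite_subset[OF _ finite_patterns[OF assms(1)]]) auto
  have ind: "(\<Sum>\<eta>\<in>?P \<xi>. indicator (cyl \<Lambda> \<eta>) \<omega>) = (indicator (cyl W \<xi>) \<omega> :: real)" for \<xi> \<omega> :: "('d, 'q) config"
  proof -
    have "(\<Sum>\<eta>\<in>?P \<xi>. indicator (cyl \<Lambda> \<eta>) \<omega>) = (\<Sum>\<eta>\<in>patterns \<Lambda>. indicator (cyl W \<xi>) \<eta> * indicator (cyl \<Lambda> \<eta>) \<omega> :: real)"
      using finite_patterns[OF assms(1)] by (intro sum.mono_neutral_cong_left) auto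
    also have "\<dots> = indicator (cyl W \<xi>) (restrict \<omega> \<Lambda>)" by (rule sum_indicator_cyl[OF assms(1)])
    also have "\<dots> = indicator (cyl W \<xi>) \<omega>"
      using assms(2) by (auto simp: indicator_def cyl_def subset_eq)
    finally show ?thesis .
  qed
  have sum_infl: "(\<Sum>\<eta>'\<in>?P \<zeta>'. inflow \<Lambda> \<eta>' \<omega>) = inflow W \<zeta>' \<omega>" if \<omega>: "\<omega> \<in> cyl W \<zeta>"
  proof -
    have "(\<Sum>\<eta>'\<in>?P \<zeta>'. inflow \<Lambda> \<eta>' \<omega>) = (\<Sum>\<tau>\<in>transitions \<Lambda>. rate \<tau> \<omega> * (\<Sum>\<eta>'\<in>?P \<zeta>'. indicator (cyl \<Lambda> \<eta>') (move \<tau> \<omega>)))"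
      unfolding inflow_def by (subst sum.swap) (simp add: sum_distrib_left)
    also have "\<dots> = (\<Sum>\<tau>\<in>transitions \<Lambda>. rate \<tau> \<omega> * indicator (cyl W \<zeta>') (move \<tau> \<omega>))"
      by (simp only: ind)
    also have "\<dots> = inflow W \<zeta>' \<omega>"
      unfolding inflow_def
    proof (rule sum.mono_neutral_right)
      show "finite (transitions \<Lambda>)" using assms(1) by simp
      show "transitions W \<subseteq> transitions \<Lambda>" by (rule transitions_mono[OF assms(2)])
      show "\<forall>\<tau>\<in>transitions \<Lambda> - transitions W. rate \<tau> \<omega> * indicator (cyl W \<zeta>') (move \<tau> \<omega>) = 0"
      proof
        fix \<tau> assume "\<tau> \<in> transitions \<Lambda> - transitions W"
        then have d: "fst \<tau> \<inter> W = {}" by (auto simp: transitions_def)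
        obtain x where x: "x \<in> W" "\<zeta> x \<noteq> \<zeta>' x" using assms(3) by blast
        have "x \<notin> fst \<tau>" using d x by blast
        then have "move \<tau> \<omega> x = \<zeta> x" using x \<omega> by (simp add: move_def cyl_def)
        then have "move \<tau> \<omega> \<notin> cyl W \<zeta>'" using x by (auto simp: cyl_def intro!: bexI[of _ x])
        then show "rate \<tau> \<omega> * indicator (cyl W \<zeta>') (move \<tau> \<omega>) = 0" by simp
      qed
    qed
    finally show ?thesis .
  qed
  have "(\<Sum>(\<eta>, \<eta>')\<in>{(\<eta>, \<eta>'). \<eta> \<in> patterns \<Lambda> \<and> \<eta>' \<in> patterns \<Lambda> \<and> \<eta> \<in> cyl W \<zeta> \<and> \<eta>' \<in> cyl W \<zeta>'}.
      indicator (cyl \<Lambda> \<eta>) \<omega> * inflow \<Lambda> \<eta>' \<omega>) = (\<Sum>(\<eta>, \<eta>')\<in>?P \<zeta> \<times> ?P \<zeta>'. indicator (cyl \<Lambda> \<eta>) \<omega> * inflow \<Lambda> \<eta>' \<omega>)"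
    by (rule sum.cong) auto
  also have "\<dots> = (\<Sum>\<eta>\<in>?P \<zeta>. indicator (cyl \<Lambda> \<eta>) \<omega>) * (\<Sum>\<eta>'\<in>?P \<zeta>'. inflow \<Lambda> \<eta>' \<omega>)"
    by (simp add: sum_product sum.cartesian_product)
  also have "\<dots> = indicator (cyl W \<zeta>) \<omega> * (\<Sum>\<eta>'\<in>?P \<zeta>'. inflow \<Lambda> \<eta>' \<omega>)"
    by (simp only: ind)
  also have "\<dots> = indicator (cyl W \<zeta>) \<omega> * inflow W \<zeta>' \<omega>"
    using sum_infl by (auto simp: indicator_def)
  finally show ?thesis by simp
qed

lemma flux_decompose:
  assumes E: "state E" and "finite \<Lambda>" "W \<subseteq> \<Lambda>" "\<exists>x\<in>W. \<zeta> x \<noteq> \<zeta>' x"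
  shows "flux E W \<zeta> \<zeta>' = (\<Sum>(\<eta>, \<eta>')\<in>{(\<eta>, \<eta>'). \<eta> \<in> patterns \<Lambda> \<and> \<eta>' \<in> patterns \<Lambda> \<and> \<eta> \<in> cyl W \<zeta> \<and> \<eta>' \<in> cyl W \<zeta>'}. flux E \<Lambda> \<eta> \<eta>')"
  unfolding flux_def[of E W] indicator_inflow_decompose[OF assms(2-4)]
  by (subst state.sum[OF E]) (auto simp: flux_def split_def intro!: flux_integrand_cont[OF assms(2)])

lemma current_flux:
  assumes E: "state E" and "finite \<Lambda>"
  shows "E (current \<Lambda> \<eta> \<eta>') = flux E \<Lambda> \<eta> \<eta>' - flux E \<Lambda> \<eta>' \<eta>"
  unfolding flux_def current_def using assms
  by (intro state.diff) (auto intro: flux_integrand_cont)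

lemma current_shift:
  assumes "finite \<Lambda>"
  shows "current (translate i \<Lambda>) (shift i \<eta>) (shift i \<eta>') (shift i \<omega>) = current \<Lambda> \<eta> \<eta>' \<omega>"
  unfolding current_def inflow_shift[OF assms] by (simp add: indicator_def shift_cyl_iff)

text \<open>By invariance every translate of the window carries the same current, which is at most a
  sum of absolute net fluxes in the box. An exchange of patterns is seen by a bounded number of
  translates, since it changes few sites and one of them has to lie in the translated
  window.\<close>

lemma current_window_bound:
  fixes E :: "(('d, 'q) config \<Rightarrow> real) \<Rightarrow> real"
  assumes E: "state E" and inv: "\<And>f i. continuous_on UNIV f \<Longrightarrow> E (\<lambda>\<omega>. f (shift i \<omega>)) = E f"
    and \<Lambda>: "finite \<Lambda>" and W: "finite W" "\<exists>x\<in>W. \<zeta> x \<noteq> \<zeta>' x"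
    and I: "\<And>i. i \<in> I \<Longrightarrow> translate i W \<subseteq> \<Lambda>0" "\<Lambda>0 \<subseteq> \<Lambda>" "finite I"
    and G: "G = {(\<eta>, \<eta>'). \<eta> \<in> patterns \<Lambda> \<and> \<eta>' \<in> patterns \<Lambda> \<and> (\<exists>x\<in>\<Lambda>0. \<eta> x \<noteq> \<eta>' x)}"
  shows "card I * \<bar>E (current W \<zeta> \<zeta>')\<bar> \<le> size_bound * card W * (\<Sum>(\<eta>, \<eta>')\<in>G. \<bar>flux E \<Lambda> \<eta> \<eta>' - flux E \<Lambda> \<eta>' \<eta>\<bar>)"
proof -
  define H where "H i = {(\<eta>, \<eta>'). \<eta> \<in> patterns \<Lambda> \<and> \<eta>' \<in> patterns \<Lambda> \<and>
    \<eta> \<in> cyl (translate i W) (shift i \<zeta>) \<and> \<eta>' \<in> cyl (translate i W) (shift i \<zeta>')}" for i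
  let ?d = "\<lambda>\<eta> \<eta>'. \<bar>flux E \<Lambda> \<eta> \<eta>' - flux E \<Lambda> \<eta>' \<eta>\<bar>"
  have finG: "finite G"
    by (rule finite_subset[of _ "patterns \<Lambda> \<times> patterns \<Lambda>"]) (use finite_patterns[OF \<Lambda>] in \<open>auto simp: G\<close>)
  obtain y where y: "y \<in> W" "\<zeta> y \<noteq> \<zeta>' y" using W(2) by blast
  have yi: "y + i \<in> translate i W" "shift i \<zeta> (y + i) \<noteq> shift i \<zeta>' (y + i)" for i
    using y by (auto simp: mem_translate_iff shift_def)
  have HG: "H i \<subseteq> G" if "i \<in> I" for i
  proof
    fix p assume p: "p \<in> H i"
    have "y + i \<in> \<Lambda>0" using I(1)[OF that] yi by blast
    moreover have "fst p (y + i) \<noteq> snd p (y + i)" using p yi[of i] by (auto simp: H_def cyl_def)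
    ultimately show "p \<in> G" using p by (auto simp: H_def G)
  qed
  have J: "\<bar>E (current W \<zeta> \<zeta>')\<bar> \<le> (\<Sum>(\<eta>, \<eta>')\<in>H i. ?d \<eta> \<eta>')" if i: "i \<in> I" for i
  proof -
    let ?W = "translate i W" and ?\<zeta> = "shift i \<zeta>" and ?\<zeta>' = "shift i \<zeta>'"
    have sub: "?W \<subseteq> \<Lambda>" using I(1)[OF i] I(2) by blast
    have ex: "\<exists>x\<in>?W. ?\<zeta> x \<noteq> ?\<zeta>' x" "\<exists>x\<in>?W. ?\<zeta>' x \<noteq> ?\<zeta> x" using yi[of i] by (auto intro!: bexI[of _ "y + i"])
    have "E (current W \<zeta> \<zeta>') = E (\<lambda>\<omega>. current ?W ?\<zeta> ?\<zeta>' (shift i \<omega>))"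
      by (simp add: current_shift[OF W(1)])
    also have "\<dots> = E (current ?W ?\<zeta> ?\<zeta>')"
      by (rule inv) (intro current_cont, simp add: W)
    also have "\<dots> = flux E ?W ?\<zeta> ?\<zeta>' - flux E ?W ?\<zeta>' ?\<zeta>"
      by (rule current_flux[OF E]) (simp add: W)
    finally have 1: "E (current W \<zeta> \<zeta>') = flux E ?W ?\<zeta> ?\<zeta>' - flux E ?W ?\<zeta>' ?\<zeta>" .
    have 2: "flux E ?W ?\<zeta> ?\<zeta>' = (\<Sum>(\<eta>, \<eta>')\<in>H i. flux E \<Lambda> \<eta> \<eta>')"
      unfolding H_def by (rule flux_decompose[OF E \<Lambda> sub ex(1)])
    have 3: "flux E ?W ?\<zeta>' ?\<zeta> = (\<Sum>(\<eta>, \<eta>')\<in>H i. flux E \<Lambda> \<eta>' \<eta>)"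
      unfolding flux_decompose[OF E \<Lambda> sub ex(2)] H_def
      by (rule sum.reindex_bij_witness[of _ prod.swap prod.swap]) auto
    have "E (current W \<zeta> \<zeta>') = (\<Sum>p\<in>H i. flux E \<Lambda> (fst p) (snd p) - flux E \<Lambda> (snd p) (fst p))"
      unfolding 1 2 3 by (simp add: sum_subtractf split_def)
    then show ?thesis
      using sum_abs[of "\<lambda>p. flux E \<Lambda> (fst p) (snd p) - flux E \<Lambda> (snd p) (fst p)" "H i"] by (simp add: split_def)
  qed
  have "card I * \<bar>E (current W \<zeta> \<zeta>')\<bar> = (\<Sum>i\<in>I. \<bar>E (current W \<zeta> \<zeta>')\<bar>)" by simp
  also have "\<dots> \<le> (\<Sum>i\<in>I. \<Sum>(\<eta>, \<eta>')\<in>H i. ?d \<eta> \<eta>')" by (rule sum_mono[OF J])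
  also have "\<dots> = (\<Sum>i\<in>I. \<Sum>p\<in>G. if p \<in> H i then ?d (fst p) (snd p) else 0)"
    by (rule sum.cong[OF refl], rule sum.mono_neutral_cong_left[OF finG HG]) auto
  \<comment> \<open>Double counting: for each pair of patterns the windows that see it are
    counted.\<close>
  also have "\<dots> = (\<Sum>p\<in>G. card {i\<in>I. p \<in> H i} * ?d (fst p) (snd p))"
    by (subst sum.swap) (simp add: sum.inter_filter[OF I(3), symmetric])
  also have "\<dots> \<le> (\<Sum>p\<in>G. (size_bound * card W) * ?d (fst p) (snd p))"
  proof (rule sum_mono)
    fix p assume "p \<in> G"
    show "card {i\<in>I. p \<in> H i} * ?d (fst p) (snd p) \<le> (size_bound * card W) * ?d (fst p) (snd p)"
    proof (cases "?d (fst p) (snd p) = 0")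
      case False
      let ?D = "{x\<in>\<Lambda>. fst p x \<noteq> snd p x}"
      have "{x\<in>\<Lambda>. snd p x \<noteq> fst p x} = ?D" by auto
      then have D: "card ?D \<le> size_bound"
        using False flux_nonzero_diff[OF E \<Lambda>, of "fst p" "snd p"] flux_nonzero_diff[OF E \<Lambda>, of "snd p" "fst p"] by fastforce
      have "{i\<in>I. p \<in> H i} \<subseteq> (\<lambda>(x, y). x - y) ` (?D \<times> W)"
      proof
        fix i assume i: "i \<in> {i\<in>I. p \<in> H i}"
        have "fst p (y + i) \<noteq> snd p (y + i)" using i yi[of i] by (auto simp: H_def cyl_def)
        moreover have "y + i \<in> \<Lambda>" using I(1)[of i] I(2) i yi[of i] by blast
        ultimately show "i \<in> (\<lambda>(x, y). x - y) ` (?D \<times> W)"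
          using y(1) by (intro image_eqI[of _ _ "(y + i, y)"]) auto
      qed
      then have "card {i\<in>I. p \<in> H i} \<le> card ((\<lambda>(x, y). x - y) ` (?D \<times> W))"
        using \<Lambda> W(1) by (intro card_mono) auto
      also have "\<dots> \<le> card (?D \<times> W)" using \<Lambda> W(1) by (intro card_image_le) auto
      also have "\<dots> \<le> size_bound * card W" using D by (simp add: card_cartesian_product)
      finally have "real (card {i\<in>I. p \<in> H i}) \<le> real (size_bound * card W)" by (rule of_nat_mono)
      then show ?thesis by (rule mult_right_mono) simp
    qed simp
  qed
  also have "\<dots> = size_bound * card W * (\<Sum>(\<eta>, \<eta>')\<in>G. ?d \<eta> \<eta>')"
    by (simp add: sum_distrib_left split_def)
  finally show ?thesis .
qed

end

section \<open>Entropy production in a box\<close>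

context reversible_gibbs_system
begin

text \<open>Along the dynamics this is the time derivative of the entropy relative to \<mu> in the
  box; differentiating the logarithm adds a term that vanishes by conservation of mass, see
  \<open>entropy_derivative\<close>.\<close>

definition entropy_rate :: "((('d, 'q) config \<Rightarrow> real) \<Rightarrow> real) \<Rightarrow> 'd site set \<Rightarrow> real" where
  "entropy_rate E \<Lambda> = (\<Sum>\<eta>\<in>patterns \<Lambda>. E (generator c (indicator (cyl \<Lambda> \<eta>)))
    * ln (E (indicator (cyl \<Lambda> \<eta>)) / measure \<mu> (cyl \<Lambda> \<eta>)))"

abbreviation gibbs_flux :: "'d site set \<Rightarrow> ('d, 'q) config \<Rightarrow> ('d, 'q) config \<Rightarrow> real" where
  "gibbs_flux \<equiv> flux (\<lambda>f. \<integral>\<omega>. f \<omega> \<partial>\<mu>)"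

lemma gibbs_flux_sym: "\<Lambda> \<in> volumes \<Longrightarrow> gibbs_flux \<Lambda> \<eta> \<eta>' = gibbs_flux \<Lambda> \<eta>' \<eta>"
  unfolding flux_def by (rule balancedD[OF balanced_gibbs gibbs_prob])

lemma sum_gibbs_flux_le:
  assumes "\<Lambda> \<in> volumes"
  shows "(\<Sum>\<eta>'\<in>patterns \<Lambda>. gibbs_flux \<Lambda> \<eta> \<eta>') \<le> site_rate * card \<Lambda> * measure \<mu> (cyl \<Lambda> \<eta>)"
proof -
  have fin: "finite \<Lambda>" using assms by (simp add: volumes_iff)
  have "(\<Sum>\<eta>'\<in>patterns \<Lambda>. gibbs_flux \<Lambda> \<eta> \<eta>') = (\<integral>\<omega>. total_rate \<Lambda> \<omega> * indicator (cyl \<Lambda> \<eta>) \<omega> \<partial>\<mu>)"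
    by (rule sum_flux_out[OF state_integral[OF gibbs_prob] fin])
  also have "\<dots> \<le> (\<integral>\<omega>. (site_rate * card \<Lambda>) * indicator (cyl \<Lambda> \<eta>) \<omega> \<partial>\<mu>)"
    by (rule state.mono[OF state_integral[OF gibbs_prob]])
      (use total_rate_le[OF fin] in \<open>auto intro!: continuous_intros fin split: split_indicator\<close>)
  also have "\<dots> = site_rate * card \<Lambda> * measure \<mu> (cyl \<Lambda> \<eta>)"
    using integral_indicator_cyl[OF gibbs_prob fin] by simp
  finally show ?thesis .
qed

lemma entropy_rate_flux:
  assumes E: "state E" and \<Lambda>: "\<Lambda> \<in> volumes" and pos: "\<And>\<eta>. E (indicator (cyl \<Lambda> \<eta>)) > 0"
  defines "f \<equiv> \<lambda>\<eta>. E (indicator (cyl \<Lambda> \<eta>)) / measure \<mu> (cyl \<Lambda> \<eta>)"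
  shows "entropy_rate E \<Lambda> = (\<Sum>(\<eta>, \<eta>')\<in>patterns \<Lambda> \<times> patterns \<Lambda>. flux E \<Lambda> \<eta> \<eta>' * (ln (f \<eta>') - ln (f \<eta>)))"
proof -
  have fin: "finite \<Lambda>" using \<Lambda> by (simp add: volumes_iff)
  let ?P = "patterns \<Lambda> :: ('d, 'q) config set"
  have "entropy_rate E \<Lambda> = (\<Sum>\<eta>\<in>?P. \<Sum>\<eta>'\<in>?P. flux E \<Lambda> \<eta>' \<eta> * ln (f \<eta>)) - (\<Sum>\<eta>\<in>?P. \<Sum>\<eta>'\<in>?P. flux E \<Lambda> \<eta> \<eta>' * ln (f \<eta>))"
    unfolding entropy_rate_def state_generator_indicator[OF E fin] f_def
    by (simp add: sum_distrib_right left_diff_distrib sum_subtractf)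
  also have "(\<Sum>\<eta>\<in>?P. \<Sum>\<eta>'\<in>?P. flux E \<Lambda> \<eta>' \<eta> * ln (f \<eta>)) = (\<Sum>\<eta>\<in>?P. \<Sum>\<eta>'\<in>?P. flux E \<Lambda> \<eta> \<eta>' * ln (f \<eta>'))"
    by (rule sum.swap)
  also have "\<dots> - (\<Sum>\<eta>\<in>?P. \<Sum>\<eta>'\<in>?P. flux E \<Lambda> \<eta> \<eta>' * ln (f \<eta>)) = (\<Sum>\<eta>\<in>?P. \<Sum>\<eta>'\<in>?P. flux E \<Lambda> \<eta> \<eta>' * (ln (f \<eta>') - ln (f \<eta>)))"
    by (simp add: sum_subtractf right_diff_distrib)
  finally show ?thesis by (simp add: sum.cartesian_product)
qed

section \<open>Exchanges in the interior and near the boundary\<close>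

definition rates_comparable :: "nat \<Rightarrow> real \<Rightarrow> bool" where
  "rates_comparable r a \<longleftrightarrow> (\<forall>x. \<forall>\<tau>\<in>transitions {x}. \<forall>\<omega>. \<forall>\<omega>'\<in>cyl (translate x (lattice_box r)) \<omega>.
    rate \<tau> \<omega>' \<le> a * rate \<tau> \<omega>)"

text \<open>A move from \<eta> to \<eta>' must touch x, where they differ. Up to the factor a its
  rate is fixed by the spins in the box of radius r around x, and these are all visible in the large
  box.\<close>

lemma inflow_relative_continuity:
  assumes r: "rates_comparable r a"
    and n: "r \<le> n" and x: "x \<in> lattice_box (n - r)" "\<eta> x \<noteq> \<eta>' x"
    and \<omega>: "\<omega> \<in> cyl (lattice_box n) \<eta>" "\<omega>' \<in> cyl (lattice_box n) \<eta>"
  shows "inflow (lattice_box n) \<eta>' \<omega>' \<le> a * inflow (lattice_box n) \<eta>' \<omega>"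
proof -
  let ?\<Lambda> = "lattice_box n :: 'd site set"
  have sub: "translate x (lattice_box r) \<subseteq> ?\<Lambda>"
  proof
    fix y assume "y \<in> translate x (lattice_box r)"
    then have "y - x \<in> lattice_box r" by (simp add: mem_translate_iff)
    from lattice_box_add[OF this x(1)] show "y \<in> ?\<Lambda>" using n by simp
  qed
  have x\<Lambda>: "{x} \<subseteq> ?\<Lambda>" using x(1) lattice_box_mono[of "n - r" n] by auto
  have eq: "inflow ?\<Lambda> \<eta>' \<xi> = (\<Sum>\<tau>\<in>transitions {x}. rate \<tau> \<xi> * indicator (cyl ?\<Lambda> \<eta>') (move \<tau> \<xi>))"
    if "\<xi> \<in> cyl ?\<Lambda> \<eta>" for \<xi>
    by (rule inflow_restrict_sites[OF _ x\<Lambda> that]) (use x in auto)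
  have near: "\<omega>' \<in> cyl ?\<Lambda> \<omega>" using \<omega> by (auto simp: cyl_def)
  show ?thesis
    unfolding eq[OF \<omega>(1)] eq[OF \<omega>(2)] sum_distrib_left
  proof (rule sum_mono)
    fix \<tau> assume \<tau>: "\<tau> \<in> transitions {x}"
    have "rate \<tau> \<omega>' \<le> a * rate \<tau> \<omega>" using r \<tau> near cyl_mono[OF sub] unfolding rates_comparable_def by blast
    moreover have "indicator (cyl ?\<Lambda> \<eta>') (move \<tau> \<omega>') = (indicator (cyl ?\<Lambda> \<eta>') (move \<tau> \<omega>) :: real)"
    proof -
      have "move \<tau> \<omega>' \<in> cyl ?\<Lambda> (move \<tau> \<omega>)" by (rule move_cyl_cong[OF near])
      then show ?thesis by (auto simp: indicator_def cyl_def)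
    qed
    ultimately show "rate \<tau> \<omega>' * indicator (cyl ?\<Lambda> \<eta>') (move \<tau> \<omega>') \<le> a * (rate \<tau> \<omega> * indicator (cyl ?\<Lambda> \<eta>') (move \<tau> \<omega>))"
      by (auto split: split_indicator)
  qed
qed

text \<open>For each state, the flux divided by the mass of the cylinder of \<eta> is an average of
  the inflow over that cylinder and lies within a factor a of the inflow at \<eta>. Two such
  quotients differ by a factor of at most \<open>a\<^sup>2\<close>.\<close>

lemma flux_comparison:
  assumes r: "rates_comparable r a"
    and n: "r \<le> n" and x: "x \<in> lattice_box (n - r)" "\<eta> x \<noteq> \<eta>' x"
    and E: "state E" "state E'" and a: "0 < a"
  shows "flux E (lattice_box n) \<eta> \<eta>' * E' (indicator (cyl (lattice_box n) \<eta>))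
    \<le> a\<^sup>2 * (flux E' (lattice_box n) \<eta> \<eta>' * E (indicator (cyl (lattice_box n) \<eta>)))"
proof -
  let ?\<Lambda> = "lattice_box n :: 'd site set" and ?k = "inflow (lattice_box n) \<eta>' \<eta>"
  let ?e = "E (indicator (cyl ?\<Lambda> \<eta>))" and ?e' = "E' (indicator (cyl ?\<Lambda> \<eta>))"
  have nn: "0 \<le> ?e" "0 \<le> ?e'"
    by (intro state.nonneg[OF E(1)] state.nonneg[OF E(2)] continuous_on_indicator_cyl finite_lattice_box; simp)+
  have "flux E ?\<Lambda> \<eta> \<eta>' \<le> (a * ?k) * ?e"
    by (rule flux_bounds[OF E(1)]) (use inflow_relative_continuity[where x = x and \<eta> = \<eta> and \<eta>' = \<eta>', OF r n x(1) x(2)] in auto)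
  then have 1: "flux E ?\<Lambda> \<eta> \<eta>' * ?e' \<le> (a * ?k) * ?e * ?e'" using nn by (intro mult_right_mono)
  have "(?k / a) * ?e' \<le> flux E' ?\<Lambda> \<eta> \<eta>'"
  proof (rule flux_lower[OF E(2)])
    fix \<omega> assume "\<omega> \<in> cyl ?\<Lambda> \<eta>"
    then have "?k \<le> a * inflow ?\<Lambda> \<eta>' \<omega>" using inflow_relative_continuity[where x = x and \<eta> = \<eta> and \<eta>' = \<eta>', OF r n x(1) x(2)] by auto
    then show "?k / a \<le> inflow ?\<Lambda> \<eta>' \<omega>" using a by (simp add: pos_divide_le_eq mult.commute)
  qed simp
  then have "a\<^sup>2 * ((?k / a) * ?e') * ?e \<le> a\<^sup>2 * flux E' ?\<Lambda> \<eta> \<eta>' * ?e" using nn by (intro mult_right_mono mult_left_mono) auto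
  moreover have "(a * ?k) * ?e * ?e' = a\<^sup>2 * ((?k / a) * ?e') * ?e"
    using a by (simp add: power2_eq_square)
  ultimately show ?thesis using 1 by (simp only: mult.assoc)
qed

text \<open>The logarithmic bound leaves the density of the target, weighted with the \<mu>-mass of
  the source. Non-nullness exchanges this for the \<mu>-mass of the target, as one move changes few
  sites. The masses of the targets sum to 1 and each transition has boundedly many sources, so only
  the number of boundary sites remains.\<close>

lemma boundary_flux_bound:
  assumes E: "state E" and \<Lambda>: "\<Lambda> \<in> volumes" and pos: "\<And>\<eta>. E (indicator (cyl \<Lambda> \<eta>)) > 0" and \<Lambda>0: "\<Lambda>0 \<subseteq> \<Lambda>"
  defines "f \<equiv> \<lambda>\<eta>. E (indicator (cyl \<Lambda> \<eta>)) / measure \<mu> (cyl \<Lambda> \<eta>)"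
  defines "B \<equiv> {(\<eta>, \<eta>'). \<eta> \<in> patterns \<Lambda> \<and> \<eta>' \<in> patterns \<Lambda> \<and> (\<forall>x\<in>\<Lambda>0. \<eta> x = \<eta>' x)}"
  shows "(\<Sum>(\<eta>, \<eta>')\<in>B. flux E \<Lambda> \<eta> \<eta>' * (ln (f \<eta>') - ln (f \<eta>)))
    \<le> site_rate * real (CARD('q discrete)) ^ size_bound / nonnull_bound ^ size_bound * card (\<Lambda> - \<Lambda>0)"
proof -
  have fin: "finite \<Lambda>" using \<Lambda> by (simp add: volumes_iff)
  let ?e = "\<lambda>\<eta>. E (indicator (cyl \<Lambda> \<eta>))"
  let ?T = "transitions (\<Lambda> - \<Lambda>0)" and ?P = "patterns \<Lambda> :: ('d, 'q) config set"
  let ?\<delta> = "nonnull_bound ^ size_bound" and ?Q = "real (CARD('q discrete)) ^ size_bound"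
  have \<delta>: "?\<delta> > 0" using nonnull_bound(1) by simp
  have finT: "finite ?T" using fin by simp
  have finP: "finite ?P" using fin by simp
  have \<mu>: "measure \<mu> (cyl \<Lambda> \<eta>) > 0" for \<eta> by (rule gibbs_cyl_pos[OF gibbs \<Lambda>])
  have fpos: "f \<eta> > 0" for \<eta> unfolding f_def using pos \<mu> by simp
  \<comment> \<open>A bound for the rate from \<eta> to \<eta>' by moves touching the boundary
    layer, free of spins outside the box.\<close>
  define k where "k \<eta> \<eta>' = (\<Sum>\<tau>\<in>?T. rate_bound * indicator (cyl \<Lambda> \<eta>') (move \<tau> \<eta>))" for \<eta> \<eta>'
  have k0: "0 \<le> k \<eta> \<eta>'" for \<eta> \<eta>' unfolding k_def using rate_bound(1) by (intro sum_nonneg) auto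
  have pair: "flux E \<Lambda> \<eta> \<eta>' * (ln (f \<eta>') - ln (f \<eta>)) \<le> k \<eta> \<eta>' * (?e \<eta>' / ?\<delta>)" if p: "(\<eta>, \<eta>') \<in> B" for \<eta> \<eta>'
  \<comment> \<open>If the density does not grow along the exchange, the term is at most 0 and needs
    no estimate.\<close>
  proof (cases "\<eta> = \<eta>' \<or> f \<eta>' < f \<eta>")
    case True
    have "0 \<le> k \<eta> \<eta>' * (?e \<eta>' / ?\<delta>)" using k0 pos[of \<eta>'] \<delta> by simp
    moreover have "flux E \<Lambda> \<eta> \<eta>' * (ln (f \<eta>') - ln (f \<eta>)) \<le> 0"
      using True flux_nonneg[OF E fin, of \<eta> \<eta>'] fpos[of \<eta>] fpos[of \<eta>'] by (auto intro: mult_nonneg_nonpos)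
    ultimately show ?thesis by linarith
  next
    case False
    then have le: "f \<eta> \<le> f \<eta>'" and "\<eta> \<noteq> \<eta>'" by auto
    then obtain x where x: "x \<in> \<Lambda>" "\<eta> x \<noteq> \<eta>' x" using p patterns_eqI[of \<eta> \<Lambda> \<eta>'] by (auto simp: B_def)
    then have x': "\<exists>x\<in>\<Lambda> - \<Lambda>0. \<eta> x \<noteq> \<eta>' x" using p by (auto simp: B_def)
    have "inflow \<Lambda> \<eta>' \<omega> \<le> k \<eta> \<eta>'" if \<omega>: "\<omega> \<in> cyl \<Lambda> \<eta>" for \<omega>
      unfolding inflow_restrict_sites[OF fin Diff_subset \<omega> x'] k_def
    proof (rule sum_mono)
      fix \<tau> assume \<tau>: "\<tau> \<in> ?T"
      have "move \<tau> \<omega> \<in> cyl \<Lambda> (move \<tau> \<eta>)" by (rule move_cyl_cong[OF \<omega>])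
      then have "indicator (cyl \<Lambda> \<eta>') (move \<tau> \<omega>) = (indicator (cyl \<Lambda> \<eta>') (move \<tau> \<eta>) :: real)"
        by (auto simp: indicator_def cyl_def)
      then show "rate \<tau> \<omega> * indicator (cyl \<Lambda> \<eta>') (move \<tau> \<omega>) \<le> rate_bound * indicator (cyl \<Lambda> \<eta>') (move \<tau> \<eta>)"
        using rate_bound(2)[OF \<tau>, of \<omega>] by (auto split: split_indicator)
    qed
    then have fl: "flux E \<Lambda> \<eta> \<eta>' \<le> k \<eta> \<eta>' * ?e \<eta>" by (rule flux_bounds[OF E fin])
    show ?thesis
    proof (cases "k \<eta> \<eta>' = 0")
      case True
      then have "flux E \<Lambda> \<eta> \<eta>' = 0" using fl flux_nonneg[OF E fin, of \<eta> \<eta>'] by simp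
      then show ?thesis using True by simp
    next
      case False
      then obtain \<tau> where \<tau>: "\<tau> \<in> ?T" "move \<tau> \<eta> \<in> cyl \<Lambda> \<eta>'"
        unfolding k_def by (metis (no_types, lifting) indicator_simps(2) mult_zero_right sum.neutral)
      let ?S = "fst \<tau> \<inter> \<Lambda>"
      have "card ?S \<le> card (fst \<tau>)" using transitionsD(5)[OF \<tau>(1)] by (intro card_mono) auto
      then have "card ?S \<le> size_bound" using size_bound(2)[OF \<tau>(1)] by simp
      then have "?\<delta> \<le> nonnull_bound ^ card ?S"
        using nonnull_bound(1) nonnull_bound_le_1 by (intro power_decreasing) auto
      then have "?\<delta> * measure \<mu> (cyl \<Lambda> \<eta>) \<le> nonnull_bound ^ card ?S * measure \<mu> (cyl \<Lambda> \<eta>)"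
        by (rule mult_right_mono) simp
      also have "\<dots> \<le> measure \<mu> (cyl \<Lambda> \<eta>')"
      proof (rule gibbs_cyl_ratio[OF gibbs \<Lambda>])
        have "\<eta> y = \<eta>' y" if "y \<in> \<Lambda> - ?S" for y
          using \<tau>(2) that by (auto simp: cyl_def move_def dest!: bspec[of _ _ y])
        then show "\<eta> \<in> cyl (\<Lambda> - ?S) \<eta>'" unfolding cyl_def by blast
      qed auto
      finally have ratio: "measure \<mu> (cyl \<Lambda> \<eta>) \<le> measure \<mu> (cyl \<Lambda> \<eta>') / ?\<delta>"
        using \<delta> by (simp add: pos_le_divide_eq mult.commute)
      have "ln (f \<eta>') - ln (f \<eta>) = ln (f \<eta>' / f \<eta>)" using fpos[of \<eta>] fpos[of \<eta>'] by (simp add: ln_div)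
      also have "\<dots> \<le> f \<eta>' / f \<eta> - 1" using fpos by (intro ln_le_minus_one) simp
      also have "\<dots> \<le> f \<eta>' / f \<eta>" by simp
      finally have l: "ln (f \<eta>') - ln (f \<eta>) \<le> f \<eta>' / f \<eta>" .
      have "flux E \<Lambda> \<eta> \<eta>' * (ln (f \<eta>') - ln (f \<eta>)) \<le> (k \<eta> \<eta>' * ?e \<eta>) * (f \<eta>' / f \<eta>)"
        using fl l le fpos[of \<eta>] k0 pos[of \<eta>] by (intro mult_mono) auto
      also have "\<dots> = k \<eta> \<eta>' * (f \<eta>' * measure \<mu> (cyl \<Lambda> \<eta>))"
        unfolding f_def using pos[of \<eta>] \<mu>[of \<eta>] by simp
      also have "\<dots> \<le> k \<eta> \<eta>' * (f \<eta>' * (measure \<mu> (cyl \<Lambda> \<eta>') / ?\<delta>))"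
        using ratio k0 fpos[of \<eta>'] by (intro mult_left_mono) auto
      also have "\<dots> = k \<eta> \<eta>' * (?e \<eta>' / ?\<delta>)"
        unfolding f_def using \<mu>[of \<eta>'] by simp
      finally show ?thesis .
    qed
  qed
  have sum_k: "(\<Sum>\<eta>\<in>?P. k \<eta> \<eta>') \<le> site_rate * card (\<Lambda> - \<Lambda>0) * ?Q" for \<eta>'
  proof -
    \<comment> \<open>The sources from which the move \<tau> reaches \<eta>' agree with \<eta>' off
      \<open>fst \<tau>\<close>, so only their spins on \<open>fst \<tau>\<close> are free.\<close>
    have cardle: "(\<Sum>\<eta>\<in>?P. indicator (cyl \<Lambda> \<eta>') (move \<tau> \<eta>)) \<le> ?Q" if \<tau>: "\<tau> \<in> ?T" for \<tau>
    proof -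
      let ?A = "{\<eta>\<in>?P. move \<tau> \<eta> \<in> cyl \<Lambda> \<eta>'}"
      have "(\<Sum>\<eta>\<in>?P. indicator (cyl \<Lambda> \<eta>') (move \<tau> \<eta>)) = (\<Sum>\<eta>\<in>?A. 1 :: real)"
        using finP by (intro sum.mono_neutral_cong_right) auto
      also have "\<dots> = card ?A" by simp
      also have "card ?A \<le> card (patterns (fst \<tau>) :: ('d, 'q) config set)"
      proof (rule card_inj_on_le[of "\<lambda>\<eta>. restrict \<eta> (fst \<tau>)"])
        show "inj_on (\<lambda>\<eta>. restrict \<eta> (fst \<tau>)) ?A"
        proof (rule inj_onI)
          fix \<eta>1 \<eta>2 assume 1: "\<eta>1 \<in> ?A" and 2: "\<eta>2 \<in> ?A" and eq: "restrict \<eta>1 (fst \<tau>) = restrict \<eta>2 (fst \<tau>)"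
          show "\<eta>1 = \<eta>2"
          proof (rule patterns_eqI[of _ \<Lambda>])
            fix y assume y: "y \<in> \<Lambda>"
            show "\<eta>1 y = \<eta>2 y"
            proof (cases "y \<in> fst \<tau>")
              case True
              then show ?thesis using fun_cong[OF eq, of y] by simp
            next
              case False
              then have "move \<tau> \<eta>1 y = \<eta>1 y" "move \<tau> \<eta>2 y = \<eta>2 y" by (simp_all add: move_def)
              moreover have "move \<tau> \<eta>1 y = \<eta>' y" "move \<tau> \<eta>2 y = \<eta>' y"
                using 1 2 y by (simp_all add: cyl_def)
              ultimately show ?thesis by simp
            qed
          qed (use 1 2 in auto)
        qed
        show "finite (patterns (fst \<tau>) :: ('d, 'q) config set)" using transitionsD(5)[OF \<tau>] by simp
      qed auto
      also have "\<dots> = CARD('q discrete) ^ card (fst \<tau>)" by (rule card_patterns[OF transitionsD(5)[OF \<tau>]])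
      also have "\<dots> \<le> CARD('q discrete) ^ size_bound"
        by (rule power_increasing[OF size_bound(2)[OF \<tau>]]) (simp add: Suc_leI)
      finally show ?thesis by simp
    qed
    have "(\<Sum>\<eta>\<in>?P. k \<eta> \<eta>') = (\<Sum>\<tau>\<in>?T. rate_bound * (\<Sum>\<eta>\<in>?P. indicator (cyl \<Lambda> \<eta>') (move \<tau> \<eta>)))"
      unfolding k_def by (subst sum.swap) (simp only: sum_distrib_left)
    also have "\<dots> \<le> (\<Sum>\<tau>\<in>?T. rate_bound * ?Q)"
      by (intro sum_mono mult_left_mono cardle rate_bound)
    also have "\<dots> = (rate_bound * card ?T) * ?Q" by simp
    also have "\<dots> \<le> (site_rate * card (\<Lambda> - \<Lambda>0)) * ?Q"
      by (intro mult_right_mono card_transitions_le) (use fin in auto)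
    finally show ?thesis .
  qed
  have sum_e: "(\<Sum>\<eta>\<in>?P. ?e \<eta>) = 1" by (rule state.sum_cyl[OF E fin])
  have "(\<Sum>(\<eta>, \<eta>')\<in>B. flux E \<Lambda> \<eta> \<eta>' * (ln (f \<eta>') - ln (f \<eta>))) \<le> (\<Sum>(\<eta>, \<eta>')\<in>B. k \<eta> \<eta>' * (?e \<eta>' / ?\<delta>))"
    by (rule sum_mono) (use pair in auto)
  also have "\<dots> \<le> (\<Sum>(\<eta>, \<eta>')\<in>?P \<times> ?P. k \<eta> \<eta>' * (?e \<eta>' / ?\<delta>))"
    by (rule sum_mono2) (use finP k0 \<delta> pos in \<open>auto simp: B_def less_imp_le\<close>)
  also have "\<dots> = (\<Sum>\<eta>'\<in>?P. (\<Sum>\<eta>\<in>?P. k \<eta> \<eta>') * (?e \<eta>' / ?\<delta>))"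
    by (subst sum.cartesian_product[symmetric], subst sum.swap) (simp only: sum_distrib_right)
  also have "\<dots> \<le> (\<Sum>\<eta>'\<in>?P. (site_rate * card (\<Lambda> - \<Lambda>0) * ?Q) * (?e \<eta>' / ?\<delta>))"
    by (intro sum_mono mult_right_mono sum_k) (use pos \<delta> in \<open>auto simp: less_imp_le\<close>)
  also have "\<dots> = (site_rate * card (\<Lambda> - \<Lambda>0) * ?Q) * ((\<Sum>\<eta>'\<in>?P. ?e \<eta>') / ?\<delta>)"
    by (simp only: sum_distrib_left sum_divide_distrib)
  also have "\<dots> = site_rate * ?Q / ?\<delta> * card (\<Lambda> - \<Lambda>0)"
    by (simp add: sum_e)
  finally show ?thesis .
qed

text \<open>Pairs are split by whether they differ in the box shrunk by r, the radius in
  \<open>rates_comparable\<close>; shrinking by w as well leaves room for the translates of W. The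
  value of \<alpha> is the factor lost in \<open>flux_comparison\<close>.\<close>

lemma entropy_rate_bound:
  fixes E :: "(('d, 'q) config \<Rightarrow> real) \<Rightarrow> real"
  assumes E: "state E" and inv: "\<And>f i. continuous_on UNIV f \<Longrightarrow> E (\<lambda>\<omega>. f (shift i \<omega>)) = E f"
    and pos: "\<And>\<eta>. E (indicator (cyl (lattice_box n) \<eta>)) > 0"
    and r: "rates_comparable r a"
    and a: "1 \<le> a" and n: "r + w \<le> n" and W: "W \<subseteq> lattice_box w" "\<exists>x\<in>W. \<zeta> x \<noteq> \<zeta>' x" and s: "0 \<le> s"
  defines "\<alpha> \<equiv> 1 / a\<^sup>2"
  shows "entropy_rate E (lattice_box n)
    \<le> - (\<alpha> * s / 2) * (card (lattice_box (n - r - w) :: 'd site set) * \<bar>E (current W \<zeta> \<zeta>')\<bar> / (size_bound * card W))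
      + (s * (1 - \<alpha>) + \<alpha> * s\<^sup>2 + 1 / \<alpha> - \<alpha>) * (site_rate * card (lattice_box n :: 'd site set))
      + site_rate * real (CARD('q discrete)) ^ size_bound / nonnull_bound ^ size_bound
        * card (lattice_box n - lattice_box (n - r) :: 'd site set)"
proof -
  let ?\<Lambda> = "lattice_box n :: 'd site set" and ?I = "lattice_box (n - r) :: 'd site set"
  let ?P = "patterns (lattice_box n) :: ('d, 'q) config set" and ?\<mu> = "\<lambda>\<eta>. measure \<mu> (cyl (lattice_box n) \<eta>)"
  let ?E\<mu> = "\<lambda>f. \<integral>\<omega>. f \<omega> \<partial>\<mu>" and ?e = "\<lambda>\<eta>. E (indicator (cyl (lattice_box n) \<eta>))"
  define f where "f \<eta> = ?e \<eta> / ?\<mu> \<eta>" for \<eta>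
  define G where "G = {(\<eta>, \<eta>'). \<eta> \<in> ?P \<and> \<eta>' \<in> ?P \<and> (\<exists>x\<in>?I. \<eta> x \<noteq> \<eta>' x)}"
  define B where "B = {(\<eta>, \<eta>'). \<eta> \<in> ?P \<and> \<eta>' \<in> ?P \<and> (\<forall>x\<in>?I. \<eta> x = \<eta>' x)}"
  have finP: "finite ?P" by simp
  have finW: "finite W" by (rule finite_subset[OF W(1) finite_lattice_box])
  have cW: "0 < card W" using W(2) finW by (auto simp: card_gt_0_iff)
  have GB: "?P \<times> ?P = G \<union> B" "G \<inter> B = {}" by (auto simp: G_def B_def)
  have finG: "finite G" "finite B" by (rule finite_subset[OF _ finite_cartesian_product[OF finP finP]], unfold GB(1), blast)+
  have sub: "?I \<subseteq> ?\<Lambda>" by (rule lattice_box_mono) simp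
  have \<mu>pos: "?\<mu> \<eta> > 0" for \<eta> by (rule gibbs_cyl_pos[OF gibbs lattice_box_in_volumes])
  have fpos: "f \<eta> > 0" for \<eta> unfolding f_def using pos \<mu>pos by simp
  have \<alpha>: "0 < \<alpha>" "\<alpha> \<le> 1" unfolding \<alpha>_def using a by (simp_all add: power_le_one_iff)
  have a0: "0 < a" using a by simp
  have e\<mu>: "?E\<mu> (indicator (cyl ?\<Lambda> \<eta>)) = ?\<mu> \<eta>" for \<eta>
    by (rule integral_indicator_cyl[OF gibbs_prob finite_lattice_box])
  have mnn: "0 \<le> gibbs_flux ?\<Lambda> \<eta> \<eta>'" for \<eta> \<eta>' by (rule flux_nonneg[OF state_integral[OF gibbs_prob] finite_lattice_box])
  have cmp: "\<alpha> * (f \<eta> * gibbs_flux ?\<Lambda> \<eta> \<eta>') \<le> flux E ?\<Lambda> \<eta> \<eta>'" "\<alpha> * flux E ?\<Lambda> \<eta> \<eta>' \<le> f \<eta> * gibbs_flux ?\<Lambda> \<eta> \<eta>'"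
    if G: "(\<eta>, \<eta>') \<in> G" for \<eta> \<eta>'
  proof -
    obtain x where x: "x \<in> ?I" "\<eta> x \<noteq> \<eta>' x" using G by (auto simp: G_def)
    have rn: "r \<le> n" using n by simp
    have 1: "flux E ?\<Lambda> \<eta> \<eta>' * ?\<mu> \<eta> \<le> a\<^sup>2 * (gibbs_flux ?\<Lambda> \<eta> \<eta>' * ?e \<eta>)"
      using flux_comparison[where x = x and \<eta> = \<eta> and \<eta>' = \<eta>', OF r rn x(1) x(2) E state_integral[OF gibbs_prob] a0] e\<mu> by simp
    have 2: "gibbs_flux ?\<Lambda> \<eta> \<eta>' * ?e \<eta> \<le> a\<^sup>2 * (flux E ?\<Lambda> \<eta> \<eta>' * ?\<mu> \<eta>)"
      using flux_comparison[where x = x and \<eta> = \<eta> and \<eta>' = \<eta>', OF r rn x(1) x(2) state_integral[OF gibbs_prob] E a0] e\<mu> by simp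
    show "\<alpha> * (f \<eta> * gibbs_flux ?\<Lambda> \<eta> \<eta>') \<le> flux E ?\<Lambda> \<eta> \<eta>'"
      using 2 \<mu>pos[of \<eta>] a0 by (simp add: f_def \<alpha>_def field_simps)
    show "\<alpha> * flux E ?\<Lambda> \<eta> \<eta>' \<le> f \<eta> * gibbs_flux ?\<Lambda> \<eta> \<eta>'"
      using 1 \<mu>pos[of \<eta>] a0 by (simp add: f_def \<alpha>_def field_simps)
  qed
  \<comment> \<open>By symmetry of the Gibbs fluxes the sum over sources is the outflow of the
    target cylinder, bounded by its \<mu>-mass; the density turns this into mass of E, of total
    1.\<close>
  have Bnd: "(\<Sum>(\<eta>, \<eta>')\<in>G. gibbs_flux ?\<Lambda> \<eta> \<eta>' * f \<eta>') \<le> site_rate * card ?\<Lambda>"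
  proof -
    have "(\<Sum>(\<eta>, \<eta>')\<in>G. gibbs_flux ?\<Lambda> \<eta> \<eta>' * f \<eta>') \<le> (\<Sum>(\<eta>, \<eta>')\<in>?P \<times> ?P. gibbs_flux ?\<Lambda> \<eta> \<eta>' * f \<eta>')"
      by (rule sum_mono2) (use finP finG GB mnn fpos in \<open>auto simp: less_imp_le\<close>)
    also have "\<dots> = (\<Sum>\<eta>'\<in>?P. \<Sum>\<eta>\<in>?P. gibbs_flux ?\<Lambda> \<eta>' \<eta> * f \<eta>')"
      by (subst sum.cartesian_product[symmetric], subst sum.swap, intro sum.cong refl,
          subst gibbs_flux_sym[OF lattice_box_in_volumes], rule refl)
    also have "\<dots> = (\<Sum>\<eta>'\<in>?P. (\<Sum>\<eta>\<in>?P. gibbs_flux ?\<Lambda> \<eta>' \<eta>) * f \<eta>')" by (simp only: sum_distrib_right)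
    also have "\<dots> \<le> (\<Sum>\<eta>'\<in>?P. (site_rate * card ?\<Lambda> * ?\<mu> \<eta>') * f \<eta>')"
      by (intro sum_mono mult_right_mono sum_gibbs_flux_le lattice_box_in_volumes) (use fpos in \<open>auto simp: less_imp_le\<close>)
    also have "\<dots> = (\<Sum>\<eta>'\<in>?P. (site_rate * card ?\<Lambda>) * ?e \<eta>')"
      unfolding f_def using \<mu>pos by (simp add: less_imp_neq[symmetric] mult.assoc)
    also have "\<dots> = site_rate * card ?\<Lambda> * (\<Sum>\<eta>'\<in>?P. ?e \<eta>')" by (simp only: sum_distrib_left)
    also have "(\<Sum>\<eta>'\<in>?P. ?e \<eta>') = 1" by (rule state.sum_cyl[OF E finite_lattice_box])
    finally show ?thesis by simp
  qed
  let ?X = "\<Sum>(\<eta>, \<eta>')\<in>G. \<bar>flux E ?\<Lambda> \<eta> \<eta>' - flux E ?\<Lambda> \<eta>' \<eta>\<bar>"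
  have win: "card (lattice_box (n - r - w) :: 'd site set) * \<bar>E (current W \<zeta> \<zeta>')\<bar> \<le> size_bound * card W * ?X"
  proof (rule current_window_bound[OF E inv finite_lattice_box finW W(2) _ sub finite_lattice_box G_def])
    fix i :: "'d site" assume i: "i \<in> lattice_box (n - r - w)"
    show "translate i W \<subseteq> ?I"
    proof
      fix y assume "y \<in> translate i W"
      then have "y - i \<in> lattice_box w" using W(1) by (auto simp: mem_translate_iff)
      from lattice_box_add[OF this i] show "y \<in> ?I" using n by (simp add: diff_diff_left)
    qed
  qed
  then have X: "card (lattice_box (n - r - w) :: 'd site set) * \<bar>E (current W \<zeta> \<zeta>')\<bar> / (size_bound * card W) \<le> ?X"
    using size_bound(1) cW by (simp add: pos_divide_le_eq mult.commute)
  have good: "(\<Sum>(\<eta>, \<eta>')\<in>G. flux E ?\<Lambda> \<eta> \<eta>' * (ln (f \<eta>') - ln (f \<eta>)))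
    \<le> - (\<alpha> * s / 2) * ?X + (s * (1 - \<alpha>) + \<alpha> * s\<^sup>2 + 1 / \<alpha> - \<alpha>) * (site_rate * card ?\<Lambda>)"
  proof (rule entropy_dissipation_bound[OF finG(1) _ fpos mnn gibbs_flux_sym[OF lattice_box_in_volumes] \<alpha> cmp Bnd s])
    show "(y, x) \<in> G" if "(x, y) \<in> G" for x y using that by (auto simp: G_def) metis
  qed auto
  have "- (\<alpha> * s / 2) * ?X \<le> - (\<alpha> * s / 2) * (card (lattice_box (n - r - w) :: 'd site set) * \<bar>E (current W \<zeta> \<zeta>')\<bar> / (size_bound * card W))"
    using X \<alpha>(1) s mult_left_mono[OF X, of "\<alpha> * s / 2"] by simp
  moreover have "entropy_rate E ?\<Lambda> = (\<Sum>(\<eta>, \<eta>')\<in>G. flux E ?\<Lambda> \<eta> \<eta>' * (ln (f \<eta>') - ln (f \<eta>)))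
      + (\<Sum>(\<eta>, \<eta>')\<in>B. flux E ?\<Lambda> \<eta> \<eta>' * (ln (f \<eta>') - ln (f \<eta>)))"
    unfolding entropy_rate_flux[OF E lattice_box_in_volumes pos] GB(1) f_def
    by (rule sum.union_disjoint[OF finG GB(2)])
  ultimately show ?thesis
    using good boundary_flux_bound[OF E lattice_box_in_volumes pos sub] unfolding B_def f_def by linarith
qed

end

text \<open>Boundary layers of fixed width are a vanishing fraction of the box.\<close>

lemma lattice_box_ratio:
  "(\<lambda>n. real (card (lattice_box (n - k) :: 'd::finite site set)) / card (lattice_box n :: 'd site set)) \<longlonglongrightarrow> 1"
proof -
  have "filterlim (\<lambda>n. 2 * real n + 1) at_top sequentially"
    by (rule filterlim_at_top_mono[OF filterlim_real_sequentially]) auto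
  then have "(\<lambda>n. 2 * real k / (2 * real n + 1)) \<longlonglongrightarrow> 0"
    by (intro tendsto_divide_0[OF tendsto_const] filterlim_at_top_imp_at_infinity)
  then have "(\<lambda>n. (1 - 2 * real k / (2 * real n + 1)) ^ CARD('d)) \<longlonglongrightarrow> (1 - 0) ^ CARD('d)"
    by (intro tendsto_intros)
  moreover have "\<forall>\<^sub>F n in sequentially. (1 - 2 * real k / (2 * real n + 1)) ^ CARD('d)
      = real (card (lattice_box (n - k) :: 'd site set)) / card (lattice_box n :: 'd site set)"
    using eventually_ge_at_top[of k]
  proof eventually_elim
    case (elim n)
    have "1 - 2 * real k / (2 * real n + 1) = (2 * real (n - k) + 1) / (2 * real n + 1)"
      using elim by (simp add: of_nat_diff field_simps)
    then show ?case by (simp add: card_lattice_box power_divide add.commute)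
  qed
  ultimately show ?thesis by (simp add: Lim_transform_eventually)
qed

section \<open>Choice of the box and of the constants\<close>

context reversible_gibbs_system
begin

text \<open>The order of quantifiers is what matters: \<open>c0\<close> is fixed before the
  tolerance e, and the box found for e serves all admissible states at once.\<close>

lemma entropy_decay:
  assumes W: "finite W" "\<exists>x\<in>W. \<zeta> x \<noteq> \<zeta>' x" and j: "j > 0"
  shows "\<exists>c0::real. 0 < c0 \<and> (\<forall>e::real. 0 < e \<longrightarrow> (\<exists>n. \<forall>E. state E \<longrightarrow>
    (\<forall>f i. continuous_on UNIV f \<longrightarrow> E (\<lambda>\<omega>. f (shift i \<omega>)) = E f) \<longrightarrow>
    (\<forall>\<eta>. E (indicator (cyl (lattice_box n) \<eta>)) > 0) \<longrightarrow>
    entropy_rate E (lattice_box n) \<le> e * card (lattice_box n :: 'd site set) \<and>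
    (j \<le> \<bar>E (current W \<zeta> \<zeta>')\<bar> \<longrightarrow> entropy_rate E (lattice_box n) \<le> (e - c0) * card (lattice_box n :: 'd site set))))"
proof -
  define D where "D = real size_bound * card W"
  have D: "D > 0"
  proof -
    have "0 < card W" using W by (auto simp: card_gt_0_iff)
    then show ?thesis unfolding D_def using size_bound(1) by simp
  qed
  define R where "R = site_rate"
  have R: "R \<ge> 0" unfolding R_def by (rule site_rate_nonneg)
  define K where "K = site_rate * real (CARD('q discrete)) ^ size_bound / nonnull_bound ^ size_bound"
  have K: "K \<ge> 0" unfolding K_def using site_rate_nonneg nonnull_bound(1) by simp
  \<comment> \<open>With \<alpha> above 1/2 and more than half of the translates available, the
    linear gain is at least \<open>s * j / (8 * D)\<close> per site, against a quadratic cost of at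
    most \<open>s\<^sup>2 * R\<close>. This s keeps the cost below half of the gain;
    \<open>c0\<close> is the other half.\<close>
  define s where "s = j / (16 * D * (R + 1))"
  have s: "s > 0" unfolding s_def using j D R by simp
  define c0 where "c0 = s * j / (16 * D)"
  have c0: "c0 > 0" unfolding c0_def using s j D by simp
  obtain w where w: "W \<subseteq> lattice_box w" using finite_subset_lattice_box[OF W(1)] by blast
  have "\<exists>n. \<forall>E. state E \<longrightarrow>
    (\<forall>f i. continuous_on UNIV f \<longrightarrow> E (\<lambda>\<omega>. f (shift i \<omega>)) = E f) \<longrightarrow>
    (\<forall>\<eta>. E (indicator (cyl (lattice_box n) \<eta>)) > 0) \<longrightarrow>
    entropy_rate E (lattice_box n) \<le> e * card (lattice_box n :: 'd site set) \<and>
    (j \<le> \<bar>E (current W \<zeta> \<zeta>')\<bar> \<longrightarrow> entropy_rate E (lattice_box n) \<le> (e - c0) * card (lattice_box n :: 'd site set))"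
    if e: "e > 0" for e :: real
  proof -
    \<comment> \<open>As a tends to 1, the error from comparing fluxes drops below half of e per
      site; the other half is left for the boundary.\<close>
    have "((\<lambda>a::real. (s * (1 - 1 / a\<^sup>2) + a\<^sup>2 - 1 / a\<^sup>2) * R) \<longlongrightarrow> (s * (1 - 1 / 1\<^sup>2) + 1\<^sup>2 - 1 / 1\<^sup>2) * R) (at_right 1)"
      by (intro tendsto_intros) auto
    then have "\<forall>\<^sub>F a in at_right (1::real). (s * (1 - 1 / a\<^sup>2) + a\<^sup>2 - 1 / a\<^sup>2) * R < e / 2"
      by (rule order_tendstoD) (use e in simp)
    moreover have "((\<lambda>a::real. 1 / a\<^sup>2) \<longlongrightarrow> 1 / 1\<^sup>2) (at_right 1)"
      by (intro tendsto_intros) auto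
    then have "\<forall>\<^sub>F a in at_right (1::real). 1 / 2 < 1 / a\<^sup>2"
      by (rule order_tendstoD) simp
    moreover have "\<forall>\<^sub>F a in at_right (1::real). 1 < a" by (rule eventually_at_right_less)
    ultimately have "\<forall>\<^sub>F a in at_right (1::real). (s * (1 - 1 / a\<^sup>2) + a\<^sup>2 - 1 / a\<^sup>2) * R < e / 2 \<and> 1 / 2 < 1 / a\<^sup>2 \<and> 1 < a"
      by eventually_elim simp
    from eventually_happens[OF this] obtain a :: real
      where a: "(s * (1 - 1 / a\<^sup>2) + a\<^sup>2 - 1 / a\<^sup>2) * R < e / 2" "1 / 2 < 1 / a\<^sup>2" "1 < a" by auto
    obtain r where r: "rates_comparable r a"
      using rate_relative_continuity[OF a(3)] unfolding rates_comparable_def by blast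
    define \<alpha> where "\<alpha> = 1 / a\<^sup>2"
    have \<alpha>: "1 / 2 < \<alpha>" "\<alpha> \<le> 1" "1 / \<alpha> = a\<^sup>2"
      using a by (simp_all add: \<alpha>_def)
    have \<alpha>R: "(s * (1 - \<alpha>) + 1 / \<alpha> - \<alpha>) * R < e / 2" using a(1) by (simp add: \<alpha>(3)) (simp add: \<alpha>_def)
    let ?V = "\<lambda>n. real (card (lattice_box n :: 'd site set))"
    have Vpos: "?V n > 0" for n by (simp add: card_lattice_box)
    have "(\<lambda>n. K * (1 - ?V (n - r) / ?V n)) \<longlonglongrightarrow> K * (1 - 1)"
      by (intro tendsto_intros lattice_box_ratio)
    then have "\<forall>\<^sub>F n in sequentially. K * (1 - ?V (n - r) / ?V n) < e / 2"
      by (rule order_tendstoD) (use e in simp)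
    moreover have "\<forall>\<^sub>F n in sequentially. 1 / 2 < ?V (n - (r + w)) / ?V n"
      by (rule order_tendstoD(1)[OF lattice_box_ratio]) simp
    moreover have "\<forall>\<^sub>F n in sequentially. r + w \<le> n" by (rule eventually_ge_at_top)
    ultimately have "\<forall>\<^sub>F n in sequentially. K * (1 - ?V (n - r) / ?V n) < e / 2 \<and> 1 / 2 < ?V (n - (r + w)) / ?V n \<and> r + w \<le> n"
      by eventually_elim simp
    from eventually_happens[OF this] obtain n
      where n: "K * (1 - ?V (n - r) / ?V n) < e / 2" "1 / 2 < ?V (n - (r + w)) / ?V n" "r + w \<le> n" by auto
    have sub: "(lattice_box (n - r) :: 'd site set) \<subseteq> lattice_box n" by (rule lattice_box_mono) simp
    have ne: "(lattice_box n :: 'd site set) \<noteq> {}" using zero_in_lattice_box by blast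
    have "(1 - ?V (n - r) / ?V n) * ?V n = real (card (lattice_box n - lattice_box (n - r) :: 'd site set))"
      using ne card_Diff_subset[OF finite_lattice_box sub] card_mono[OF finite_lattice_box sub]
      by (simp add: left_diff_distrib of_nat_diff)
    moreover have "K * (1 - ?V (n - r) / ?V n) * ?V n \<le> e / 2 * ?V n"
      using n(1) Vpos[of n] by (intro mult_right_mono) auto
    ultimately have bd: "K * real (card (lattice_box n - lattice_box (n - r) :: 'd site set)) \<le> e / 2 * ?V n"
      by (simp add: mult.assoc)
    have half: "?V n / 2 \<le> ?V (n - r - w)" using n(2) Vpos[of n] by (simp add: field_simps)
    show ?thesis
    proof (intro exI[of _ n] allI impI conjI)
      fix E :: "(('d, 'q) config \<Rightarrow> real) \<Rightarrow> real"
      assume E: "state E" and inv: "\<forall>f i. continuous_on UNIV f \<longrightarrow> E (\<lambda>\<omega>. f (shift i \<omega>)) = E f"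
        and pos: "\<forall>\<eta>. E (indicator (cyl (lattice_box n) \<eta>)) > 0"
      define J where "J = \<bar>E (current W \<zeta> \<zeta>')\<bar>"
      have bound: "entropy_rate E (lattice_box n) \<le> - (\<alpha> * u / 2) * (?V (n - r - w) * J / D)
          + (u * (1 - \<alpha>) + \<alpha> * u\<^sup>2 + 1 / \<alpha> - \<alpha>) * (R * ?V n) + e / 2 * ?V n" if "0 \<le> u" for u
      proof -
        have "entropy_rate E (lattice_box n) \<le> - (\<alpha> * u / 2) * (?V (n - r - w) * J / D)
          + (u * (1 - \<alpha>) + \<alpha> * u\<^sup>2 + 1 / \<alpha> - \<alpha>) * (R * ?V n) + K * real (card (lattice_box n - lattice_box (n - r) :: 'd site set))"
          unfolding J_def D_def R_def K_def \<alpha>_def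
          using entropy_rate_bound[OF E _ _ r _ n(3) w W(2) that] inv pos a(3) by simp
        then show ?thesis using bd by linarith
      qed
      have s1: "0 \<le> s * (1 - \<alpha>)" using s \<alpha> by simp
      \<comment> \<open>With parameter 0 the current is dropped from the bound and only errors
        remain.\<close>
      show "entropy_rate E (lattice_box n) \<le> e * ?V n"
      proof -
        have "(1 / \<alpha> - \<alpha>) * R \<le> (s * (1 - \<alpha>) + 1 / \<alpha> - \<alpha>) * R" using R s1 by (intro mult_right_mono) auto
        then have 1: "(1 / \<alpha> - \<alpha>) * R * ?V n \<le> e / 2 * ?V n" using \<alpha>R Vpos[of n] by (intro mult_right_mono) auto
        have "entropy_rate E (lattice_box n) \<le> (1 / \<alpha> - \<alpha>) * R * ?V n + e / 2 * ?V n"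
          using bound[of 0] by (simp add: mult.assoc)
        from order_trans[OF this add_right_mono[OF 1]] show ?thesis by simp
      qed
      assume "j \<le> \<bar>E (current W \<zeta> \<zeta>')\<bar>"
      then have J: "j \<le> J" by (simp add: J_def)
      show "entropy_rate E (lattice_box n) \<le> (e - c0) * ?V n"
      proof -
        have "(s / 4) * (?V n / 2 * j / D) \<le> (\<alpha> * s / 2) * (?V (n - r - w) * J / D)"
          using half J j D \<alpha> s Vpos[of n] by (intro mult_mono divide_right_mono) auto
        moreover have "(s / 4) * (?V n / 2 * j / D) = 2 * c0 * ?V n" by (simp add: c0_def)
        moreover have "(s * (1 - \<alpha>) + \<alpha> * s\<^sup>2 + 1 / \<alpha> - \<alpha>) * (R * ?V n)
            = (s * (1 - \<alpha>) + 1 / \<alpha> - \<alpha>) * R * ?V n + \<alpha> * s\<^sup>2 * R * ?V n" by (simp add: algebra_simps)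
        moreover have "(s * (1 - \<alpha>) + 1 / \<alpha> - \<alpha>) * R * ?V n \<le> e / 2 * ?V n"
          using \<alpha>R Vpos[of n] by (intro mult_right_mono) auto
        moreover have "\<alpha> * s\<^sup>2 * R * ?V n \<le> c0 * ?V n"
        proof -
          have "s * R \<le> j / (16 * D)"
          proof -
            have "s * R = j / (16 * D) * (R / (R + 1))" unfolding s_def by simp
            also have "\<dots> \<le> j / (16 * D) * 1" using R j D by (intro mult_left_mono) auto
            finally show ?thesis by simp
          qed
          then have "s * (s * R) \<le> s * (j / (16 * D))" using s by (intro mult_left_mono) auto
          then have "s\<^sup>2 * R \<le> c0" by (simp add: c0_def power2_eq_square mult.assoc)
          moreover have "\<alpha> * (s\<^sup>2 * R) \<le> 1 * (s\<^sup>2 * R)" using \<alpha> R by (intro mult_right_mono) auto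
          ultimately have "\<alpha> * s\<^sup>2 * R \<le> c0" by (simp add: mult.assoc)
          then show ?thesis using Vpos[of n] by (intro mult_right_mono) auto
        qed
        ultimately show ?thesis using bound[of s] s by (simp add: left_diff_distrib)
      qed
    qed
  qed
  then show ?thesis using c0 by blast
qed

end

section \<open>Contraction semigroups\<close>

text \<open>An abstract setting for comparing two semigroups through their generators; uniqueness
  will give that P commutes with translations.\<close>

locale contraction_semigroup =
  fixes P :: "real \<Rightarrow> 'a::real_normed_vector \<Rightarrow> 'a"
  assumes lin: "0 \<le> t \<Longrightarrow> linear (P t)"
    and P_0: "P 0 f = f"
    and P_add: "0 \<le> s \<Longrightarrow> 0 \<le> t \<Longrightarrow> P (s + t) f = P s (P t f)"
    and P_cont: "continuous_on {0..} (\<lambda>t. P t f)"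
    and P_norm: "0 \<le> t \<Longrightarrow> norm (P t f) \<le> norm f"
begin

lemma P_diff: "0 \<le> t \<Longrightarrow> P t (f - g) = P t f - P t g"
  and P_scale: "0 \<le> t \<Longrightarrow> P t (a *\<^sub>R f) = a *\<^sub>R P t f"
  using lin by (auto simp: linear_diff linear_scale)

lemma P_bounded_linear: "0 \<le> t \<Longrightarrow> bounded_linear (P t)"
  using lin P_norm by (intro bounded_linear.intro) (auto simp: bounded_linear_axioms_def intro!: exI[of _ 1])

lemma P_cont_at:
  assumes "0 \<le> t" "0 < e"
  obtains d where "0 < d" "\<And>s. 0 \<le> s \<Longrightarrow> \<bar>s - t\<bar> < d \<Longrightarrow> norm (P s f - P t f) < e"
proof -
  have "\<forall>t\<in>{0..}. \<forall>e>0. \<exists>d>0. \<forall>s\<in>{0..}. dist s t < d \<longrightarrow> dist (P s f) (P t f) < e"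
    using P_cont[of f] by (simp only: continuous_on_iff)
  from bspec[OF this, of t] assms have "\<exists>d>0. \<forall>s\<in>{0..}. dist s t < d \<longrightarrow> dist (P s f) (P t f) < e" by simp
  then show ?thesis using that by (auto simp: dist_norm)
qed

definition graph :: "('a \<times> 'a) set" where
  "graph = {(f, g). ((\<lambda>t. (1 / t) *\<^sub>R (P t f - f)) \<longlongrightarrow> g) (at_right 0)}"

lemma graph_bound:
  assumes "(f, g) \<in> graph" "0 < e"
  shows "\<exists>d>0. \<forall>h. 0 \<le> h \<and> h < d \<longrightarrow> norm (P h f - f - h *\<^sub>R g) \<le> e * h"
proof -
  have "\<forall>\<^sub>F h in at_right 0. dist ((1 / h) *\<^sub>R (P h f - f)) g < e"
    using assms by (auto simp: graph_def tendsto_iff)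
  then obtain d where d: "d > 0" "\<And>h. 0 < h \<Longrightarrow> h < d \<Longrightarrow> dist ((1 / h) *\<^sub>R (P h f - f)) g < e"
    by (auto simp: eventually_at_right_field)
  have "norm (P h f - f - h *\<^sub>R g) \<le> e * h" if "0 \<le> h" "h < d" for h
  proof (cases "h = 0")
    case True
    then show ?thesis by (simp add: P_0)
  next
    case False
    then have h: "h > 0" using that by simp
    then have "P h f - f - h *\<^sub>R g = h *\<^sub>R ((1 / h) *\<^sub>R (P h f - f) - g)"
      by (simp add: scaleR_diff_right)
    then have "norm (P h f - f - h *\<^sub>R g) = h * norm ((1 / h) *\<^sub>R (P h f - f) - g)"
      using h by simp
    also have "\<dots> \<le> h * e" using d(2)[OF h that(2)] h by (intro mult_left_mono) (auto simp: dist_norm)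
    finally show ?thesis by (simp add: mult.commute)
  qed
  then show ?thesis using d(1) by blast
qed

lemma graph_invariant:
  assumes "(f, g) \<in> graph" "0 \<le> s"
  shows "(P s f, P s g) \<in> graph"
proof -
  have "((\<lambda>t. P s ((1 / t) *\<^sub>R (P t f - f))) \<longlongrightarrow> P s g) (at_right 0)"
    using assms by (intro bounded_linear.tendsto[OF P_bounded_linear]) (auto simp: graph_def)
  moreover have "\<forall>\<^sub>F t in at_right 0. P s ((1 / t) *\<^sub>R (P t f - f)) = (1 / t) *\<^sub>R (P t (P s f) - P s f)"
    using eventually_at_right_less[of 0]
  proof eventually_elim
    case (elim t)
    have "P s (P t f) = P t (P s f)"
      using P_add[OF assms(2), of t f] P_add[of t s f] assms(2) elim by (simp add: add.commute)
    then show ?case using elim assms(2) by (simp add: P_scale P_diff)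
  qed
  ultimately show ?thesis by (simp add: graph_def Lim_transform_eventually)
qed

text \<open>From the right the increment is \<open>P t\<close> applied to an increment at time 0.
  From the left it is \<open>P s\<close> that is applied, so continuity of \<open>P s g\<close> in s
  is needed to reach the derivative at t.\<close>

lemma P_has_vector_derivative:
  assumes fg: "(f, g) \<in> graph" and t: "0 \<le> t"
  shows "((\<lambda>s. P s f) has_vector_derivative P t g) (at t within {0..})"
  unfolding has_vector_derivative_def has_derivative_within_alt
proof (intro conjI bounded_linear_scaleR_left allI impI)
  fix e :: real assume e: "0 < e"
  then obtain d1 where d1: "d1 > 0" "\<And>h. 0 \<le> h \<Longrightarrow> h < d1 \<Longrightarrow> norm (P h f - f - h *\<^sub>R g) \<le> e / 2 * h"
    using graph_bound[OF fg, of "e / 2"] by auto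
  obtain d2 where d2: "d2 > 0" "\<And>s. 0 \<le> s \<Longrightarrow> \<bar>s - t\<bar> < d2 \<Longrightarrow> norm (P s g - P t g) < e / 2"
    using P_cont_at[OF t, of "e / 2" g] e by auto
  have "norm (P s f - P t f - (s - t) *\<^sub>R P t g) \<le> e * norm (s - t)" if s: "s \<in> {0..}" "norm (s - t) < min d1 d2" for s
  proof (cases "t \<le> s")
    case True
    define h where "h = s - t"
    have h: "0 \<le> h" "h < d1" "s = t + h" using True s by (auto simp: h_def)
    have "P s f - P t f - (s - t) *\<^sub>R P t g = P t (P h f - f - h *\<^sub>R g)"
      using h t by (simp add: P_add P_diff P_scale)
    also have "norm \<dots> \<le> norm (P h f - f - h *\<^sub>R g)" by (rule P_norm[OF t])
    also have "\<dots> \<le> e / 2 * h" by (rule d1(2)[OF h(1,2)])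
    also have "\<dots> \<le> e * norm (s - t)" using e h by simp
    finally show ?thesis .
  next
    case False
    define h where "h = t - s"
    have h: "0 \<le> h" "h < d1" "t = s + h" using False s by (auto simp: h_def)
    have s0: "0 \<le> s" using s by simp
    have "P s f - P t f - (s - t) *\<^sub>R P t g = - (P s (P h f - f - h *\<^sub>R g) + h *\<^sub>R (P s g - P t g))"
      using h s0 by (simp add: P_add P_diff P_scale scaleR_diff_right)
    then have "norm (P s f - P t f - (s - t) *\<^sub>R P t g) \<le> norm (P s (P h f - f - h *\<^sub>R g)) + norm (h *\<^sub>R (P s g - P t g))"
      by (simp only: norm_minus_cancel norm_triangle_ineq)
    also have "\<dots> \<le> e / 2 * h + h * (e / 2)"
    proof (rule add_mono)
      show "norm (P s (P h f - f - h *\<^sub>R g)) \<le> e / 2 * h"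
        by (rule order_trans[OF P_norm[OF s0] d1(2)[OF h(1,2)]])
      have "norm (P s g - P t g) \<le> e / 2" using d2(2)[OF s0] s by (simp add: less_imp_le)
      from mult_left_mono[OF this h(1)] show "norm (h *\<^sub>R (P s g - P t g)) \<le> h * (e / 2)" using h(1) by simp
    qed
    also have "\<dots> = e * norm (s - t)" using h by simp
    finally show ?thesis .
  qed
  then show "\<exists>d>0. \<forall>y\<in>{0..}. norm (y - t) < d \<longrightarrow> norm (P y f - P t f - (y - t) *\<^sub>R P t g) \<le> e * norm (y - t)"
    using d1(1) d2(1) by (intro exI[of _ "min d1 d2"]) auto
qed

text \<open>A mean value bound whose constant involves g only. Unlike in \<open>graph_bound\<close>,
  the admissible h does not depend on f, which allows moving base points in the uniqueness
  proof.\<close>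

lemma graph_bound_integrated:
  assumes fg: "(f, g) \<in> graph" and h: "0 \<le> h" and B: "\<And>r. 0 \<le> r \<Longrightarrow> r \<le> h \<Longrightarrow> norm (P r g - g) \<le> B"
  shows "norm (P h f - f - h *\<^sub>R g) \<le> B * h"
proof -
  have "norm (P h f - P 0 f - (h - 0) *\<^sub>R P 0 g) \<le> norm (h - 0) * B"
  proof (rule vector_differentiable_bound_linearization[where S = "{0..h}"])
    show "((\<lambda>s. P s f) has_vector_derivative P r g) (at r within {0..h})" if "r \<in> {0..h}" for r
      using P_has_vector_derivative[OF fg, of r] that by (auto intro: has_vector_derivative_within_subset)
    show "closed_segment 0 h \<subseteq> {0..h}" using h by (simp add: closed_segment_eq_real_ivl)
    show "norm (P r g - P 0 g) \<le> B" if "r \<in> {0..h}" for r using B that by (simp add: P_0)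
  qed (use h in auto)
  then show ?thesis using h by (simp add: P_0 mult.commute)
qed

end

text \<open>\<phi> interpolates between \<open>Q t f\<close> and \<open>P t f\<close>, and its
  derivative vanishes because the generators agree along the orbit of f.\<close>

lemma semigroup_unique_on_domain:
  fixes P Q :: "real \<Rightarrow> 'a::real_normed_vector \<Rightarrow> 'a"
  assumes P: "contraction_semigroup P" and Q: "contraction_semigroup Q"
    and sub: "contraction_semigroup.graph P \<subseteq> contraction_semigroup.graph Q"
    and fg: "(f, g) \<in> contraction_semigroup.graph P" and t: "0 \<le> t"
  shows "P t f = Q t f"
proof -
  interpret P: contraction_semigroup P by fact
  interpret Q: contraction_semigroup Q by fact
  define \<phi> where "\<phi> s = Q (t - s) (P s f)" for s
  have step: "norm (\<phi> (s + h) - \<phi> s) \<le> norm (P h f - f - h *\<^sub>R g) + norm (Q h (P s f) - P s f - h *\<^sub>R P s g)"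
    if "0 \<le> s" "0 \<le> h" "s + h \<le> t" for s h
  proof -
    have "\<phi> (s + h) - \<phi> s = Q (t - s - h) (P h (P s f) - Q h (P s f))"
      using that Q.P_add[of "t - s - h" h "P s f"] P.P_add[of h s f]
      by (simp add: \<phi>_def Q.P_diff diff_diff_eq add.commute)
    also have "norm \<dots> \<le> norm (P h (P s f) - Q h (P s f))" using that by (intro Q.P_norm) simp
    \<comment> \<open>To first order both semigroups move \<open>P s f\<close> by
      \<open>h *\<^sub>R P s g\<close>; only the two remainders survive.\<close>
    also have "P h (P s f) - Q h (P s f) = P s (P h f - f - h *\<^sub>R g) - (Q h (P s f) - P s f - h *\<^sub>R P s g)"
      using that P.P_add[of h s f] P.P_add[of s h f] by (simp add: P.P_diff P.P_scale add.commute)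
    also have "norm \<dots> \<le> norm (P s (P h f - f - h *\<^sub>R g)) + norm (Q h (P s f) - P s f - h *\<^sub>R P s g)"
      by (rule norm_triangle_ineq4)
    also have "norm (P s (P h f - f - h *\<^sub>R g)) \<le> norm (P h f - f - h *\<^sub>R g)" by (rule P.P_norm[OF that(1)])
    finally show ?thesis by simp
  qed
  have "(\<phi> has_derivative (\<lambda>_. 0)) (at s within {0..t})" if s: "s \<in> {0..t}" for s
    unfolding has_derivative_within_alt
  proof (intro conjI bounded_linear_zero allI impI)
    fix e :: real assume e: "0 < e"
    then have e4: "e / 4 > 0" "e / 2 > 0" by auto
    obtain d1 where d1: "d1 > 0" "\<And>h. 0 \<le> h \<Longrightarrow> h < d1 \<Longrightarrow> norm (P h f - f - h *\<^sub>R g) \<le> e / 4 * h"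
      using P.graph_bound[OF fg e4(1)] by auto
    have s0: "0 \<le> s" using s by simp
    obtain d2 where d2: "d2 > 0" "\<And>r. 0 \<le> r \<Longrightarrow> r < d2 \<Longrightarrow> norm (Q r (P s g) - P s g) < e / 4"
      using Q.P_cont_at[of 0 "e / 4" "P s g"] e4(1) by (auto simp: Q.P_0)
    obtain d3 where d3: "d3 > 0" "\<And>r. 0 \<le> r \<Longrightarrow> \<bar>r - s\<bar> < d3 \<Longrightarrow> norm (P r g - P s g) < e / 4"
      using P.P_cont_at[OF s0 e4(1), of g] by auto
    define d where "d = min d1 (min d2 d3)"
    \<comment> \<open>Increments start at the smaller of the two times, which may lie on either side
      of s; hence the estimate at all base points u near s.\<close>
    have key: "norm (\<phi> (u + h) - \<phi> u) \<le> e * h" if u: "0 \<le> u" "\<bar>u - s\<bar> < d" "0 \<le> h" "h < d" "u + h \<le> t" for u h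
    proof -
      have "norm (Q h (P u f) - P u f - h *\<^sub>R P u g) \<le> (3 * e / 4) * h"
      proof (rule Q.graph_bound_integrated[OF subsetD[OF sub P.graph_invariant[OF fg u(1)]] u(3)])
        fix r assume r: "0 \<le> r" "r \<le> h"
        have "Q r (P u g) - P u g = Q r (P u g - P s g) + (Q r (P s g) - P s g) - (P u g - P s g)"
          using r by (simp add: Q.P_diff)
        then have "norm (Q r (P u g) - P u g) \<le> norm (Q r (P u g - P s g)) + norm (Q r (P s g) - P s g) + norm (P u g - P s g)"
          using norm_triangle_ineq4[of "Q r (P u g - P s g) + (Q r (P s g) - P s g)" "P u g - P s g"]
            norm_triangle_ineq[of "Q r (P u g - P s g)" "Q r (P s g) - P s g"] by simp
        moreover have "norm (Q r (P u g - P s g)) \<le> norm (P u g - P s g)" by (rule Q.P_norm[OF r(1)])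
        moreover have "norm (P u g - P s g) < e / 4" using d3(2)[OF u(1)] u(2) by (simp add: d_def)
        moreover have "norm (Q r (P s g) - P s g) < e / 4" using d2(2)[OF r(1)] r u(4) by (simp add: d_def)
        ultimately show "norm (Q r (P u g) - P u g) \<le> 3 * e / 4" by linarith
      qed
      moreover have "norm (P h f - f - h *\<^sub>R g) \<le> e / 4 * h" using d1(2)[OF u(3)] u(4) by (simp add: d_def)
      ultimately show ?thesis using step[OF u(1,3,5)] by (simp add: field_simps)
    qed
    have "norm (\<phi> y - \<phi> s - 0) \<le> e * norm (y - s)" if y: "y \<in> {0..t}" "norm (y - s) < d" for y
    proof (cases "s \<le> y")
      case True
      then show ?thesis using key[of s "y - s"] y s by auto
    next
      case False
      then show ?thesis using key[of y "s - y"] y s by (auto simp: norm_minus_commute)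
    qed
    then show "\<exists>d>0. \<forall>y\<in>{0..t}. norm (y - s) < d \<longrightarrow> norm (\<phi> y - \<phi> s - 0) \<le> e * norm (y - s)"
      using d1(1) d2(1) d3(1) by (intro exI[of _ d]) (auto simp: d_def)
  qed
  then have "\<phi> 0 = \<phi> t"
    using has_derivative_zero_constant[of "{0..t}" \<phi>] t by (metis atLeastAtMost_iff convex_real_interval(5) order_refl)
  then show ?thesis by (simp add: \<phi>_def P.P_0 Q.P_0)
qed

lemma semigroup_unique:
  fixes P Q :: "real \<Rightarrow> 'a::real_normed_vector \<Rightarrow> 'a"
  assumes P: "contraction_semigroup P" and Q: "contraction_semigroup Q"
    and sub: "contraction_semigroup.graph P \<subseteq> contraction_semigroup.graph Q"
    and dense: "closure (fst ` contraction_semigroup.graph P) = UNIV" and t: "0 \<le> t"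
  shows "P t f = Q t f"
proof -
  interpret P: contraction_semigroup P by fact
  interpret Q: contraction_semigroup Q by fact
  have "closed {f. P t f = Q t f}"
    by (intro closed_Collect_eq linear_continuous_on P.P_bounded_linear Q.P_bounded_linear t)
  moreover have "fst ` P.graph \<subseteq> {f. P t f = Q t f}"
    using semigroup_unique_on_domain[OF P Q sub _ t] by auto
  ultimately have "closure (fst ` P.graph) \<subseteq> {f. P t f = Q t f}" by (rule closure_minimal[rotated])
  then show ?thesis using dense by auto
qed

text \<open>Contraction comes from positivity, applied to the constant \<open>norm f\<close> plus
  and minus f, since constants are preserved.\<close>

lemma feller_contraction_semigroup:
  fixes P :: "real \<Rightarrow> ('d::finite, 'q::finite) cont \<Rightarrow> ('d, 'q) cont"
  assumes "feller_semigroup P"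
  shows "contraction_semigroup P"
proof (rule contraction_semigroup.intro)
  show lin: "linear (P t)" if "0 \<le> t" for t using assms that by (simp add: feller_semigroup_def)
  show "P 0 f = f" for f using assms by (simp add: feller_semigroup_def)
  show "P (s + t) f = P s (P t f)" if "0 \<le> s" "0 \<le> t" for s t f using assms that by (simp add: feller_semigroup_def)
  show "continuous_on {0..} (\<lambda>t. P t f)" for f using assms by (simp add: feller_semigroup_def)
  show "norm (P t f) \<le> norm f" if t: "0 \<le> t" for t f
  proof (rule norm_bound)
    fix \<omega>
    interpret linear "P t" using lin[OF t] .
    let ?c = "norm f *\<^sub>R const_bcontfun 1 :: ('d, 'q) cont"
    have c: "P t ?c = ?c" using assms t by (simp add: scale feller_semigroup_def)
    have nn: "0 \<le> apply_bcontfun (P t g) \<omega>" if "\<And>\<omega>. 0 \<le> apply_bcontfun g \<omega>" for g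
      using assms t that by (simp add: feller_semigroup_def)
    have "\<bar>apply_bcontfun f \<omega>\<bar> \<le> norm f" for \<omega> using norm_bounded[of f \<omega>] by simp
    then have "0 \<le> apply_bcontfun (?c - f) \<omega>" "0 \<le> apply_bcontfun (?c + f) \<omega>" for \<omega>
      by (auto simp: abs_le_iff const_bcontfun.rep_eq algebra_simps minus_le_iff)
        (metis add.commute add_le_cancel_left add_uminus_conv_diff diff_ge_0_iff_ge le_diff_eq minus_le_iff)+
    from nn[OF this(1)] nn[OF this(2)] show "norm (apply_bcontfun (P t f) \<omega>) \<le> norm f"
      by (simp add: diff add c const_bcontfun.rep_eq)
  qed
qed

lemma semigroup_generator_graph_eq:
  assumes "contraction_semigroup P"
  shows "semigroup_generator_graph P = contraction_semigroup.graph P"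
  by (simp add: semigroup_generator_graph_def contraction_semigroup.graph_def[OF assms])

section \<open>The semigroup of an interacting particle system\<close>

definition shift_fun :: "('d::finite) site \<Rightarrow> ('d, 'q::finite) cont \<Rightarrow> ('d, 'q) cont" where
  "shift_fun i F = Bcontfun (\<lambda>\<omega>. apply_bcontfun F (shift i \<omega>))"

lemma apply_shift_fun [simp]: "apply_bcontfun (shift_fun i F) \<omega> = apply_bcontfun F (shift i \<omega>)"
  unfolding shift_fun_def by (subst apply_Bcontfun) (auto intro!: continuous_intros)

lemma shift_fun_shift_fun [simp]: "shift_fun i (shift_fun j F) = shift_fun (j + i) F"
  by (rule bcontfun_eqI) simp

lemma shift_fun_0 [simp]: "shift_fun 0 F = F"
  by (rule bcontfun_eqI) simp

lemma linear_shift_fun: "linear (shift_fun i)"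
  by (rule linearI) (rule bcontfun_eqI, simp add: plus_bcontfun.rep_eq scaleR_bcontfun.rep_eq)+

lemma norm_shift_fun [simp]: "norm (shift_fun i F) = norm F"
proof -
  have le: "norm (shift_fun i F) \<le> norm F" for i and F :: "('a, 'b) cont"
    by (rule norm_bound) (simp only: apply_shift_fun norm_bounded)
  show ?thesis using le[of i F] le[of "- i" "shift_fun i F"] by simp
qed

lemma bounded_linear_shift_fun: "bounded_linear (shift_fun i)"
  using linear_shift_fun by (intro bounded_linear.intro) (auto simp: bounded_linear_axioms_def intro!: exI[of _ 1])

lemma Bcontfun_add:
  fixes f g :: "('d::finite, 'q::finite) config \<Rightarrow> real"
  assumes "continuous_on UNIV f" "continuous_on UNIV g"
  shows "Bcontfun (\<lambda>\<omega>. f \<omega> + g \<omega>) = Bcontfun f + Bcontfun g"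
  by (rule bcontfun_eqI) (simp add: assms continuous_intros plus_bcontfun.rep_eq)

lemma Bcontfun_scale:
  fixes f :: "('d::finite, 'q::finite) config \<Rightarrow> real"
  assumes "continuous_on UNIV f"
  shows "Bcontfun (\<lambda>\<omega>. a * f \<omega>) = a *\<^sub>R Bcontfun f"
  by (rule bcontfun_eqI) (simp add: assms continuous_intros scaleR_bcontfun.rep_eq)

lemma bounded_linear_integral:
  assumes M: "M \<in> prob_measures"
  shows "bounded_linear (\<lambda>G::('d::finite, 'q::finite) cont. \<integral>\<omega>. apply_bcontfun F \<omega> * apply_bcontfun G \<omega> \<partial>M)"
proof (rule bounded_linear_intro[where K = "norm F"])
  interpret prob_space M using prob_measuresD[OF M] by simp
  have int: "integrable M (\<lambda>\<omega>. apply_bcontfun F \<omega> * apply_bcontfun G \<omega>)" for G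
    by (intro integrable_continuous[OF M] continuous_intros) auto
  fix G H :: "('d, 'q) cont" and a :: real
  show "(\<integral>\<omega>. apply_bcontfun F \<omega> * apply_bcontfun (G + H) \<omega> \<partial>M)
      = (\<integral>\<omega>. apply_bcontfun F \<omega> * apply_bcontfun G \<omega> \<partial>M) + (\<integral>\<omega>. apply_bcontfun F \<omega> * apply_bcontfun H \<omega> \<partial>M)"
    using int[of G] int[of H] by (simp add: plus_bcontfun.rep_eq distrib_left)
  show "(\<integral>\<omega>. apply_bcontfun F \<omega> * apply_bcontfun (a *\<^sub>R G) \<omega> \<partial>M) = a *\<^sub>R (\<integral>\<omega>. apply_bcontfun F \<omega> * apply_bcontfun G \<omega> \<partial>M)"
    by (simp add: scaleR_bcontfun.rep_eq mult.left_commute)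
  have "norm (\<integral>\<omega>. apply_bcontfun F \<omega> * apply_bcontfun G \<omega> \<partial>M) \<le> (\<integral>\<omega>. norm G * norm F \<partial>M)"
  proof (rule order_trans[OF integral_norm_bound integral_mono])
    show "norm (apply_bcontfun F \<omega> * apply_bcontfun G \<omega>) \<le> norm G * norm F" for \<omega>
      using mult_mono[OF norm_bounded[of F \<omega>] norm_bounded[of G \<omega>]] by (simp add: abs_mult mult.commute)
  qed (use int in auto)
  then show "norm (\<integral>\<omega>. apply_bcontfun F \<omega> * apply_bcontfun G \<omega> \<partial>M) \<le> norm G * norm F"
    by (simp add: prob_space)
qed

lemma bounded_linear_integral1:
  assumes "M \<in> prob_measures"
  shows "bounded_linear (\<lambda>G::('d::finite, 'q::finite) cont. \<integral>\<omega>. apply_bcontfun G \<omega> \<partial>M)"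
  using bounded_linear_integral[OF assms, of "const_bcontfun 1"] by (simp add: const_bcontfun.rep_eq)

lemma local_functions_dense:
  fixes F :: "('d::finite, 'q::finite) cont"
  assumes "e > 0"
  shows "\<exists>\<Lambda> f. finite \<Lambda> \<and> (\<forall>\<omega>. \<forall>\<omega>'\<in>cyl \<Lambda> \<omega>. f \<omega>' = f \<omega>) \<and> norm (Bcontfun f - F) < e"
proof -
  have "e / 2 > 0" using assms by simp
  then obtain \<Lambda> where \<Lambda>: "finite \<Lambda>" "\<And>\<omega>. \<bar>apply_bcontfun F \<omega> - apply_bcontfun F (restrict \<omega> \<Lambda>)\<bar> < e / 2"
    using local_approximation[of "apply_bcontfun F" "e / 2"] by auto
  define f where "f \<omega> = apply_bcontfun F (restrict \<omega> \<Lambda>)" for \<omega>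
  have loc: "f \<omega>' = f \<omega>" if "\<omega>' \<in> cyl \<Lambda> \<omega>" for \<omega> \<omega>'
    using that by (auto simp: f_def cyl_def restrict_def intro!: arg_cong[of _ _ "apply_bcontfun F"])
  then have "continuous_on UNIV f" by (rule continuous_on_local[OF \<Lambda>(1)])
  then have "norm (Bcontfun f - F) \<le> e / 2"
    using \<Lambda>(2) by (intro norm_bound) (simp add: f_def minus_bcontfun.rep_eq abs_minus_commute less_imp_le)
  also have "\<dots> < e" using assms by simp
  finally show ?thesis using \<Lambda>(1) loc by blast
qed

lemma oscillation_shift: "oscillation (shift_fun i F) x = oscillation F (x + i)"
proof -
  have "(\<lambda>(\<eta>, \<zeta>). \<bar>apply_bcontfun (shift_fun i F) \<eta> - apply_bcontfun (shift_fun i F) \<zeta>\<bar>) ` {(\<eta>, \<zeta>). \<forall>y. y \<noteq> x \<longrightarrow> \<eta> y = \<zeta> y}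
      = (\<lambda>(\<eta>, \<zeta>). \<bar>apply_bcontfun F \<eta> - apply_bcontfun F \<zeta>\<bar>) ` {(\<eta>, \<zeta>). \<forall>y. y \<noteq> x + i \<longrightarrow> \<eta> y = \<zeta> y}" (is "?A = ?B")
  proof (intro equalityI subsetI)
    fix v assume "v \<in> ?A"
    then obtain \<eta> \<zeta> where "\<forall>y. y \<noteq> x \<longrightarrow> \<eta> y = \<zeta> y" "v = \<bar>apply_bcontfun F (shift i \<eta>) - apply_bcontfun F (shift i \<zeta>)\<bar>"
      by auto
    then show "v \<in> ?B"
      by (intro image_eqI[of _ _ "(shift i \<eta>, shift i \<zeta>)"]) (auto simp: shift_def algebra_simps)
  next
    fix v assume "v \<in> ?B"
    then obtain \<eta> \<zeta> where "\<forall>y. y \<noteq> x + i \<longrightarrow> \<eta> y = \<zeta> y" "v = \<bar>apply_bcontfun F \<eta> - apply_bcontfun F \<zeta>\<bar>"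
      by auto
    then show "v \<in> ?A"
      by (intro image_eqI[of _ _ "(shift (- i) \<eta>, shift (- i) \<zeta>)"]) (simp, auto simp: shift_def)
  qed
  then show ?thesis by (simp add: oscillation_def)
qed

context translation_invariant_rates_system
begin

lemma generator_shift:
  "generator c (\<lambda>\<omega>. f (shift i \<omega>)) \<eta> = generator c f (shift i \<eta>)"
proof -
  have "generator c f (shift i \<eta>) = (\<Sum>\<^sub>\<infinity>\<Delta>\<in>volumes. \<Sum>\<xi>\<in>patterns (translate i \<Delta>).
      c (translate i \<Delta>) (shift i \<eta>) \<xi> * (f (override_on (shift i \<eta>) \<xi> (translate i \<Delta>)) - f (shift i \<eta>)))"
    unfolding generator_def
    by (rule infsum_reindex_bij_betw[symmetric], rule bij_betw_byWitness[of _ "translate (- i)"]) auto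
  also have "\<dots> = (\<Sum>\<^sub>\<infinity>\<Delta>\<in>volumes. \<Sum>\<xi>\<in>patterns \<Delta>. c \<Delta> \<eta> \<xi> * (f (shift i (override_on \<eta> \<xi> \<Delta>)) - f (shift i \<eta>)))"
  proof (rule infsum_cong)
    fix \<Delta> :: "'d site set" assume \<Delta>: "\<Delta> \<in> volumes"
    show "(\<Sum>\<xi>\<in>patterns (translate i \<Delta>). c (translate i \<Delta>) (shift i \<eta>) \<xi> * (f (override_on (shift i \<eta>) \<xi> (translate i \<Delta>)) - f (shift i \<eta>)))
        = (\<Sum>\<xi>\<in>patterns \<Delta>. c \<Delta> \<eta> \<xi> * (f (shift i (override_on \<eta> \<xi> \<Delta>)) - f (shift i \<eta>)))"
    proof (rule sum.reindex_bij_witness[of _ "shift i" "shift (- i)"])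
      fix \<xi> :: "('d, 'q) config" assume \<xi>: "\<xi> \<in> patterns (translate i \<Delta>)"
      show m: "shift (- i) \<xi> \<in> patterns \<Delta>" using shift_patterns[OF \<xi>, of "- i"] by simp
      have "c (translate i \<Delta>) (shift i \<eta>) (shift i (shift (- i) \<xi>)) = c \<Delta> \<eta> (shift (- i) \<xi>)"
        using rates_shift \<Delta> m unfolding translation_invariant_rates_def by blast
      then show "c \<Delta> \<eta> (shift (- i) \<xi>) * (f (shift i (override_on \<eta> (shift (- i) \<xi>) \<Delta>)) - f (shift i \<eta>))
        = c (translate i \<Delta>) (shift i \<eta>) \<xi> * (f (override_on (shift i \<eta>) \<xi> (translate i \<Delta>)) - f (shift i \<eta>))"
        by (simp add: shift_override)
    qed (auto simp: shift_patterns)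
  qed
  finally show ?thesis by (simp add: generator_def)
qed

lemma pregenerator_shift:
  assumes "(F, G) \<in> pregenerator_graph c"
  shows "(shift_fun i F, shift_fun i G) \<in> pregenerator_graph c"
proof -
  have "(\<lambda>x. oscillation F (x + i)) summable_on UNIV"
    using assms by (subst summable_on_reindex_bij_betw) (auto simp: pregenerator_graph_def bij_plus_right)
  then have "oscillation (shift_fun i F) summable_on UNIV"
    by (simp add: oscillation_shift[abs_def])
  moreover have "apply_bcontfun (shift_fun i F) = (\<lambda>\<omega>. apply_bcontfun F (shift i \<omega>))" by auto
  ultimately show ?thesis
    using assms by (simp add: pregenerator_graph_def generator_shift)
qed

text \<open>A local function does not react to sites off \<Lambda>, so its oscillation has finite
  support and is summable.\<close>

lemma pregenerator_local:
  fixes f :: "('d, 'q) config \<Rightarrow> real"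
  assumes "finite \<Lambda>" "\<And>\<omega> \<omega>'. \<omega>' \<in> cyl \<Lambda> \<omega> \<Longrightarrow> f \<omega>' = f \<omega>"
  shows "(Bcontfun f, Bcontfun (generator c f)) \<in> pregenerator_graph c"
proof -
  have f: "continuous_on UNIV f" by (rule continuous_on_local[OF assms])
  have "oscillation (Bcontfun f) x = 0" if "x \<notin> \<Lambda>" for x
  proof -
    have "\<bar>f \<eta> - f \<zeta>\<bar> = 0" if "\<forall>y. y \<noteq> x \<longrightarrow> \<eta> y = \<zeta> y" for \<eta> \<zeta>
    proof -
      have "\<eta> \<in> cyl \<Lambda> \<zeta>" using that \<open>x \<notin> \<Lambda>\<close> by (simp add: cyl_def) metis
      then show ?thesis using assms(2) by simp
    qed
    then have "(\<lambda>(\<eta>, \<zeta>). \<bar>f \<eta> - f \<zeta>\<bar>) ` {(\<eta>, \<zeta>). \<forall>y. y \<noteq> x \<longrightarrow> \<eta> y = \<zeta> y} = {0}"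
      by (auto simp: image_iff intro!: exI[of _ undefined])
    then show ?thesis by (simp add: oscillation_def f)
  qed
  then have "oscillation (Bcontfun f) summable_on UNIV"
    using summable_on_cong_neutral[of \<Lambda> UNIV "oscillation (Bcontfun f)" "oscillation (Bcontfun f)"] assms(1) by auto
  then show ?thesis
    by (simp add: pregenerator_graph_def f generator_local_continuous[OF assms])
qed

end

section \<open>Translation covariance and reversibility of the semigroup\<close>

locale ips_dynamics = translation_invariant_rates_system c
  for c :: "('d::finite, 'q::finite) rates" +
  fixes P :: "real \<Rightarrow> ('d, 'q) cont \<Rightarrow> ('d, 'q) cont"
  assumes semigroup: "ips_semigroup c P"
begin

sublocale P: contraction_semigroup P
  using semigroup by (intro feller_contraction_semigroup) (simp add: ips_semigroup_def)

lemma graph_closure: "P.graph = closure (pregenerator_graph c)"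
  using semigroup semigroup_generator_graph_eq[OF P.contraction_semigroup_axioms] by (simp add: ips_semigroup_def)

lemma graph_local:
  assumes "finite \<Lambda>" "\<And>\<omega> \<omega>'. \<omega>' \<in> cyl \<Lambda> \<omega> \<Longrightarrow> f \<omega>' = f \<omega>"
  shows "(Bcontfun f, Bcontfun (generator c f)) \<in> P.graph"
  unfolding graph_closure by (rule subsetD[OF closure_subset pregenerator_local[OF assms]])

lemma graph_dense: "closure (fst ` P.graph) = UNIV"
proof -
  have "F \<in> closure (fst ` P.graph)" for F
    unfolding closure_approachable
  proof (intro allI impI)
    fix e :: real assume "e > 0"
    then obtain \<Lambda> f where f: "finite \<Lambda>" "\<forall>\<omega>. \<forall>\<omega>'\<in>cyl \<Lambda> \<omega>. f \<omega>' = f \<omega>" "norm (Bcontfun f - F) < e"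
      using local_functions_dense[of e F] by blast
    have "Bcontfun f \<in> fst ` P.graph"
    proof (rule image_eqI)
      show "(Bcontfun f, Bcontfun (generator c f)) \<in> P.graph" by (rule graph_local[OF f(1)]) (use f(2) in blast)
    qed simp
    then show "\<exists>y\<in>fst ` P.graph. dist y F < e" by (rule bexI[rotated]) (use f(3) in \<open>simp add: dist_norm\<close>)
  qed
  then show ?thesis by blast
qed

text \<open>The semigroup conjugated by a translation is again a contraction semigroup, and its
  generator extends that of P because the pregenerator is translation invariant. Uniqueness gives
  equality.\<close>

lemma P_shift:
  assumes t: "0 \<le> t" shows "P t (shift_fun i F) = shift_fun i (P t F)"
proof -
  define Q where "Q t F = shift_fun (- i) (P t (shift_fun i F))" for t F
  interpret Q: contraction_semigroup Q
  proof (rule contraction_semigroup.intro)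
    show "linear (Q t)" if "0 \<le> t" for t
      unfolding Q_def using linear_compose[OF linear_compose[OF linear_shift_fun P.lin[OF that]] linear_shift_fun]
      by (simp add: o_def)
    show "Q 0 f = f" for f by (simp add: Q_def P.P_0)
    show "Q (s + t) f = Q s (Q t f)" if "0 \<le> s" "0 \<le> t" for s t f by (simp add: Q_def P.P_add that)
    show "continuous_on {0..} (\<lambda>t. Q t f)" for f
      unfolding Q_def by (intro bounded_linear.continuous_on[OF bounded_linear_shift_fun] P.P_cont)
    show "norm (Q t f) \<le> norm f" if "0 \<le> t" for t f using P.P_norm[OF that, of "shift_fun i f"] by (simp add: Q_def)
  qed
  have "P.graph \<subseteq> Q.graph"
  proof (rule subrelI)
    fix f g assume fg: "(f, g) \<in> P.graph"
    let ?S = "\<lambda>p. (shift_fun i (fst p), shift_fun i (snd p))"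
    have "?S ` closure (pregenerator_graph c) \<subseteq> closure (pregenerator_graph c)"
    proof (rule image_closure_subset[OF _ closed_closure])
      show "continuous_on (closure (pregenerator_graph c)) ?S"
        by (intro continuous_on_Pair bounded_linear.continuous_on[OF bounded_linear_shift_fun] continuous_on_fst continuous_on_snd continuous_on_id)
      show "?S ` pregenerator_graph c \<subseteq> closure (pregenerator_graph c)"
      proof (rule image_subsetI)
        fix p assume "p \<in> pregenerator_graph c"
        then have "?S p \<in> pregenerator_graph c" using pregenerator_shift[of "fst p" "snd p" i] by simp
        then show "?S p \<in> closure (pregenerator_graph c)" by (rule subsetD[OF closure_subset])
      qed
    qed
    from subsetD[OF this imageI, of "(f, g)"] have "(shift_fun i f, shift_fun i g) \<in> P.graph"
      using fg by (simp add: graph_closure)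
    then have "((\<lambda>t. shift_fun (- i) ((1 / t) *\<^sub>R (P t (shift_fun i f) - shift_fun i f))) \<longlongrightarrow> shift_fun (- i) (shift_fun i g)) (at_right 0)"
      unfolding P.graph_def by (intro bounded_linear.tendsto[OF bounded_linear_shift_fun]) auto
    moreover have "shift_fun (- i) ((1 / t) *\<^sub>R (P t (shift_fun i f) - shift_fun i f)) = (1 / t) *\<^sub>R (Q t f - f)" for t
      by (simp add: Q_def linear_scale[OF linear_shift_fun] linear_diff[OF linear_shift_fun])
    ultimately show "(f, g) \<in> Q.graph" by (simp add: Q.graph_def)
  qed
  then have "P t F = Q t F"
    by (rule semigroup_unique[OF P.contraction_semigroup_axioms Q.contraction_semigroup_axioms _ graph_dense t])
  moreover have "shift_fun i (Q t F) = P t (shift_fun i F)" by (simp add: Q_def)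
  ultimately show ?thesis by simp
qed

lemma P_one: "0 \<le> t \<Longrightarrow> P t (const_bcontfun 1) = const_bcontfun 1"
  and P_nonneg: "0 \<le> t \<Longrightarrow> (\<And>\<omega>. 0 \<le> apply_bcontfun f \<omega>) \<Longrightarrow> 0 \<le> apply_bcontfun (P t f) \<omega>"
  using semigroup by (auto simp: ips_semigroup_def feller_semigroup_def)

text \<open>The derivative at time 0 of the symmetry of \<open>P t\<close>.\<close>

lemma reversible_generator:
  assumes M: "M \<in> prob_measures" "reversible P M" and F: "(F, F') \<in> P.graph" and G: "(G, G') \<in> P.graph"
  shows "(\<integral>\<omega>. apply_bcontfun F \<omega> * apply_bcontfun G' \<omega> \<partial>M) = (\<integral>\<omega>. apply_bcontfun G \<omega> * apply_bcontfun F' \<omega> \<partial>M)"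
proof (rule tendsto_unique[OF trivial_limit_at_right_real])
  let ?I = "\<lambda>F G. \<integral>\<omega>. apply_bcontfun F \<omega> * apply_bcontfun G \<omega> \<partial>M"
  show "((\<lambda>t. ?I F ((1 / t) *\<^sub>R (P t G - G))) \<longlongrightarrow> ?I F G') (at_right 0)"
    using G unfolding P.graph_def by (intro bounded_linear.tendsto[OF bounded_linear_integral[OF M(1)]]) auto
  have "((\<lambda>t. ?I G ((1 / t) *\<^sub>R (P t F - F))) \<longlongrightarrow> ?I G F') (at_right 0)"
    using F unfolding P.graph_def by (intro bounded_linear.tendsto[OF bounded_linear_integral[OF M(1)]]) auto
  moreover have "\<forall>\<^sub>F t in at_right 0. ?I G ((1 / t) *\<^sub>R (P t F - F)) = ?I F ((1 / t) *\<^sub>R (P t G - G))"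
    using eventually_at_right_less[of 0]
  proof eventually_elim
    case (elim t)
    have lin: "?I H ((1 / t) *\<^sub>R (X - Y)) = (1 / t) * (?I H X - ?I H Y)" for H X Y
      using linear_scale[OF bounded_linear.linear[OF bounded_linear_integral[OF M(1), of H]]]
        linear_diff[OF bounded_linear.linear[OF bounded_linear_integral[OF M(1), of H]]] by simp
    have "?I G (P t F) = ?I F (P t G)" using M(2) elim unfolding reversible_def by (simp add: less_imp_le)
    moreover have "?I G F = ?I F G" by (simp add: mult.commute)
    ultimately show ?case unfolding lin by simp
  qed
  ultimately show "((\<lambda>t. ?I F ((1 / t) *\<^sub>R (P t G - G))) \<longlongrightarrow> ?I G F') (at_right 0)"
    by (rule Lim_transform_eventually)
qed

text \<open>Symmetry of the generator is applied to the indicators of two disjoint cylinders: the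
  loss terms carry the product of both indicators and vanish, which leaves the two opposite
  fluxes.\<close>

lemma reversible_balanced:
  assumes M: "M \<in> prob_measures" "reversible P M"
  shows "balanced M"
  unfolding balanced_def
proof (intro ballI allI)
  fix \<Lambda> :: "'d site set" and \<eta> \<eta>' :: "('d, 'q) config" assume \<Lambda>: "\<Lambda> \<in> volumes"
  have fin: "finite \<Lambda>" using \<Lambda> by (simp add: volumes_iff)
  show "(\<integral>\<omega>. current \<Lambda> \<eta> \<eta>' \<omega> \<partial>M) = 0"
  proof (cases "\<eta>' \<in> cyl \<Lambda> \<eta>")
    case True
    then have "current \<Lambda> \<eta> \<eta>' \<omega> = 0" for \<omega>
      using cyl_cong[OF True] inflow_cong[OF True] by (simp add: current_def)
    then show ?thesis by simp
  next
    case False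
    have disj: "indicator (cyl \<Lambda> \<eta>) \<omega> * indicator (cyl \<Lambda> \<eta>') \<omega> = (0::real)" for \<omega>
      using False by (auto simp: cyl_def indicator_def)
    have loc: "indicator (cyl \<Lambda> \<zeta>) \<omega>' = (indicator (cyl \<Lambda> \<zeta>) \<omega> :: real)" if "\<omega>' \<in> cyl \<Lambda> \<omega>" for \<omega> \<omega>' \<zeta> :: "('d, 'q) config"
      using that by (auto simp: cyl_def indicator_def)
    have gen: "apply_bcontfun (Bcontfun (generator c (indicator (cyl \<Lambda> \<zeta>)))) \<omega> = inflow \<Lambda> \<zeta> \<omega> - total_rate \<Lambda> \<omega> * indicator (cyl \<Lambda> \<zeta>) \<omega>" for \<zeta> \<omega>
    proof -
      have "continuous_on UNIV (generator c (indicator (cyl \<Lambda> \<zeta>)))"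
        by (rule generator_local_continuous[OF fin loc])
      then show ?thesis by (simp only: apply_Bcontfun generator_indicator_cyl[OF fin])
    qed
    have ind: "apply_bcontfun (Bcontfun (indicator (cyl \<Lambda> \<zeta>) :: ('d, 'q) config \<Rightarrow> real)) = indicator (cyl \<Lambda> \<zeta>)" for \<zeta>
      by (rule apply_Bcontfun[OF continuous_on_indicator_cyl[OF fin]])
    have graph: "(Bcontfun (indicator (cyl \<Lambda> \<zeta>)), Bcontfun (generator c (indicator (cyl \<Lambda> \<zeta>)))) \<in> P.graph" for \<zeta> :: "('d, 'q) config"
      by (rule graph_local[OF fin loc])
    have "(\<integral>\<omega>. indicator (cyl \<Lambda> \<eta>) \<omega> * (inflow \<Lambda> \<eta>' \<omega> - total_rate \<Lambda> \<omega> * indicator (cyl \<Lambda> \<eta>') \<omega>) \<partial>M)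
        = (\<integral>\<omega>. indicator (cyl \<Lambda> \<eta>') \<omega> * (inflow \<Lambda> \<eta> \<omega> - total_rate \<Lambda> \<omega> * indicator (cyl \<Lambda> \<eta>) \<omega>) \<partial>M)"
      using reversible_generator[OF M graph[of \<eta>] graph[of \<eta>']] by (simp add: gen ind)
    moreover have "indicator (cyl \<Lambda> \<eta>) \<omega> * (inflow \<Lambda> \<eta>' \<omega> - total_rate \<Lambda> \<omega> * indicator (cyl \<Lambda> \<eta>') \<omega>) = indicator (cyl \<Lambda> \<eta>) \<omega> * inflow \<Lambda> \<eta>' \<omega>"
      "indicator (cyl \<Lambda> \<eta>') \<omega> * (inflow \<Lambda> \<eta> \<omega> - total_rate \<Lambda> \<omega> * indicator (cyl \<Lambda> \<eta>) \<omega>) = indicator (cyl \<Lambda> \<eta>') \<omega> * inflow \<Lambda> \<eta> \<omega>" for \<omega>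
      using disj[of \<omega>] by (auto simp: indicator_def)
    ultimately have "(\<integral>\<omega>. indicator (cyl \<Lambda> \<eta>) \<omega> * inflow \<Lambda> \<eta>' \<omega> \<partial>M) = (\<integral>\<omega>. indicator (cyl \<Lambda> \<eta>') \<omega> * inflow \<Lambda> \<eta> \<omega> \<partial>M)"
      by simp
    moreover have "integrable M (\<lambda>\<omega>. indicator (cyl \<Lambda> \<eta>) \<omega> * inflow \<Lambda> \<eta>' \<omega>)" "integrable M (\<lambda>\<omega>. indicator (cyl \<Lambda> \<eta>') \<omega> * inflow \<Lambda> \<eta> \<omega>)"
      by (intro integrable_continuous[OF M(1)] flux_integrand_cont fin)+
    ultimately show ?thesis unfolding current_def by simp
  qed
qed

end

section \<open>Decay of relative entropy\<close>

lemma state_average: "state E \<Longrightarrow> state E' \<Longrightarrow> state (\<lambda>f. (E f + E' f) / 2)"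
  unfolding state_def by (auto simp: add_divide_distrib distrib_left)

lemma integral_shift:
  fixes f :: "('d::finite, 'q::finite) config \<Rightarrow> real"
  assumes M: "M \<in> prob_measures" "translation_invariant_measure M" and f: "continuous_on UNIV f"
  shows "(\<integral>\<omega>. f (shift i \<omega>) \<partial>M) = (\<integral>\<omega>. f \<omega> \<partial>M)"
proof -
  have "shift i \<in> borel \<rightarrow>\<^sub>M (borel :: ('d, 'q) config measure)"
    by (rule borel_measurable_continuous_onI[OF continuous_on_shift])
  then have "shift i \<in> M \<rightarrow>\<^sub>M borel"
    using measurable_cong_sets[OF prob_measuresD(2)[OF M(1)] refl] by blast
  then have "(\<integral>\<omega>. f \<omega> \<partial>distr M borel (shift i)) = (\<integral>\<omega>. f (shift i \<omega>) \<partial>M)"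
    by (rule integral_distr) (rule borel_measurable_continuous_onI[OF f])
  then show ?thesis using M(2) by (simp add: translation_invariant_measure_def)
qed

lemma derivative_upper_bound:
  fixes h :: "real \<Rightarrow> real"
  assumes "a \<le> b" and h: "\<And>s. a \<le> s \<Longrightarrow> s \<le> b \<Longrightarrow> (h has_real_derivative h' s) (at s)"
    and B: "\<And>s. a \<le> s \<Longrightarrow> s \<le> b \<Longrightarrow> h' s \<le> B"
  shows "h b - h a \<le> B * (b - a)"
proof (cases "a = b")
  case False
  then have "a < b" using assms(1) by simp
  from MVT2[OF this h] obtain z where z: "a < z" "z < b" "h b - h a = (b - a) * h' z" by blast
  then show ?thesis using mult_left_mono[OF B[of z], of "b - a"] by (simp add: mult.commute)
qed simp

section \<open>Evolved functionals\<close>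

context ips_dynamics
begin

definition evolved :: "('d, 'q) config measure \<Rightarrow> real \<Rightarrow> (('d, 'q) config \<Rightarrow> real) \<Rightarrow> real" where
  "evolved M t f = (\<integral>\<omega>. apply_bcontfun (P t (Bcontfun f)) \<omega> \<partial>M)"

lemma state_evolved:
  assumes M: "M \<in> prob_measures" and t: "0 \<le> t"
  shows "state (evolved M t)"
proof
  interpret prob_space M using prob_measuresD[OF M] by simp
  have int: "integrable M (\<lambda>\<omega>. apply_bcontfun F \<omega>)" for F :: "('d, 'q) cont"
    by (rule integrable_continuous[OF M]) auto
  fix f g :: "('d, 'q) config \<Rightarrow> real" and a :: real
  assume f: "continuous_on UNIV f"
  show "evolved M t (\<lambda>\<omega>. a * f \<omega>) = a * evolved M t f"
    by (simp add: evolved_def Bcontfun_scale[OF f] P.P_scale[OF t] scaleR_bcontfun.rep_eq)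
  show "evolved M t (\<lambda>\<omega>. f \<omega> + g \<omega>) = evolved M t f + evolved M t g" if g: "continuous_on UNIV g"
    using int by (simp add: evolved_def Bcontfun_add[OF f g] linear_add[OF P.lin[OF t]] plus_bcontfun.rep_eq)
  show "0 \<le> evolved M t f" if "\<And>\<omega>. 0 \<le> f \<omega>"
    unfolding evolved_def by (intro Bochner_Integration.integral_nonneg P_nonneg[OF t]) (simp add: f that)
next
  interpret prob_space M using prob_measuresD[OF M] by simp
  have "Bcontfun (\<lambda>_. 1) = (const_bcontfun 1 :: ('d, 'q) cont)"
    by (rule bcontfun_eqI) (simp add: const_bcontfun.rep_eq)
  then show "evolved M t (\<lambda>_. 1) = 1"
    by (simp add: evolved_def P_one[OF t] const_bcontfun.rep_eq prob_space)
qed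

lemma evolved_shift:
  assumes M: "M \<in> prob_measures" "translation_invariant_measure M" and t: "0 \<le> t" and f: "continuous_on UNIV f"
  shows "evolved M t (\<lambda>\<omega>. f (shift i \<omega>)) = evolved M t f"
proof -
  have "Bcontfun (\<lambda>\<omega>. f (shift i \<omega>)) = shift_fun i (Bcontfun f)"
    by (rule bcontfun_eqI) (simp add: f continuous_intros)
  then show ?thesis
    using integral_shift[OF M, of "apply_bcontfun (P t (Bcontfun f))" i] by (simp add: evolved_def P_shift[OF t])
qed

lemma evolved_derivative:
  assumes M: "M \<in> prob_measures" and t: "0 < t" and \<Lambda>: "finite \<Lambda>"
  shows "((\<lambda>s. evolved M s (indicator (cyl \<Lambda> \<eta>))) has_real_derivative evolved M t (generator c (indicator (cyl \<Lambda> \<eta>)))) (at t)"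
proof -
  let ?f = "indicator (cyl \<Lambda> \<eta>) :: ('d, 'q) config \<Rightarrow> real"
  have "(Bcontfun ?f, Bcontfun (generator c ?f)) \<in> P.graph"
    by (rule graph_local[OF \<Lambda>]) (auto simp: cyl_def indicator_def)
  from P.P_has_vector_derivative[OF this less_imp_le[OF t]]
  have "((\<lambda>s. P s (Bcontfun ?f)) has_vector_derivative P t (Bcontfun (generator c ?f))) (at t)"
    using t at_within_interior[of t "{0..}"] by simp
  from bounded_linear.has_vector_derivative[OF bounded_linear_integral1[OF M] this]
  show ?thesis by (simp add: evolved_def has_real_derivative_iff_has_vector_derivative)
qed

text \<open>The increment from t to s is \<open>P t\<close> applied to an increment at time 0, and
  \<open>P t\<close> contracts; hence \<tau> does not depend on t. A current seen at some late time
  thus persists for a fixed duration.\<close>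

lemma evolved_continuity:
  assumes M: "M \<in> prob_measures" and f: "continuous_on UNIV f" and e: "0 < e"
  shows "\<exists>\<tau>>0. \<forall>t\<ge>0. \<forall>s. t \<le> s \<and> s \<le> t + \<tau> \<longrightarrow> \<bar>evolved M s f - evolved M t f\<bar> < e"
proof -
  let ?F = "Bcontfun f"
  obtain d where d: "0 < d" "\<And>s. 0 \<le> s \<Longrightarrow> \<bar>s - 0\<bar> < d \<Longrightarrow> norm (P s ?F - P 0 ?F) < e"
    using P.P_cont_at[of 0 e ?F] e by blast
  have "\<bar>evolved M s f - evolved M t f\<bar> < e" if t: "0 \<le> t" "t \<le> s" "s \<le> t + d / 2" for s t
  proof -
    interpret prob_space M using prob_measuresD[OF M] by simp
    have int: "integrable M (\<lambda>\<omega>. apply_bcontfun F \<omega>)" for F :: "('d, 'q) cont"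
      by (rule integrable_continuous[OF M]) auto
    have "P s ?F = P t (P (s - t) ?F)" using P.P_add[of t "s - t" ?F] t by simp
    then have n: "norm (P s ?F - P t ?F) < e"
      using P.P_norm[OF t(1), of "P (s - t) ?F - ?F"] d(2)[of "s - t"] t d(1) by (simp add: P.P_diff P.P_0)
    have "evolved M s f - evolved M t f = (\<integral>\<omega>. apply_bcontfun (P s ?F - P t ?F) \<omega> \<partial>M)"
      using int by (simp add: evolved_def minus_bcontfun.rep_eq)
    also have "\<bar>\<dots>\<bar> \<le> (\<integral>\<omega>. norm (P s ?F - P t ?F) \<partial>M)"
    proof (rule order_trans[OF integral_abs_bound integral_mono])
      show "\<bar>apply_bcontfun (P s ?F - P t ?F) \<omega>\<bar> \<le> norm (P s ?F - P t ?F)" for \<omega>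
        using norm_bounded[of "P s ?F - P t ?F" \<omega>] by simp
    qed (use int in auto)
    finally show ?thesis using n by (simp add: prob_space)
  qed
  then show ?thesis using d(1) by (intro exI[of _ "d / 2"]) auto
qed

end

section \<open>Relative entropy of the mixture\<close>

locale reversible_gibbs_dynamics = reversible_gibbs_system \<gamma> c \<mu> + ips_dynamics c P
  for \<gamma> :: "('d::finite, 'q::finite) kernels" and c :: "('d, 'q) rates" and \<mu> P +
  fixes \<nu> :: "('d, 'q) config measure"
  assumes \<mu>_invariant: "translation_invariant_measure \<mu>"
    and \<nu>: "\<nu> \<in> prob_measures" "translation_invariant_measure \<nu>"
begin

text \<open>Mixing with the stationary measure \<open>\<mu>\<close> keeps all cylinder probabilities positive and
  does not change which limits are balanced.\<close>

definition mixture :: "real \<Rightarrow> (('d, 'q) config \<Rightarrow> real) \<Rightarrow> real" where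
  "mixture t f = (evolved \<nu> t f + (\<integral>\<omega>. f \<omega> \<partial>\<mu>)) / 2"

lemma state_mixture: "0 \<le> t \<Longrightarrow> state (mixture t)"
  unfolding mixture_def[abs_def] by (intro state_average state_evolved state_integral \<nu>(1) gibbs_prob)

lemma mixture_shift:
  assumes "0 \<le> t" "continuous_on UNIV f"
  shows "mixture t (\<lambda>\<omega>. f (shift i \<omega>)) = mixture t f"
  unfolding mixture_def using evolved_shift[OF \<nu> assms] integral_shift[OF gibbs_prob \<mu>_invariant assms(2)] by simp

lemma mixture_pos:
  assumes "0 \<le> t" "\<Lambda> \<in> volumes"
  shows "0 < mixture t (indicator (cyl \<Lambda> \<eta>))"
proof -
  have fin: "finite \<Lambda>" using assms(2) by (simp add: volumes_iff)
  have "0 \<le> evolved \<nu> t (indicator (cyl \<Lambda> \<eta>))"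
    by (rule state.nonneg[OF state_evolved[OF \<nu>(1) assms(1)] continuous_on_indicator_cyl[OF fin]]) simp
  then show ?thesis
    using gibbs_cyl_pos[OF gibbs assms(2), of \<eta>]
    unfolding mixture_def integral_indicator_cyl[OF gibbs_prob fin] by simp
qed

lemma mixture_derivative:
  assumes t: "0 < t" and \<Lambda>: "\<Lambda> \<in> volumes"
  shows "((\<lambda>s. mixture s (indicator (cyl \<Lambda> \<eta>))) has_real_derivative mixture t (generator c (indicator (cyl \<Lambda> \<eta>)))) (at t)"
proof -
  have fin: "finite \<Lambda>" using \<Lambda> by (simp add: volumes_iff)
  \<comment> \<open>The half from \<mu> is constant in time, and its net fluxes cancel in pairs, so
    the derivative may be written with the mixture throughout.\<close>
  have "(\<integral>\<omega>. generator c (indicator (cyl \<Lambda> \<eta>)) \<omega> \<partial>\<mu>) = 0"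
    using state_generator_indicator[OF state_integral[OF gibbs_prob] fin, of \<eta>]
    by (simp add: gibbs_flux_sym[OF \<Lambda>, of _ \<eta>])
  then show ?thesis
    unfolding mixture_def using evolved_derivative[OF \<nu>(1) t fin, of \<eta>]
    by (auto intro!: derivative_eq_intros)
qed

definition entropy :: "nat \<Rightarrow> real \<Rightarrow> real" where
  "entropy n t = (\<Sum>\<eta>\<in>patterns (lattice_box n). mixture t (indicator (cyl (lattice_box n) \<eta>))
    * ln (mixture t (indicator (cyl (lattice_box n) \<eta>)) / measure \<mu> (cyl (lattice_box n) \<eta>)))"

lemma entropy_derivative:
  assumes t: "0 < t"
  shows "(entropy n has_real_derivative entropy_rate (mixture t) (lattice_box n)) (at t)"
proof -
  let ?\<Lambda> = "lattice_box n :: 'd site set"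
  let ?u = "\<lambda>\<eta> s. mixture s (indicator (cyl (lattice_box n) \<eta>))" and ?m = "\<lambda>\<eta>. measure \<mu> (cyl (lattice_box n) \<eta>)"
  let ?d = "\<lambda>\<eta>. mixture t (generator c (indicator (cyl (lattice_box n) \<eta>)))"
  have "((\<lambda>s. ?u \<eta> s * ln (?u \<eta> s / ?m \<eta>)) has_real_derivative ?d \<eta> * ln (?u \<eta> t / ?m \<eta>) + ?d \<eta>) (at t)" for \<eta>
  proof -
    have pos: "?u \<eta> t > 0" "?m \<eta> > 0"
      using mixture_pos[of t ?\<Lambda> \<eta>] gibbs_cyl_pos[OF gibbs, of ?\<Lambda> \<eta>] t by simp_all
    show ?thesis
      using pos by (auto intro!: derivative_eq_intros mixture_derivative[OF t lattice_box_in_volumes] simp: field_simps)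
  qed
  then have "((\<lambda>s. \<Sum>\<eta>\<in>patterns ?\<Lambda>. ?u \<eta> s * ln (?u \<eta> s / ?m \<eta>)) has_real_derivative
      (\<Sum>\<eta>\<in>patterns ?\<Lambda>. ?d \<eta> * ln (?u \<eta> t / ?m \<eta>) + ?d \<eta>)) (at t)"
    by (rule DERIV_sum)
  \<comment> \<open>Conservation of mass removes the second summand, which stems from the derivative
    of the logarithm.\<close>
  moreover have "(\<Sum>\<eta>\<in>patterns ?\<Lambda>. ?d \<eta>) = 0"
  proof -
    have "(\<Sum>\<eta>\<in>patterns ?\<Lambda>. ?d \<eta>) = (\<Sum>\<eta>\<in>patterns ?\<Lambda>. \<Sum>\<eta>'\<in>patterns ?\<Lambda>. flux (mixture t) ?\<Lambda> \<eta>' \<eta>)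
        - (\<Sum>\<eta>\<in>patterns ?\<Lambda>. \<Sum>\<eta>'\<in>patterns ?\<Lambda>. flux (mixture t) ?\<Lambda> \<eta> \<eta>')"
      using state_generator_indicator[OF state_mixture finite_lattice_box] t by (simp add: sum_subtractf)
    then show ?thesis
      using sum.swap[of "\<lambda>\<eta> \<eta>'. flux (mixture t) ?\<Lambda> \<eta>' \<eta>" "patterns ?\<Lambda>" "patterns ?\<Lambda>"] by simp
  qed
  ultimately show ?thesis
    unfolding entropy_def[abs_def] entropy_rate_def by (simp add: sum.distrib)
qed

text \<open>Gibbs' inequality: \<open>u * ln (u / m) \<ge> u - m\<close>, summed over two
  probability vectors.\<close>

lemma entropy_nonneg:
  assumes t: "0 \<le> t" shows "0 \<le> entropy n t"
proof -
  let ?u = "\<lambda>\<eta>. mixture t (indicator (cyl (lattice_box n) \<eta>))" and ?m = "\<lambda>\<eta>. measure \<mu> (cyl (lattice_box n) \<eta>)"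
  have "?u \<eta> - ?m \<eta> \<le> ?u \<eta> * ln (?u \<eta> / ?m \<eta>)" for \<eta>
  proof -
    have pos: "?u \<eta> > 0" "?m \<eta> > 0"
      using mixture_pos[OF t lattice_box_in_volumes] gibbs_cyl_pos[OF gibbs lattice_box_in_volumes] by blast+
    have "ln (?m \<eta> / ?u \<eta>) \<le> ?m \<eta> / ?u \<eta> - 1" using pos by (intro ln_le_minus_one) simp
    then have "1 - ?m \<eta> / ?u \<eta> \<le> ln (?u \<eta> / ?m \<eta>)" using pos by (simp add: ln_div)
    then have "?u \<eta> * (1 - ?m \<eta> / ?u \<eta>) \<le> ?u \<eta> * ln (?u \<eta> / ?m \<eta>)" using pos by (intro mult_left_mono) auto
    then show ?thesis using pos by (simp add: right_diff_distrib)
  qed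
  then have "(\<Sum>\<eta>\<in>patterns (lattice_box n). ?u \<eta> - ?m \<eta>) \<le> entropy n t"
    unfolding entropy_def by (intro sum_mono)
  moreover have "(\<Sum>\<eta>\<in>patterns (lattice_box n). ?u \<eta>) = 1"
    by (rule state.sum_cyl[OF state_mixture[OF t] finite_lattice_box])
  moreover have "(\<Sum>\<eta>\<in>patterns (lattice_box n). ?m \<eta>) = 1"
    using state.sum_cyl[OF state_integral[OF gibbs_prob] finite_lattice_box, of n]
    by (simp only: integral_indicator_cyl[OF gibbs_prob finite_lattice_box])
  ultimately show ?thesis by (simp add: sum_subtractf)
qed

text \<open>The finite-energy lower bound on the cylinder probabilities of \<mu> makes each
  logarithm at most linear in the volume, uniformly in time.\<close>

lemma entropy_le:
  assumes t: "0 \<le> t"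
  shows "entropy n t \<le> ln (1 / nonnull_bound) * card (lattice_box n :: 'd site set)"
proof -
  let ?u = "\<lambda>\<eta>. mixture t (indicator (cyl (lattice_box n) \<eta>))" and ?m = "\<lambda>\<eta>. measure \<mu> (cyl (lattice_box n) \<eta>)"
  let ?V = "card (lattice_box n :: 'd site set)"
  have sum1: "(\<Sum>\<eta>\<in>patterns (lattice_box n). ?u \<eta>) = 1"
    by (rule state.sum_cyl[OF state_mixture[OF t] finite_lattice_box])
  have upos: "?u \<eta> > 0" for \<eta> by (rule mixture_pos[OF t lattice_box_in_volumes])
  have "?u \<eta> * ln (?u \<eta> / ?m \<eta>) \<le> ?u \<eta> * (ln (1 / nonnull_bound) * ?V)" if \<eta>: "\<eta> \<in> patterns (lattice_box n)" for \<eta>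
  proof (rule mult_left_mono)
    have m: "?m \<eta> > 0" by (rule gibbs_cyl_pos[OF gibbs lattice_box_in_volumes])
    have "?u \<eta> \<le> (\<Sum>\<eta>\<in>patterns (lattice_box n). ?u \<eta>)"
      using \<eta> upos by (intro member_le_sum) (auto simp: less_imp_le)
    then have "?u \<eta> \<le> 1" using sum1 by simp
    then have "ln (?u \<eta>) \<le> 0" using upos[of \<eta>] by simp
    moreover have "ln (nonnull_bound ^ ?V) \<le> ln (?m \<eta>)"
      using gibbs_cyl_lower[OF gibbs lattice_box_in_volumes, of n \<eta>] nonnull_bound(1) m by simp
    moreover have "ln (nonnull_bound ^ ?V) = ?V * ln nonnull_bound" "ln (1 / nonnull_bound) * ?V = - (?V * ln nonnull_bound)"
      "ln (?u \<eta> / ?m \<eta>) = ln (?u \<eta>) - ln (?m \<eta>)"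
      using upos[of \<eta>] m nonnull_bound(1) by (simp_all add: ln_div ln_realpow mult.commute)
    ultimately show "ln (?u \<eta> / ?m \<eta>) \<le> ln (1 / nonnull_bound) * ?V" by linarith
  qed (use upos in \<open>simp add: less_imp_le\<close>)
  then have "entropy n t \<le> (\<Sum>\<eta>\<in>patterns (lattice_box n). ?u \<eta> * (ln (1 / nonnull_bound) * ?V))"
    unfolding entropy_def by (intro sum_mono)
  also have "\<dots> = ln (1 / nonnull_bound) * ?V" by (simp only: sum_distrib_right[symmetric] sum1 mult_1)
  finally show ?thesis .
qed

theorem limit_balanced:
  assumes t: "filterlim t at_top sequentially"
    and lim: "\<And>f. continuous_on UNIV f \<Longrightarrow> (\<lambda>n. evolved \<nu> (t n) f) \<longlonglongrightarrow> (\<integral>\<omega>. f \<omega> \<partial>M)"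
  shows "balanced M"
proof (rule ccontr)
  assume "\<not> balanced M"
  then obtain W \<zeta> \<zeta>' where W: "W \<in> volumes" "(\<integral>\<omega>. current W \<zeta> \<zeta>' \<omega> \<partial>M) \<noteq> 0"
    unfolding balanced_def by blast
  have fin: "finite W" using W(1) by (simp add: volumes_iff)
  have ex: "\<exists>x\<in>W. \<zeta> x \<noteq> \<zeta>' x"
  proof (rule ccontr)
    assume "\<not> ?thesis"
    then have "\<zeta>' \<in> cyl W \<zeta>" by (auto simp: cyl_def)
    then have "current W \<zeta> \<zeta>' \<omega> = 0" for \<omega>
      using cyl_cong[of \<zeta>' W \<zeta>] inflow_cong[of \<zeta>' W \<zeta>] by (simp add: current_def)
    then show False using W(2) by simp
  qed
  define j0 where "j0 = \<bar>\<integral>\<omega>. current W \<zeta> \<zeta>' \<omega> \<partial>M\<bar>"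
  have j0: "j0 > 0" using W(2) by (simp add: j0_def)
  have cc: "continuous_on UNIV (current W \<zeta> \<zeta>')" by (rule current_cont[OF fin])
  \<comment> \<open>The fractions of \<open>j0\<close>: along the sequence the current exceeds 3/4,
    it loses less than 1/4 within time \<tau>, and mixing with the balanced \<mu> halves the
    remaining 1/2, which leaves \<open>j0 / 4\<close>.\<close>
  have "0 < j0 / 4" using j0 by simp
  from evolved_continuity[OF \<nu>(1) cc this] obtain \<tau> where \<tau>: "\<tau> > 0"
    "\<And>a s. 0 \<le> a \<Longrightarrow> a \<le> s \<Longrightarrow> s \<le> a + \<tau> \<Longrightarrow> \<bar>evolved \<nu> s (current W \<zeta> \<zeta>') - evolved \<nu> a (current W \<zeta> \<zeta>')\<bar> < j0 / 4"
    by blast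
  have "(\<lambda>n. \<bar>evolved \<nu> (t n) (current W \<zeta> \<zeta>')\<bar>) \<longlonglongrightarrow> j0"
    unfolding j0_def by (intro tendsto_rabs lim cc)
  then have ev: "\<forall>\<^sub>F n in sequentially. 3 / 4 * j0 < \<bar>evolved \<nu> (t n) (current W \<zeta> \<zeta>')\<bar>"
    by (rule order_tendstoD) (use j0 in simp)
  have mix_cur: "mixture s (current W \<zeta> \<zeta>') = evolved \<nu> s (current W \<zeta> \<zeta>') / 2" for s
    using balanced_gibbs W(1) by (simp add: mixture_def balanced_def)
  define V where "V n = real (card (lattice_box n :: 'd site set))" for n
  have Vpos: "V n > 0" for n by (simp add: V_def card_lattice_box)
  have j4: "0 < j0 / 4" using j0 by simp
  from entropy_decay[OF fin ex j4] obtain c0 :: real where c0: "0 < c0"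
    and dec: "\<And>e::real. 0 < e \<Longrightarrow> \<exists>n. \<forall>E. state E \<longrightarrow>
      (\<forall>f i. continuous_on UNIV f \<longrightarrow> E (\<lambda>\<omega>. f (shift i \<omega>)) = E f) \<longrightarrow>
      (\<forall>\<eta>. E (indicator (cyl (lattice_box n) \<eta>)) > 0) \<longrightarrow>
      entropy_rate E (lattice_box n) \<le> e * V n \<and>
      (j0 / 4 \<le> \<bar>E (current W \<zeta> \<zeta>')\<bar> \<longrightarrow> entropy_rate E (lattice_box n) \<le> (e - c0) * V n)"
    unfolding V_def by blast
  \<comment> \<open>One box is to serve the mixture at all positive times, so that the rates can be
    integrated over long intervals.\<close>
  define good where "good e n \<longleftrightarrow> (\<forall>s>0. entropy_rate (mixture s) (lattice_box n) \<le> e * V n \<and>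
      (j0 / 4 \<le> \<bar>mixture s (current W \<zeta> \<zeta>')\<bar> \<longrightarrow> entropy_rate (mixture s) (lattice_box n) \<le> (e - c0) * V n))" for e n
  have ex_good: "\<exists>n. good e n" if e: "0 < e" for e
  proof -
    obtain n where n: "\<And>E. state E \<Longrightarrow>
      (\<forall>f i. continuous_on UNIV f \<longrightarrow> E (\<lambda>\<omega>. f (shift i \<omega>)) = E f) \<Longrightarrow>
      (\<forall>\<eta>. E (indicator (cyl (lattice_box n) \<eta>)) > 0) \<Longrightarrow>
      entropy_rate E (lattice_box n) \<le> e * V n \<and>
      (j0 / 4 \<le> \<bar>E (current W \<zeta> \<zeta>')\<bar> \<longrightarrow> entropy_rate E (lattice_box n) \<le> (e - c0) * V n)"
      using dec[OF e] by blast
    have "good e n"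
      unfolding good_def
    proof (intro allI impI)
      fix s :: real assume "0 < s"
      then have s: "0 \<le> s" by simp
      show "entropy_rate (mixture s) (lattice_box n) \<le> e * V n \<and>
        (j0 / 4 \<le> \<bar>mixture s (current W \<zeta> \<zeta>')\<bar> \<longrightarrow> entropy_rate (mixture s) (lattice_box n) \<le> (e - c0) * V n)"
        by (rule n[OF state_mixture[OF s]]) (auto simp: mixture_shift[OF s] mixture_pos[OF s])
    qed
    then show ?thesis by blast
  qed
  \<comment> \<open>Entropy is followed from time 1 on, as its derivative is available at positive
    times. T depends on k and on the recurrence of the current, but neither on the tolerance nor on
    the box.\<close>
  have gain: "\<exists>T\<ge>1. \<forall>e n. good e n \<longrightarrow> entropy n T - entropy n 1 \<le> (e * (T - 1) - real k * (\<tau> * c0)) * V n" for k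
  proof (induction k)
    case 0
    show ?case by (intro exI[of _ 1]) simp
  next
    case (Suc k)
    then obtain T where T: "T \<ge> 1" "\<And>e n. good e n \<Longrightarrow> entropy n T - entropy n 1 \<le> (e * (T - 1) - real k * (\<tau> * c0)) * V n" by blast
    have "\<forall>\<^sub>F n in sequentially. T \<le> t n" using t by (simp add: filterlim_at_top)
    with ev have "\<forall>\<^sub>F n in sequentially. 3 / 4 * j0 < \<bar>evolved \<nu> (t n) (current W \<zeta> \<zeta>')\<bar> \<and> T \<le> t n"
      by eventually_elim simp
    from eventually_happens[OF this] obtain m where m: "3 / 4 * j0 < \<bar>evolved \<nu> (t m) (current W \<zeta> \<zeta>')\<bar>" "T \<le> t m" by auto
    have "entropy n (t m + \<tau>) - entropy n 1 \<le> (e * (t m + \<tau> - 1) - real (Suc k) * (\<tau> * c0)) * V n" if good: "good e n" for e n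
    proof -
      \<comment> \<open>Until \<open>t m\<close> only the error is controlled; during the next time
        span of length \<tau> the current yields one more gain.\<close>
      have "entropy n (t m) - entropy n T \<le> (e * V n) * (t m - T)"
        by (rule derivative_upper_bound[OF m(2), where h' = "\<lambda>s. entropy_rate (mixture s) (lattice_box n)"])
          (use T(1) good in \<open>auto intro!: entropy_derivative simp: good_def\<close>)
      moreover have "entropy n (t m + \<tau>) - entropy n (t m) \<le> ((e - c0) * V n) * (t m + \<tau> - t m)"
      proof (rule derivative_upper_bound[where h' = "\<lambda>s. entropy_rate (mixture s) (lattice_box n)"])
        fix s assume s: "t m \<le> s" "s \<le> t m + \<tau>"
        have s0: "0 < s" "0 \<le> t m" using s(1) m(2) T(1) by auto
        show "(entropy n has_real_derivative entropy_rate (mixture s) (lattice_box n)) (at s)"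
          by (rule entropy_derivative[OF s0(1)])
        have "j0 / 2 \<le> \<bar>evolved \<nu> s (current W \<zeta> \<zeta>')\<bar>"
          using \<tau>(2)[OF s0(2) s] m(1) by linarith
        then have "j0 / 4 \<le> \<bar>mixture s (current W \<zeta> \<zeta>')\<bar>" by (simp add: mix_cur)
        then show "entropy_rate (mixture s) (lattice_box n) \<le> (e - c0) * V n"
          using good s0(1) by (simp add: good_def)
      qed (use \<tau>(1) in simp)
      moreover note T(2)[OF good]
      ultimately have "entropy n (t m + \<tau>) - entropy n 1 \<le>
          (e * (T - 1) - real k * (\<tau> * c0)) * V n + (e * V n) * (t m - T) + ((e - c0) * V n) * \<tau>" by simp
      also have "\<dots> = (e * (t m + \<tau> - 1) - real (Suc k) * (\<tau> * c0)) * V n"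
        by (simp add: algebra_simps)
      finally show ?thesis .
    qed
    then show ?case using T(1) m(2) \<tau>(1) by (intro exI[of _ "t m + \<tau>"]) auto
  qed
  \<comment> \<open>L bounds the entropy per site. The gains are made to exceed it by more than 1,
    and the tolerance \<open>1 / T\<close> keeps the accumulated error below 1.\<close>
  define L where "L = ln (1 / nonnull_bound)"
  have "0 < \<tau> * c0" using \<tau>(1) c0 by simp
  from reals_Archimedean3[OF this] obtain k where k: "L + 1 < real k * (\<tau> * c0)" by blast
  obtain T where T: "T \<ge> 1" "\<And>e n. good e n \<Longrightarrow> entropy n T - entropy n 1 \<le> (e * (T - 1) - real k * (\<tau> * c0)) * V n"
    using gain[of k] by blast
  obtain n where n: "good (1 / T) n" using ex_good[of "1 / T"] T(1) by auto
  have "1 / T * (T - 1) \<le> 1" using T(1) by (simp add: field_simps)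
  then have "1 / T * (T - 1) - real k * (\<tau> * c0) < - L" using k by linarith
  then have "(1 / T * (T - 1) - real k * (\<tau> * c0)) * V n < - L * V n" using Vpos[of n] by (rule mult_strict_right_mono)
  moreover have "- L * V n \<le> entropy n T - entropy n 1"
    using entropy_nonneg[of T n] entropy_le[of 1 n] T(1) by (simp add: L_def V_def)
  ultimately show False using T(2)[OF n] by linarith
qed

end

theorem theorem2p12:
  fixes c :: "('d::finite, 'q::finite) rates"
    and P :: "real \<Rightarrow> ('d, 'q) cont \<Rightarrow> ('d, 'q) cont"
    and \<gamma> :: "('d, 'q) kernels"
    and \<mu> \<nu> \<nu>_lim :: "('d, 'q) config measure"
    and \<nu>_seq :: "nat \<Rightarrow> ('d, 'q) config measure"
    and t :: "nat \<Rightarrow> real"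
  assumes "well_defined_ips c"
    and "ips_semigroup c P"
    and "translation_invariant_rates c"
    and "finitely_many_types c"
    and "uniformly_continuous_rates c"
    and "positive_minimal_rates c"
    and "irreducible_ips c"
    and "is_specification \<gamma>"
    and "translation_invariant_spec \<gamma>"
    and "non_null \<gamma>"
    and "quasilocal \<gamma>"
    and "\<mu> \<in> gibbs_measures \<gamma>"
    and "reversible P \<mu>"
    and "translation_invariant_measure \<mu>"
    and "asymptotically_decoupled \<mu>"
    and "\<nu> \<in> prob_measures"
    and "translation_invariant_measure \<nu>"
    and "\<And>n. 0 \<le> t n"
    and "incseq t"
    and "filterlim t at_top sequentially"
    and "\<And>n. time_evolved P (t n) \<nu> (\<nu>_seq n)"
    and "\<nu>_lim \<in> prob_measures"
    and "weakly_converges \<nu>_seq \<nu>_lim"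
  shows "\<nu>_lim \<in> gibbs_measures \<gamma>"
proof -
  interpret gibbsian_kernels \<gamma> by unfold_locales fact+
  interpret ips_dynamics c P
    using assms by unfold_locales (auto simp: well_defined_ips_def)
  have \<mu>: "\<mu> \<in> prob_measures" using assms(12) by (simp add: gibbs_measures_def)
  \<comment> \<open>Reversibility enters as the vanishing of all currents of \<mu>.\<close>
  interpret reversible_gibbs_dynamics \<gamma> c \<mu> P \<nu>
    using assms reversible_balanced[OF \<mu>] by unfold_locales
  have "balanced \<nu>_lim"
  proof (rule limit_balanced[OF assms(20)])
    fix f :: "('d, 'q) config \<Rightarrow> real" assume f: "continuous_on UNIV f"
    have "(\<lambda>n. \<integral>\<omega>. apply_bcontfun (Bcontfun f) \<omega> \<partial>\<nu>_seq n) \<longlonglongrightarrow> (\<integral>\<omega>. apply_bcontfun (Bcontfun f) \<omega> \<partial>\<nu>_lim)"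
      using assms(23) unfolding weakly_converges_def by blast
    moreover have "(\<integral>\<omega>. apply_bcontfun (Bcontfun f) \<omega> \<partial>\<nu>_seq n) = evolved \<nu> (t n) f" for n
      using assms(21)[of n] unfolding time_evolved_def evolved_def by blast
    ultimately show "(\<lambda>n. evolved \<nu> (t n) f) \<longlonglongrightarrow> (\<integral>\<omega>. f \<omega> \<partial>\<nu>_lim)" by (simp add: f)
  qed
  then show ?thesis by (rule balanced_imp_gibbs[OF assms(22) _ assms(7)])
qed

end
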